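(* Let $E\to M$ be a 4-form twisted Courant algebroid with local structure data $(\eta_{ab},\rho_a{}^\mu,C_{abc},H_{\mu\nu\kappa\lambda})$, let $\nabla$ be a vector bundle connection on $TM\oplus E$, and let $Q^H=Q^\alpha_{\nabla}\mathrm D_\alpha$ be the homological vector field of the twisted Courant algebroid in covariant form. The BRST transformations on the fields $\phi=(\phi^\alpha_\nabla)=(X^\mu,A^a,B^\nabla_\mu)$, the ghosts $\epsilon=(\epsilon^\alpha_\nabla)=(0,\epsilon^a,-\psi^\nabla_\mu)$ and the ghost for ghost $\widetilde\epsilon=(\widetilde\epsilon^{\,\alpha}_\nabla)=(0,0,-\widetilde\psi^\nabla_\mu)$ of the 4-form twisted Courant sigma model with source $T[1]\Sigma$ and target the graded manifold $\mathcal M$ with coordinates $(x^\alpha)=(x^\mu,a^a,b^\nabla_\mu)$ of degrees $(0,1,2)$ are given in terms of $Q^H$ and in tensorial form as $s_0^\nabla\phi=s_0^\nabla\phi^\alpha_\nabla\otimes e_\alpha$ (and similarly for $\epsilon$ and $\widetilde\epsilon$), with (pull-backs implicit) $$\begin{aligned}s_0^\nabla\phi^\alpha_\nabla&=\mathrm D\epsilon^\alpha_\nabla+\epsilon^\beta_\nabla\mathrm D_\beta Q^\alpha_\nabla+s^\nabla_{\rm triv}\phi^\alpha_\nabla,\\ s_0^\nabla\epsilon^\alpha_\nabla&=\mathrm D\widetilde\epsilon^{\,\alpha}_\nabla-\widetilde\epsilon^{\,\beta}_\nabla\mathrm D_\beta Q^\alpha_\nabla-\tfrac12\epsilon^\beta_\nabla\epsilon^\gamma_\nabla\mathrm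 D_\beta\mathrm D_\gamma Q^\alpha_\nabla+s^\nabla_{\rm triv}\epsilon^\alpha_\nabla,\\ s_0^\nabla\widetilde\epsilon^{\,\alpha}_\nabla&=\widetilde\epsilon^{\,\beta}_\nabla\epsilon^\gamma_\nabla\mathrm D_\beta\mathrm D_\gamma Q^\alpha_\nabla+\tfrac1{3!}\epsilon^\beta_\nabla\epsilon^\gamma_\nabla\epsilon^\delta_\nabla\mathrm D_\beta\mathrm D_\gamma\mathrm D_\delta Q^\alpha_\nabla,\end{aligned}$$ where $\mathrm D$ (without index) is the exterior covariant derivative on $\Sigma$, $\mathrm D_\alpha$ are the covariant derivations of degrees $0,-1,-2$ on $\mathcal M$, and the terms $s^\nabla_{\rm triv}$ vanish on the stationary surface.
   Context: **Structure data.** $M$ is a smooth manifold with local coordinates $x^\mu$, $E\to M$ a vector bundle with local frame $\mathfrak e_a$ and pulled-back frame $e_a$. $\eta_{ab}$ are the components of a nondegenerate symmetric fibre metric (normalised as $\eta_{ab}=2\langle\mathfrak e_a,\mathfrak e_b\rangle$; inverse $\eta^{ab}$; Latin indices are raised and lowered with it, e.g. $C_{abc}=\eta_{cd}C^d_{ab}$), $\rho_a{}^\mu(x)$ the components of the anchor $\rho:E\to TM$, $C^c_{ab}(x)$ the structure functions of the (skew-symmetric) Courant bracket, and $H$ a closed 4-form on $M$ with components $H_{\mu\nu\kappa\lambda}$. They are local data of a 4-form twisted Courant algebroid if (i) $\eta^{ab}\rho_a{}^\mu\rho_b{}^\nu=0$; (ii) $\rho_b{}^\mu\partial_\mu\rho_a{}^\nu-\rho_a{}^\mu\partial_\mu\rho_b{}^\nu+\eta^{ef}\rho_e{}^\nu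 C_{fab}=0$; (iii) $\rho_d{}^\mu\partial_\mu C_{abc}-\rho_a{}^\mu\partial_\mu C_{bcd}+\rho_b{}^\mu\partial_\mu C_{cda}-\rho_c{}^\mu\partial_\mu C_{dab}+\eta^{ef}(C_{eab}C_{cdf}+C_{eac}C_{dbf}+C_{ead}C_{bcf})=-\rho_d{}^\mu\rho_a{}^\nu\rho_b{}^\kappa\rho_c{}^\lambda H_{\mu\nu\kappa\lambda}$. Notation: $H_{\mu\nu\rho a}=\rho_a{}^\kappa H_{\mu\nu\rho\kappa}$, $H_{\mu\nu ab}=\rho_a{}^\kappa\rho_b{}^\lambda H_{\mu\nu\kappa\lambda}$, $H_{\mu abc}=\rho_a{}^\kappa\rho_b{}^\lambda\rho_c{}^\nu H_{\mu\kappa\lambda\nu}$. Brackets $(\,)$, $[\,]$ on indices denote weight-one (anti)symmetrization. **Connection and tensors.** $\nabla$ is a vector bundle connection on $TM\oplus E$ with coefficients $\Gamma^\nu_{\mu\sigma}$ on $TM$ and $\omega^b_{\mu a}=\omega_{\mu a}{}^b$ on $E$; $\omega_{\mu ab}=\omega_{\mu a}{}^c\eta_{cb}$. Its torsionless part is denoted $\mathring\nabla$, with coefficients $\mathring\Gamma^\nu_{\mu\sigma}$ on $TM$. $R^c{}_{b\mu\nu}$ is the curvature of $\nabla$ on $E$, $R_{ab\mu\nu}=\eta_{ac}R^c{}_{b\mu\nu}$. Also $\nabla_\mu\rho_a{}^\nu=\partial_\mu\rho_a{}^\nu+\Gamma^\nu_{\mu\sigma}\rho_a{}^\sigma-\omega^b_{\mu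 a}\rho_b{}^\nu$. The induced $E$-connection on $E$, $\nabla^E_e e'=\nabla_{\rho(e)}e'$, has coefficients $\omega^c_{ab}=\rho_a{}^\mu\omega^c_{\mu b}$. Its Gualtieri torsion is $\mathcal T_{abc}=\omega^d_{[ab]}\eta_{cd}-\frac12C^d_{ab}\eta_{dc}+\frac12\omega^d_{c[a}\eta_{b]d}$. The basic curvature is $\mathcal S_{\mu abc}=-\nabla_\mu\mathcal T_{abc}-\mathcal C_{\mu[ab]c}-\frac12\mathcal C_{\mu c[ab]}$ with $\mathcal C_{\mu ab}{}^c=\rho_a{}^\nu R^c{}_{b\nu\mu}$, and $\widetilde{\mathcal S}_{\mu abc}=\mathcal S_{\mu abc}+\frac12H_{\mu abc}$. **Covariant homological vector field.** On the graded manifold $\mathcal M$ with coordinates $(x^\mu,a^a,b_\mu)$ of degrees $(0,1,2)$ put $b^\nabla_\mu=b_\mu+\frac12\omega_{\mu ab}a^aa^b$. The derivations $(\mathrm D_\alpha)=(\mathrm D^{(0)}_\mu,\mathrm D^{(-1)}_a,\mathrm D^\mu_{(-2)})$ are $$\mathrm D^{(0)}_\mu=\frac{\partial}{\partial x^\mu}-\frac12\frac{\partial\omega_{\nu bc}}{\partial x^\mu}a^ba^c\frac{\partial}{\partial b_\nu}+\Gamma^\sigma_{\nu\mu}b^\nabla_\sigma\frac{\partial}{\partial b_\nu}-\omega_{\mu b}{}^ca^b\mathrm D^{(-1)}_c,\quad \mathrm D^{(-1)}_a=\frac{\partial}{\partial a^a}+\omega_{\mu ba}a^b\frac{\partial}{\partial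 b_\mu},\quad \mathrm D^\mu_{(-2)}=\frac{\partial}{\partial b^\nabla_\mu},$$ acting on the coordinates as $\mathrm D^{(0)}_\mu x^\nu=\delta_\mu^\nu$, $\mathrm D^{(0)}_\mu a^c=-\omega_{\mu b}{}^ca^b$, $\mathrm D^{(0)}_\nu b^\nabla_\mu=\Gamma^\sigma_{\mu\nu}b^\nabla_\sigma$; $\mathrm D^{(-1)}_ax^\mu=0$, $\mathrm D^{(-1)}_aa^c=\delta^c_a$, $\mathrm D^{(-1)}_ab^\nabla_\mu=0$; $\mathrm D^\mu_{(-2)}x^\nu=0$, $\mathrm D^\mu_{(-2)}a^c=0$, $\mathrm D^\mu_{(-2)}b^\nabla_\nu=\delta^\mu_\nu$. The homological vector field is $Q^H=Q^\alpha_\nabla\mathrm D_\alpha$ with $$Q^\mu_\nabla=a^a\rho_a{}^\mu,\quad Q^a_\nabla=-\eta^{ab}\rho_b{}^\mu b^\nabla_\mu+\mathcal T_{bc}{}^aa^ba^c,\quad Q^\nabla_\mu=-\nabla_\mu\rho_a{}^\nu b^\nabla_\nu a^a-\tfrac13\widetilde{\mathcal S}_{\mu abc}a^aa^ba^c .$$ **Model and the transformation $s_0$.** $\Sigma$ is a 3-manifold without boundary, $\Sigma=\partial\widehat\Sigma$; fields: a map $X:\Sigma\to M$, 1-forms $A^a$, 2-forms $B_\mu$; structure functions are evaluated at $X$; action $S_{\rm cl}=\int_{T[1]\Sigma}(-B_\mu\mathrm dX^\mu+\frac12\eta_{ab}A^a\mathrm dA^b+\rho_a{}^\mu B_\mu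 A^a+\frac1{3!}C_{abc}A^aA^bA^c)+\int_{\widehat\Sigma}X^*H$. Ghosts as (ghost degree, form degree): $\epsilon^a(1,0)$, $\psi_\mu(1,1)$, $\widetilde\psi_\mu(2,0)$. Signs: $\alpha_1\alpha_2=(-1)^{f_1f_2+g_1g_2}\alpha_2\alpha_1$ for form degrees $f_i$, ghost degrees $g_i$. Put $F^\mu=\mathrm dX^\mu-\rho_a{}^\mu A^a$, $G^a=\mathrm dA^a+\eta^{ab}\rho_b{}^\mu B_\mu+\frac12C^a_{bc}A^bA^c$; the stationary surface is where the field equations hold (in particular $F^\mu=0$, $G^a=0$). The on-shell closed BRST transformation $s_0$ is: $s_0X^\mu=\rho_a{}^\mu\epsilon^a$; $s_0A^a=\mathrm d\epsilon^a+\eta^{ab}\rho_b{}^\mu\psi_\mu+C^a_{bc}A^b\epsilon^c$; $s_0B_\mu=-\mathrm d\psi_\mu-\partial_\mu\rho_a{}^\nu(B_\nu\epsilon^a-\psi_\nu A^a)-\frac12(\partial_\mu C_{abc}+H_{\mu abc})A^aA^b\epsilon^c-\frac12H_{\mu\nu ab}\epsilon^aA^bF^\nu-\frac16H_{\mu\nu\lambda a}\epsilon^aF^\nu F^\lambda$; $s_0\epsilon^a=-\eta^{ab}(\rho_b{}^\mu\widetilde\psi_\mu+\frac12C_{bcd}\epsilon^c\epsilon^d)$; $s_0\psi_\mu=\mathrm d\widetilde\psi_\mu+\partial_\mu\rho_a{}^\nu(\widetilde\psi_\nu A^a+\psi_\nu\epsilon^a)+\frac12(\partial_\mu C_{abc}+H_{\mu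 abc})A^a\epsilon^b\epsilon^c+\frac14H_{\mu\nu ab}\epsilon^a\epsilon^bF^\nu$; $s_0\widetilde\psi_\mu=-\partial_\mu\rho_a{}^\nu\widetilde\psi_\nu\epsilon^a-\frac16(\partial_\mu C_{abc}+H_{\mu abc})\epsilon^a\epsilon^b\epsilon^c$. **Covariant fields and the transformation $s_0^\nabla$.** $B^\nabla_\mu=B_\mu+\frac12\omega_{\mu ab}A^aA^b$, $\psi^\nabla_\mu=\psi_\mu+\omega_{\mu ab}A^a\epsilon^b$, $\widetilde\psi^\nabla_\mu=\widetilde\psi_\mu+\frac12\omega_{\mu ab}\epsilon^a\epsilon^b$. $\mathrm D$ is the exterior covariant derivative on $\Sigma$ induced by $\nabla$ via pull-back along $X$. To account for the transformation of the pulled-back frame one uses the tensorial version $\bar s_0$ of $s_0$: $\bar s_0X^\mu=s_0X^\mu$, $\bar s_0V^a=s_0V^a+\omega^a_{\mu b}(s_0X^\mu)V^b$ for $V^a=A^a,\epsilon^a$, and $\bar s_0V_\mu=s_0V_\mu-\mathring\Gamma^\nu_{\mu\sigma}(s_0X^\sigma)V_\nu$ for $V_\mu=B^\nabla_\mu,\psi^\nabla_\mu,\widetilde\psi^\nabla_\mu$. Then $s_0^\nabla=\bar s_0$ on $X^\mu,\epsilon^a,\widetilde\psi^\nabla_\mu$, and $s_0^\nabla A^a=\bar s_0A^a+\omega^a_{\mu b}F^\mu\epsilon^b$; $s_0^\nabla\psi^\nabla_\mu=\bar s_0\psi^\nabla_\mu-\mathring\Gamma^\nu_{\mu\sigma}\widetilde\psi^\nabla_\nu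 F^\sigma+\frac12(\partial_{(\mu}\omega_{\nu)ab}+\omega^d_{[\mu a}\omega_{\nu]bd})F^\nu\epsilon^a\epsilon^b$; $s_0^\nabla B^\nabla_\mu=\bar s_0B^\nabla_\mu-\mathring\Gamma^\nu_{\mu\sigma}\psi^\nabla_\nu F^\sigma-(\partial_{(\mu}\omega_{\nu)ab}+\omega^d_{[\mu a}\omega_{\nu]bd})F^\nu A^a\epsilon^b-\omega_{\mu ab}G^a\epsilon^b$. With graded signs in the collective formulas understood accordingly, they read in components: $s_0^\nabla X^\mu=\rho_a{}^\mu\epsilon^a$; $s_0^\nabla\epsilon^a=-\eta^{ab}\rho_b{}^\mu\widetilde\psi^\nabla_\mu+\eta^{ab}\mathcal T_{cdb}\epsilon^c\epsilon^d$; $s_0^\nabla A^a=\mathrm D\epsilon^a+\eta^{ab}\rho_b{}^\mu\psi^\nabla_\mu-2\eta^{ab}\mathcal T_{cdb}A^c\epsilon^d$; $s_0^\nabla\widetilde\psi^\nabla_\mu=-\nabla_\mu\rho_a{}^\nu\widetilde\psi^\nabla_\nu\epsilon^a-\frac13\widetilde{\mathcal S}_{\mu abc}\epsilon^a\epsilon^b\epsilon^c$; $s_0^\nabla\psi^\nabla_\mu=\mathrm D\widetilde\psi^\nabla_\mu+\nabla_\mu\rho_a{}^\nu(\widetilde\psi^\nabla_\nu A^a+\psi^\nabla_\nu\epsilon^a)+\widetilde{\mathcal S}_{\mu abc}A^a\epsilon^b\epsilon^c+s^\nabla_{\rm triv}\psi^\nabla_\mu$, $s^\nabla_{\rm triv}\psi^\nabla_\mu=\frac14(H_{\mu\nu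 ab}-R_{ab\mu\nu})\epsilon^a\epsilon^bF^\nu$; $s_0^\nabla B^\nabla_\mu=-\mathrm D\psi^\nabla_\mu+\nabla_\mu\rho_a{}^\nu(\psi^\nabla_\nu A^a-B^\nabla_\nu\epsilon^a)-\widetilde{\mathcal S}_{\mu abc}A^aA^b\epsilon^c+s^\nabla_{\rm triv}B^\nabla_\mu$, $s^\nabla_{\rm triv}B^\nabla_\mu=-\frac12(H_{\mu\nu ab}-R_{ab\mu\nu})\epsilon^aA^bF^\nu-\frac16H_{\mu\nu\sigma a}\epsilon^aF^\nu F^\sigma$; all other $s^\nabla_{\rm triv}$ vanish.
   Formalization: The connection on E is taken compatible with the fibre metric (needed for D_a b^∇ = 0), and Q^H, D_α and D are built from the torsionless part of ∇, as s_0^∇ is; with torsion or a non-metric ω the printed formulas fail. *)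

theory Defs
  imports "HOL-Analysis.Analysis"
begin

text \<open>
  Everything is written in a chart \<^term>\<open>U\<close>, an open subset of \<^typ>\<open>real ^ 'm\<close>, over which
  \<open>E\<close> is trivialised by a frame indexed by \<^typ>\<open>'a\<close>: Greek indices have type \<^typ>\<open>'m\<close>, Latin ones
  type \<^typ>\<open>'a\<close>.  The frame is one in which the fibre metric has constant components, as is implicit
  in structure equations that contain no derivative of \<open>\<eta>\<close>.
\<close>

section \<open>Smooth functions on a chart\<close>

definition pdiff :: "'m::finite \<Rightarrow> (real^'m \<Rightarrow> real) \<Rightarrow> real^'m \<Rightarrow> real" where
  "pdiff \<mu> f x = frechet_derivative f (at x) (axis \<mu> 1)"

definition smooth_fun :: "(real^'m::finite) set \<Rightarrow> (real^'m \<Rightarrow> real) \<Rightarrow> bool" where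
  "smooth_fun U f \<longleftrightarrow> (\<forall>\<mu>s. \<forall>x\<in>U. foldr pdiff \<mu>s f differentiable (at x))"

section \<open>Twisted Courant algebroids: local data\<close>

text \<open>\<^term>\<open>rho K a \<mu>\<close> is $\rho_a{}^\mu$; \<^term>\<open>cst K a b c\<close> is $C_{abc}$.\<close>

record ('m::finite, 'a::finite) courant_data =
  eta :: "real^'a^'a"
  rho :: "'a \<Rightarrow> 'm \<Rightarrow> real^'m \<Rightarrow> real"
  cst :: "'a \<Rightarrow> 'a \<Rightarrow> 'a \<Rightarrow> real^'m \<Rightarrow> real"
  hfl :: "'m \<Rightarrow> 'm \<Rightarrow> 'm \<Rightarrow> 'm \<Rightarrow> real^'m \<Rightarrow> real"

definition etai :: "('m::finite, 'a::finite) courant_data \<Rightarrow> 'a \<Rightarrow> 'a \<Rightarrow> real" where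
  "etai K a b = matrix_inv (eta K) $ a $ b"

text \<open>$C^c_{ab}$, with the upper index first.\<close>

definition cst_up :: "('m::finite, 'a::finite) courant_data \<Rightarrow> 'a \<Rightarrow> 'a \<Rightarrow> 'a \<Rightarrow> real^'m \<Rightarrow> real" where
  "cst_up K c a b x = (\<Sum>d\<in>UNIV. etai K c d * cst K a b d x)"

text \<open>$H_{\mu\nu\sigma a}$, $H_{\mu\nu ab}$ and $H_{\mu abc}$.\<close>

definition hfl1 :: "('m::finite, 'a::finite) courant_data \<Rightarrow> 'm \<Rightarrow> 'm \<Rightarrow> 'm \<Rightarrow> 'a \<Rightarrow> real^'m \<Rightarrow> real" where
  "hfl1 K \<mu> \<nu> \<sigma> a x = (\<Sum>\<kappa>\<in>UNIV. rho K a \<kappa> x * hfl K \<mu> \<nu> \<sigma> \<kappa> x)"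

definition hfl2 :: "('m::finite, 'a::finite) courant_data \<Rightarrow> 'm \<Rightarrow> 'm \<Rightarrow> 'a \<Rightarrow> 'a \<Rightarrow> real^'m \<Rightarrow> real" where
  "hfl2 K \<mu> \<nu> a b x = (\<Sum>\<kappa>\<in>UNIV. \<Sum>\<tau>\<in>UNIV. rho K a \<kappa> x * rho K b \<tau> x * hfl K \<mu> \<nu> \<kappa> \<tau> x)"

definition hfl3 :: "('m::finite, 'a::finite) courant_data \<Rightarrow> 'm \<Rightarrow> 'a \<Rightarrow> 'a \<Rightarrow> 'a \<Rightarrow> real^'m \<Rightarrow> real" where
  "hfl3 K \<mu> a b c x =
     (\<Sum>\<kappa>\<in>UNIV. \<Sum>\<tau>\<in>UNIV. \<Sum>\<nu>\<in>UNIV. rho K a \<kappa> x * rho K b \<tau> x * rho K c \<nu> x * hfl K \<mu> \<kappa> \<tau> \<nu> x)"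

text \<open>
  Besides skew-symmetry of the bracket, the total antisymmetry of $C_{abc}$ encodes the invariance
  of the fibre metric, which in a frame with constant \<open>\<eta>\<close> reads $C_{abc} = -C_{acb}$.
\<close>

definition twisted_courant :: "(real^'m::finite) set \<Rightarrow> ('m, 'a::finite) courant_data \<Rightarrow> bool" where
  "twisted_courant U K \<longleftrightarrow>
     open U \<and> transpose (eta K) = eta K \<and> invertible (eta K) \<and>
     (\<forall>a \<mu>. smooth_fun U (rho K a \<mu>)) \<and>
     (\<forall>a b c. smooth_fun U (cst K a b c)) \<and>
     (\<forall>\<mu> \<nu> \<kappa> \<tau>. smooth_fun U (hfl K \<mu> \<nu> \<kappa> \<tau>)) \<and>
     (\<forall>x\<in>U. \<forall>a b c. cst K a b c x = - cst K b a c x \<and> cst K a b c x = - cst K a c b x) \<and>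
     (\<forall>x\<in>U. \<forall>\<mu> \<nu> \<kappa> \<tau>. hfl K \<mu> \<nu> \<kappa> \<tau> x = - hfl K \<nu> \<mu> \<kappa> \<tau> x \<and>
        hfl K \<mu> \<nu> \<kappa> \<tau> x = - hfl K \<mu> \<kappa> \<nu> \<tau> x \<and> hfl K \<mu> \<nu> \<kappa> \<tau> x = - hfl K \<mu> \<nu> \<tau> \<kappa> x) \<and>
     (\<forall>x\<in>U. \<forall>\<mu> \<nu> \<kappa> \<tau> \<sigma>.
        pdiff \<mu> (hfl K \<nu> \<kappa> \<tau> \<sigma>) x - pdiff \<nu> (hfl K \<mu> \<kappa> \<tau> \<sigma>) x + pdiff \<kappa> (hfl K \<mu> \<nu> \<tau> \<sigma>) x
        - pdiff \<tau> (hfl K \<mu> \<nu> \<kappa> \<sigma>) x + pdiff \<sigma> (hfl K \<mu> \<nu> \<kappa> \<tau>) x = 0) \<and>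
     (\<forall>x\<in>U. \<forall>\<mu> \<nu>. (\<Sum>a\<in>UNIV. \<Sum>b\<in>UNIV. etai K a b * rho K a \<mu> x * rho K b \<nu> x) = 0) \<and>
     (\<forall>x\<in>U. \<forall>a b \<nu>.
        (\<Sum>\<mu>\<in>UNIV. rho K b \<mu> x * pdiff \<mu> (rho K a \<nu>) x - rho K a \<mu> x * pdiff \<mu> (rho K b \<nu>) x)
        + (\<Sum>e\<in>UNIV. \<Sum>f\<in>UNIV. etai K e f * rho K e \<nu> x * cst K f a b x) = 0) \<and>
     (\<forall>x\<in>U. \<forall>a b c d.
        (\<Sum>\<mu>\<in>UNIV. rho K d \<mu> x * pdiff \<mu> (cst K a b c) x - rho K a \<mu> x * pdiff \<mu> (cst K b c d) x
              + rho K b \<mu> x * pdiff \<mu> (cst K c d a) x - rho K c \<mu> x * pdiff \<mu> (cst K d a b) x)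
        + (\<Sum>e\<in>UNIV. \<Sum>f\<in>UNIV. etai K e f *
             (cst K e a b x * cst K c d f x + cst K e a c x * cst K d b f x + cst K e a d x * cst K b c f x))
        = - (\<Sum>\<mu>\<in>UNIV. \<Sum>\<nu>\<in>UNIV. \<Sum>\<kappa>\<in>UNIV. \<Sum>\<tau>\<in>UNIV.
               rho K d \<mu> x * rho K a \<nu> x * rho K b \<kappa> x * rho K c \<tau> x * hfl K \<mu> \<nu> \<kappa> \<tau> x))"

section \<open>Connections and tensors\<close>

text \<open>
  \<^term>\<open>gam N \<nu> \<mu> \<sigma>\<close> is $\Gamma^\nu_{\mu\sigma}$, so that
  $\nabla_\mu V^\nu = \partial_\mu V^\nu + \Gamma^\nu_{\mu\sigma} V^\sigma$, and \<^term>\<open>omg N \<mu> a b\<close> is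
  $\omega_{\mu a}{}^b$, so that $\nabla_\mu \mathfrak{e}_a = \omega_{\mu a}{}^b \mathfrak{e}_b$.
\<close>

record ('m::finite, 'a::finite) connection =
  gam :: "'m \<Rightarrow> 'm \<Rightarrow> 'm \<Rightarrow> real^'m \<Rightarrow> real"
  omg :: "'m \<Rightarrow> 'a \<Rightarrow> 'a \<Rightarrow> real^'m \<Rightarrow> real"

definition smooth_connection :: "(real^'m::finite) set \<Rightarrow> ('m, 'a::finite) connection \<Rightarrow> bool" where
  "smooth_connection U N \<longleftrightarrow>
     (\<forall>\<nu> \<mu> \<sigma>. smooth_fun U (gam N \<nu> \<mu> \<sigma>)) \<and> (\<forall>\<mu> a b. smooth_fun U (omg N \<mu> a b))"

text \<open>
  The covariant transformation is built with $\mathring\Gamma$, hence so must be the derivations, the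
  components of $Q^H$ and the derivative on \<open>\<Sigma>\<close> to which it is compared: with the coefficients of a
  connection with torsion in $\nabla_\mu\rho_a{}^\nu$ the transformation of $\widetilde\psi^\nabla_\mu$ would differ
  by a torsion term.  For \<open>\<nabla>\<close> torsion-free on the tangent bundle, \<open>torsionless_id\<close> gives
  $\mathring\nabla = \nabla$.
\<close>

definition torsionless :: "('m::finite, 'a::finite) connection \<Rightarrow> ('m, 'a) connection" where
  "torsionless N = N\<lparr>gam := \<lambda>\<nu> \<mu> \<sigma> x. (gam N \<nu> \<mu> \<sigma> x + gam N \<nu> \<sigma> \<mu> x) / 2\<rparr>"

lemma torsionless_id:
  assumes "\<And>\<nu> \<mu> \<sigma>. gam N \<nu> \<mu> \<sigma> = gam N \<nu> \<sigma> \<mu>"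
  shows "torsionless N = N"
proof -
  have "(gam N \<nu> \<mu> \<sigma> x + gam N \<nu> \<sigma> \<mu> x) / 2 = gam N \<nu> \<mu> \<sigma> x" for \<nu> \<mu> \<sigma> x
    using fun_cong[OF assms[of \<nu> \<mu> \<sigma>], of x] by simp
  then show ?thesis
    unfolding torsionless_def by (cases N) simp
qed

definition om_low :: "('m::finite, 'a::finite) courant_data \<Rightarrow> ('m, 'a) connection \<Rightarrow>
    'm \<Rightarrow> 'a \<Rightarrow> 'a \<Rightarrow> real^'m \<Rightarrow> real" where
  "om_low K N \<mu> a b x = (\<Sum>c\<in>UNIV. omg N \<mu> a c x * eta K $ c $ b)"

text \<open>
  Compatibility with the (constant) fibre metric.  It is what makes $\mathrm{D}^{(-1)}_a b^\nabla_\mu = 0$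
  hold: the left-hand side is the symmetric part of $\omega_{\mu ab}$ contracted with $a^b$.
\<close>

definition metric_connection :: "(real^'m::finite) set \<Rightarrow> ('m, 'a::finite) courant_data \<Rightarrow>
    ('m, 'a) connection \<Rightarrow> bool" where
  "metric_connection U K N \<longleftrightarrow> (\<forall>x\<in>U. \<forall>\<mu> a b. om_low K N \<mu> a b x + om_low K N \<mu> b a x = 0)"

text \<open>$\nabla_\mu\rho_a{}^\nu$.\<close>

definition nabla_rho :: "('m::finite, 'a::finite) courant_data \<Rightarrow> ('m, 'a) connection \<Rightarrow>
    'm \<Rightarrow> 'a \<Rightarrow> 'm \<Rightarrow> real^'m \<Rightarrow> real" where
  "nabla_rho K N \<mu> a \<nu> x = pdiff \<mu> (rho K a \<nu>) x
     + (\<Sum>\<sigma>\<in>UNIV. gam N \<nu> \<mu> \<sigma> x * rho K a \<sigma> x) - (\<Sum>b\<in>UNIV. omg N \<mu> a b x * rho K b \<nu> x)"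

text \<open>Coefficients $\omega^c_{ab}$ of the induced \<open>E\<close>-connection, upper index first.\<close>

definition omE :: "('m::finite, 'a::finite) courant_data \<Rightarrow> ('m, 'a) connection \<Rightarrow>
    'a \<Rightarrow> 'a \<Rightarrow> 'a \<Rightarrow> real^'m \<Rightarrow> real" where
  "omE K N c a b x = (\<Sum>\<mu>\<in>UNIV. rho K a \<mu> x * omg N \<mu> b c x)"

definition gualtieri_torsion :: "('m::finite, 'a::finite) courant_data \<Rightarrow> ('m, 'a) connection \<Rightarrow>
    'a \<Rightarrow> 'a \<Rightarrow> 'a \<Rightarrow> real^'m \<Rightarrow> real" where
  "gualtieri_torsion K N a b c x =
     (\<Sum>d\<in>UNIV. 1/2 * (omE K N d a b x - omE K N d b a x) * eta K $ c $ d)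
     - 1/2 * (\<Sum>d\<in>UNIV. cst_up K d a b x * eta K $ d $ c)
     + 1/2 * (\<Sum>d\<in>UNIV. 1/2 * (omE K N d c a x * eta K $ b $ d - omE K N d c b x * eta K $ a $ d))"

text \<open>$\mathcal{T}_{bc}{}^a$, with the raised index last.\<close>

definition gualtieri_torsion_up :: "('m::finite, 'a::finite) courant_data \<Rightarrow> ('m, 'a) connection \<Rightarrow>
    'a \<Rightarrow> 'a \<Rightarrow> 'a \<Rightarrow> real^'m \<Rightarrow> real" where
  "gualtieri_torsion_up K N b c a x = (\<Sum>d\<in>UNIV. etai K a d * gualtieri_torsion K N b c d x)"

text \<open>
  $R^c{}_{b\mu\nu}$, upper index first:
  $[\nabla_\mu,\nabla_\nu]\,\mathfrak{e}_b = R^c{}_{b\mu\nu}\,\mathfrak{e}_c$.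
\<close>

definition curv :: "('m::finite, 'a::finite) connection \<Rightarrow> 'a \<Rightarrow> 'a \<Rightarrow> 'm \<Rightarrow> 'm \<Rightarrow> real^'m \<Rightarrow> real" where
  "curv N c b \<mu> \<nu> x = pdiff \<mu> (omg N \<nu> b c) x - pdiff \<nu> (omg N \<mu> b c) x
     + (\<Sum>d\<in>UNIV. omg N \<mu> d c x * omg N \<nu> b d x - omg N \<nu> d c x * omg N \<mu> b d x)"

definition curv_low :: "('m::finite, 'a::finite) courant_data \<Rightarrow> ('m, 'a) connection \<Rightarrow>
    'a \<Rightarrow> 'a \<Rightarrow> 'm \<Rightarrow> 'm \<Rightarrow> real^'m \<Rightarrow> real" where
  "curv_low K N a b \<mu> \<nu> x = (\<Sum>c\<in>UNIV. eta K $ a $ c * curv N c b \<mu> \<nu> x)"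

text \<open>$\mathcal{C}_{\mu abc}$, the last index lowered.\<close>

definition calC :: "('m::finite, 'a::finite) courant_data \<Rightarrow> ('m, 'a) connection \<Rightarrow>
    'm \<Rightarrow> 'a \<Rightarrow> 'a \<Rightarrow> 'a \<Rightarrow> real^'m \<Rightarrow> real" where
  "calC K N \<mu> a b c x =
     (\<Sum>d\<in>UNIV. eta K $ c $ d * (\<Sum>\<nu>\<in>UNIV. rho K a \<nu> x * curv N d b \<nu> \<mu> x))"

definition nabla_torsion :: "('m::finite, 'a::finite) courant_data \<Rightarrow> ('m, 'a) connection \<Rightarrow>
    'm \<Rightarrow> 'a \<Rightarrow> 'a \<Rightarrow> 'a \<Rightarrow> real^'m \<Rightarrow> real" where
  "nabla_torsion K N \<mu> a b c x = pdiff \<mu> (gualtieri_torsion K N a b c) x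
     - (\<Sum>d\<in>UNIV. omg N \<mu> a d x * gualtieri_torsion K N d b c x
           + omg N \<mu> b d x * gualtieri_torsion K N a d c x
           + omg N \<mu> c d x * gualtieri_torsion K N a b d x)"

definition basic_curvature :: "('m::finite, 'a::finite) courant_data \<Rightarrow> ('m, 'a) connection \<Rightarrow>
    'm \<Rightarrow> 'a \<Rightarrow> 'a \<Rightarrow> 'a \<Rightarrow> real^'m \<Rightarrow> real" where
  "basic_curvature K N \<mu> a b c x = - nabla_torsion K N \<mu> a b c x
     - 1/2 * (calC K N \<mu> a b c x - calC K N \<mu> b a c x)
     - 1/2 * (1/2 * (calC K N \<mu> c a b x - calC K N \<mu> c b a x))"

definition twisted_basic_curvature :: "('m::finite, 'a::finite) courant_data \<Rightarrow> ('m, 'a) connection \<Rightarrow>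
    'm \<Rightarrow> 'a \<Rightarrow> 'a \<Rightarrow> 'a \<Rightarrow> real^'m \<Rightarrow> real" where
  "twisted_basic_curvature K N \<mu> a b c x = basic_curvature K N \<mu> a b c x + 1/2 * hfl3 K \<mu> a b c x"

section \<open>Graded-commutative algebras\<close>

text \<open>
  \<^term>\<open>G\<close> is the family of homogeneous components and \<^term>\<open>p\<close> the exponent of the commutation sign.
\<close>

definition graded_comm_algebra ::
    "('i::comm_monoid_add \<Rightarrow> 'w::real_algebra_1 set) \<Rightarrow> ('i \<Rightarrow> 'i \<Rightarrow> nat) \<Rightarrow> bool" where
  "graded_comm_algebra G p \<longleftrightarrow>
     (\<forall>i. subspace (G i)) \<and> 1 \<in> G 0 \<and>
     (\<forall>i j. \<forall>x\<in>G i. \<forall>y\<in>G j. x * y \<in> G (i + j) \<and> x * y = (-1) ^ p i j * (y * x)) \<and>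
     (\<forall>x. \<exists>!c. (\<forall>i. c i \<in> G i) \<and> finite {i. c i \<noteq> 0} \<and> x = (\<Sum>i | c i \<noteq> 0. c i))"

definition graded_derivation ::
    "('i \<Rightarrow> 'w::real_algebra_1 set) \<Rightarrow> ('i \<Rightarrow> nat) \<Rightarrow> ('w \<Rightarrow> 'w) \<Rightarrow> bool" where
  "graded_derivation G p D \<longleftrightarrow>
     linear D \<and> (\<forall>i. \<forall>x\<in>G i. \<forall>y. D (x * y) = D x * y + (-1) ^ p i * (x * D y))"

definition two_sided_ideal :: "'w::ring_1 set \<Rightarrow> bool" where
  "two_sided_ideal I \<longleftrightarrow>
     0 \<in> I \<and> (\<forall>x\<in>I. \<forall>y\<in>I. x + y \<in> I) \<and> (\<forall>x\<in>I. \<forall>w. w * x \<in> I \<and> x * w \<in> I)"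

section \<open>The graded target and its covariant derivations\<close>

text \<open>
  Functions on the graded manifold over the chart, with coordinates $x^\mu$, $a^a$, $b_\mu$ of
  degrees 0, 1, 2: \<open>fn\<close> embeds the smooth functions on the base and \<open>px\<close>, \<open>pa\<close>, \<open>pb\<close> are the
  coordinate derivations $\partial/\partial x^\mu$, $\partial/\partial a^a$, $\partial/\partial b_\mu$.
\<close>

record ('o, 'm::finite, 'a::finite) graded_target =
  grd :: "nat \<Rightarrow> 'o set"
  fn :: "(real^'m \<Rightarrow> real) \<Rightarrow> 'o"
  ca :: "'a \<Rightarrow> 'o"
  cb :: "'m \<Rightarrow> 'o"
  px :: "'m \<Rightarrow> 'o \<Rightarrow> 'o"
  pa :: "'a \<Rightarrow> 'o \<Rightarrow> 'o"
  pb :: "'m \<Rightarrow> 'o \<Rightarrow> 'o"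

text \<open>
  Because of the generation clause and the coordinate derivations these conditions determine the
  algebra up to isomorphism as $C^\infty(U) \otimes \Lambda[a^a] \otimes \mathbb{R}[b_\mu]$.
\<close>

definition target_functions :: "(real^'m::finite) set \<Rightarrow>
    ('o::real_algebra_1, 'm, 'a::finite) graded_target \<Rightarrow> bool" where
  "target_functions U M \<longleftrightarrow>
     graded_comm_algebra (grd M) (\<lambda>i j. i * j) \<and>
     (\<forall>f. smooth_fun U f \<longrightarrow> fn M f \<in> grd M 0) \<and> (\<forall>a. ca M a \<in> grd M 1) \<and> (\<forall>\<mu>. cb M \<mu> \<in> grd M 2) \<and>
     (\<forall>r. fn M (\<lambda>x. r) = of_real r) \<and>
     (\<forall>f g. smooth_fun U f \<longrightarrow> smooth_fun U g \<longrightarrow>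
        fn M (\<lambda>x. f x + g x) = fn M f + fn M g \<and> fn M (\<lambda>x. f x * g x) = fn M f * fn M g \<and>
        (fn M f = fn M g \<longleftrightarrow> (\<forall>x\<in>U. f x = g x))) \<and>
     (\<forall>Z. (\<forall>f. smooth_fun U f \<longrightarrow> fn M f \<in> Z) \<longrightarrow> range (ca M) \<subseteq> Z \<longrightarrow> range (cb M) \<subseteq> Z \<longrightarrow>
        (\<forall>u\<in>Z. \<forall>v\<in>Z. u + v \<in> Z \<and> u * v \<in> Z) \<longrightarrow> Z = UNIV) \<and>
     (\<forall>\<mu>. graded_derivation (grd M) (\<lambda>i. 0) (px M \<mu>)) \<and>
     (\<forall>a. graded_derivation (grd M) (\<lambda>i. i) (pa M a)) \<and>
     (\<forall>\<mu>. graded_derivation (grd M) (\<lambda>i. 0) (pb M \<mu>)) \<and>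
     (\<forall>f. smooth_fun U f \<longrightarrow>
        (\<forall>\<mu>. px M \<mu> (fn M f) = fn M (pdiff \<mu> f) \<and> pb M \<mu> (fn M f) = 0) \<and> (\<forall>a. pa M a (fn M f) = 0)) \<and>
     (\<forall>\<mu> a. px M \<mu> (ca M a) = 0 \<and> pb M \<mu> (ca M a) = 0) \<and>
     (\<forall>a b. pa M a (ca M b) = (if a = b then 1 else 0)) \<and>
     (\<forall>\<mu> \<nu>. px M \<mu> (cb M \<nu>) = 0 \<and> pb M \<mu> (cb M \<nu>) = (if \<mu> = \<nu> then 1 else 0)) \<and>
     (\<forall>a \<mu>. pa M a (cb M \<mu>) = 0)"

text \<open>The collective index \<open>\<alpha>\<close>, running over the coordinates $x^\mu$, $a^a$, $b^\nabla_\mu$.\<close>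

datatype ('m, 'a) tindex = Base 'm | Frame 'a | Fibre 'm

instance tindex :: (finite, finite) finite
proof
  have "x \<in> range Base \<union> range Frame \<union> range Fibre" for x :: "('a, 'b) tindex"
    by (cases x) auto
  then have "(UNIV :: ('a, 'b) tindex set) = range Base \<union> range Frame \<union> range Fibre"
    by blast
  then show "finite (UNIV :: ('a, 'b) tindex set)"
    by (metis finite_UnI finite_class.finite_UNIV finite_imageI)
qed

primrec coord_deg :: "('m, 'a) tindex \<Rightarrow> nat" where
  "coord_deg (Base \<mu>) = 0"
| "coord_deg (Frame a) = 1"
| "coord_deg (Fibre \<mu>) = 2"

definition bnab :: "('m::finite, 'a::finite) courant_data \<Rightarrow> ('m, 'a) connection \<Rightarrow>
    ('o::real_algebra_1, 'm, 'a) graded_target \<Rightarrow> 'm \<Rightarrow> 'o" where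
  "bnab K N M \<mu> = cb M \<mu>
     + (1/2) *\<^sub>R (\<Sum>a\<in>UNIV. \<Sum>b\<in>UNIV. fn M (om_low K N \<mu> a b) * ca M a * ca M b)"

definition Dm1 :: "('m::finite, 'a::finite) courant_data \<Rightarrow> ('m, 'a) connection \<Rightarrow>
    ('o::real_algebra_1, 'm, 'a) graded_target \<Rightarrow> 'a \<Rightarrow> 'o \<Rightarrow> 'o" where
  "Dm1 K N M a u = pa M a u
     + (\<Sum>\<mu>\<in>UNIV. \<Sum>b\<in>UNIV. fn M (om_low K N \<mu> b a) * ca M b * pb M \<mu> u)"

definition D0 :: "('m::finite, 'a::finite) courant_data \<Rightarrow> ('m, 'a) connection \<Rightarrow>
    ('o::real_algebra_1, 'm, 'a) graded_target \<Rightarrow> 'm \<Rightarrow> 'o \<Rightarrow> 'o" where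
  "D0 K N M \<mu> u = px M \<mu> u
     - (1/2) *\<^sub>R (\<Sum>\<nu>\<in>UNIV. \<Sum>b\<in>UNIV. \<Sum>c\<in>UNIV.
         fn M (pdiff \<mu> (om_low K N \<nu> b c)) * ca M b * ca M c * pb M \<nu> u)
     + (\<Sum>\<nu>\<in>UNIV. \<Sum>\<sigma>\<in>UNIV. fn M (gam N \<sigma> \<nu> \<mu>) * bnab K N M \<sigma> * pb M \<nu> u)
     - (\<Sum>b\<in>UNIV. \<Sum>c\<in>UNIV. fn M (omg N \<mu> b c) * ca M b * Dm1 K N M c u)"

text \<open>
  The derivations $\mathrm{D}_\alpha$.  Since $b^\nabla_\mu - b_\mu$ depends on \<open>x\<close> and \<open>a\<close> only,
  $\partial/\partial b^\nabla_\mu = \partial/\partial b_\mu$.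
\<close>

primrec Dcov :: "('m::finite, 'a::finite) courant_data \<Rightarrow> ('m, 'a) connection \<Rightarrow>
    ('o::real_algebra_1, 'm, 'a) graded_target \<Rightarrow> ('m, 'a) tindex \<Rightarrow> 'o \<Rightarrow> 'o" where
  "Dcov K N M (Base \<mu>) = D0 K N M \<mu>"
| "Dcov K N M (Frame a) = Dm1 K N M a"
| "Dcov K N M (Fibre \<mu>) = pb M \<mu>"

text \<open>The components $Q^\alpha_\nabla$ of the homological vector field.\<close>

primrec Qcomp :: "('m::finite, 'a::finite) courant_data \<Rightarrow> ('m, 'a) connection \<Rightarrow>
    ('o::real_algebra_1, 'm, 'a) graded_target \<Rightarrow> ('m, 'a) tindex \<Rightarrow> 'o" where
  "Qcomp K N M (Base \<mu>) = (\<Sum>a\<in>UNIV. ca M a * fn M (rho K a \<mu>))"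
| "Qcomp K N M (Frame a) =
     - (\<Sum>b\<in>UNIV. \<Sum>\<mu>\<in>UNIV. etai K a b *\<^sub>R (fn M (rho K b \<mu>) * bnab K N M \<mu>))
     + (\<Sum>b\<in>UNIV. \<Sum>c\<in>UNIV. fn M (gualtieri_torsion_up K N b c a) * ca M b * ca M c)"
| "Qcomp K N M (Fibre \<mu>) =
     - (\<Sum>a\<in>UNIV. \<Sum>\<nu>\<in>UNIV. fn M (nabla_rho K N \<mu> a \<nu>) * bnab K N M \<nu> * ca M a)
     - (1/3) *\<^sub>R (\<Sum>a\<in>UNIV. \<Sum>b\<in>UNIV. \<Sum>c\<in>UNIV.
         fn M (twisted_basic_curvature K N \<mu> a b c) * ca M a * ca M b * ca M c)"

section \<open>The sigma model\<close>

text \<open>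
  The fields and ghosts live in a (ghost degree, form degree)-bigraded algebra: the functions on
  $T[1]\Sigma$ tensored with those on the space of fields and ghosts.  \<open>pull\<close> is the pull-back along
  the map $T[1]\Sigma \to \mathcal{M}$ that constitutes the classical fields $(X, A, B)$;
  \<open>dd\<close> is the de Rham differential of \<open>\<Sigma>\<close>, \<open>s0\<close> the BRST operator, and \<open>eps\<close>, \<open>psi\<close>, \<open>psit\<close>
  are $\epsilon^a$, $\psi_\mu$, $\widetilde\psi_\mu$.
\<close>

record ('w, 'o, 'm, 'a) sigma_model =
  bigr :: "nat \<times> nat \<Rightarrow> 'w set"
  dd :: "'w \<Rightarrow> 'w"
  s0 :: "'w \<Rightarrow> 'w"
  pull :: "'o \<Rightarrow> 'w"
  eps :: "'a \<Rightarrow> 'w"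
  psi :: "'m \<Rightarrow> 'w"
  psit :: "'m \<Rightarrow> 'w"

definition pbf :: "('o, 'm::finite, 'a::finite) graded_target \<Rightarrow> ('w, 'o, 'm, 'a) sigma_model \<Rightarrow>
    (real^'m \<Rightarrow> real) \<Rightarrow> 'w" where
  "pbf M S f = pull S (fn M f)"

definition Xf :: "('o, 'm::finite, 'a::finite) graded_target \<Rightarrow> ('w, 'o, 'm, 'a) sigma_model \<Rightarrow>
    'm \<Rightarrow> 'w" where
  "Xf M S \<mu> = pbf M S (\<lambda>x. x $ \<mu>)"

definition Af :: "('o, 'm::finite, 'a::finite) graded_target \<Rightarrow> ('w, 'o, 'm, 'a) sigma_model \<Rightarrow>
    'a \<Rightarrow> 'w" where
  "Af M S a = pull S (ca M a)"

definition Bf :: "('o, 'm::finite, 'a::finite) graded_target \<Rightarrow> ('w, 'o, 'm, 'a) sigma_model \<Rightarrow>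
    'm \<Rightarrow> 'w" where
  "Bf M S \<mu> = pull S (cb M \<mu>)"

text \<open>The algebraic structure; \<^prop>\<open>3 < f\<close> reflects that \<open>\<Sigma>\<close> is three-dimensional.\<close>

definition field_algebra :: "(real^'m::finite) set \<Rightarrow> ('o::real_algebra_1, 'm, 'a::finite) graded_target \<Rightarrow>
    ('w::real_algebra_1, 'o, 'm, 'a) sigma_model \<Rightarrow> bool" where
  "field_algebra U M S \<longleftrightarrow>
     graded_comm_algebra (bigr S) (\<lambda>i j. snd i * snd j + fst i * fst j) \<and>
     (\<forall>g f. 3 < f \<longrightarrow> bigr S (g, f) = {0}) \<and>
     graded_derivation (bigr S) snd (dd S) \<and>
     (\<forall>g f. dd S ` bigr S (g, f) \<subseteq> bigr S (g, f + 1)) \<and> (\<forall>w. dd S (dd S w) = 0) \<and>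
     graded_derivation (bigr S) fst (s0 S) \<and>
     (\<forall>g f. s0 S ` bigr S (g, f) \<subseteq> bigr S (g + 1, f)) \<and> (\<forall>w. s0 S (dd S w) = dd S (s0 S w)) \<and>
     linear (pull S) \<and> pull S 1 = 1 \<and> (\<forall>u v. pull S (u * v) = pull S u * pull S v) \<and>
     (\<forall>n. pull S ` grd M n \<subseteq> bigr S (0, n)) \<and>
     (\<forall>h. smooth_fun U h \<longrightarrow>
        dd S (pbf M S h) = (\<Sum>\<mu>\<in>UNIV. pbf M S (pdiff \<mu> h) * dd S (Xf M S \<mu>)) \<and>
        s0 S (pbf M S h) = (\<Sum>\<mu>\<in>UNIV. pbf M S (pdiff \<mu> h) * s0 S (Xf M S \<mu>))) \<and>
     (\<forall>a. eps S a \<in> bigr S (1, 0)) \<and> (\<forall>\<mu>. psi S \<mu> \<in> bigr S (1, 1)) \<and> (\<forall>\<mu>. psit S \<mu> \<in> bigr S (2, 0))"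

text \<open>
  The field equations $F^\mu$, $G^a$ of \<open>B\<close> and \<open>A\<close> and the one of \<open>X\<close>, the variation of
  $S_{\mathrm{cl}}$ with respect to $X^\mu$:
  $\mathrm{d}B_\mu + \partial_\mu\rho_a{}^\nu B_\nu A^a + \frac{1}{3!}\partial_\mu C_{abc}A^aA^bA^c
   + \frac{1}{3!}H_{\mu\nu\kappa\lambda}\,\mathrm{d}X^\nu\mathrm{d}X^\kappa\mathrm{d}X^\lambda$.
\<close>

definition eqF :: "('m::finite, 'a::finite) courant_data \<Rightarrow> ('o::real_algebra_1, 'm, 'a) graded_target \<Rightarrow>
    ('w::real_algebra_1, 'o, 'm, 'a) sigma_model \<Rightarrow> 'm \<Rightarrow> 'w" where
  "eqF K M S \<mu> = dd S (Xf M S \<mu>) - (\<Sum>a\<in>UNIV. pbf M S (rho K a \<mu>) * Af M S a)"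

definition eqG :: "('m::finite, 'a::finite) courant_data \<Rightarrow> ('o::real_algebra_1, 'm, 'a) graded_target \<Rightarrow>
    ('w::real_algebra_1, 'o, 'm, 'a) sigma_model \<Rightarrow> 'a \<Rightarrow> 'w" where
  "eqG K M S a = dd S (Af M S a)
     + (\<Sum>b\<in>UNIV. \<Sum>\<mu>\<in>UNIV. etai K a b *\<^sub>R (pbf M S (rho K b \<mu>) * Bf M S \<mu>))
     + (1/2) *\<^sub>R (\<Sum>b\<in>UNIV. \<Sum>c\<in>UNIV. pbf M S (cst_up K a b c) * Af M S b * Af M S c)"

definition eqX :: "('m::finite, 'a::finite) courant_data \<Rightarrow> ('o::real_algebra_1, 'm, 'a) graded_target \<Rightarrow>
    ('w::real_algebra_1, 'o, 'm, 'a) sigma_model \<Rightarrow> 'm \<Rightarrow> 'w" where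
  "eqX K M S \<mu> = dd S (Bf M S \<mu>)
     + (\<Sum>a\<in>UNIV. \<Sum>\<nu>\<in>UNIV. pbf M S (pdiff \<mu> (rho K a \<nu>)) * Bf M S \<nu> * Af M S a)
     + (1/6) *\<^sub>R (\<Sum>a\<in>UNIV. \<Sum>b\<in>UNIV. \<Sum>c\<in>UNIV.
         pbf M S (pdiff \<mu> (cst K a b c)) * Af M S a * Af M S b * Af M S c)
     + (1/6) *\<^sub>R (\<Sum>\<nu>\<in>UNIV. \<Sum>\<kappa>\<in>UNIV. \<Sum>\<tau>\<in>UNIV.
         pbf M S (hfl K \<mu> \<nu> \<kappa> \<tau>) * dd S (Xf M S \<nu>) * dd S (Xf M S \<kappa>) * dd S (Xf M S \<tau>))"

text \<open>
  Vanishing on the stationary surface: membership in the ideal generated by the field equations,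
  i.e. vanishing in every quotient of the field algebra in which the field equations hold.
\<close>

definition vanishes_on_shell :: "('m::finite, 'a::finite) courant_data \<Rightarrow>
    ('o::real_algebra_1, 'm, 'a) graded_target \<Rightarrow> ('w::real_algebra_1, 'o, 'm, 'a) sigma_model \<Rightarrow>
    'w \<Rightarrow> bool" where
  "vanishes_on_shell K M S w \<longleftrightarrow>
     w \<in> two_sided_ideal hull (range (eqF K M S) \<union> range (eqG K M S) \<union> range (eqX K M S))"

section \<open>The BRST transformation in the original variables\<close>

definition brst_transformation :: "('m::finite, 'a::finite) courant_data \<Rightarrow>
    ('o::real_algebra_1, 'm, 'a) graded_target \<Rightarrow> ('w::real_algebra_1, 'o, 'm, 'a) sigma_model \<Rightarrow>
    bool" where
  "brst_transformation K M S \<longleftrightarrow>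
     (\<forall>\<mu>. s0 S (Xf M S \<mu>) = (\<Sum>a\<in>UNIV. pbf M S (rho K a \<mu>) * eps S a)) \<and>
     (\<forall>a. s0 S (Af M S a) = dd S (eps S a)
        + (\<Sum>b\<in>UNIV. \<Sum>\<mu>\<in>UNIV. etai K a b *\<^sub>R (pbf M S (rho K b \<mu>) * psi S \<mu>))
        + (\<Sum>b\<in>UNIV. \<Sum>c\<in>UNIV. pbf M S (cst_up K a b c) * Af M S b * eps S c)) \<and>
     (\<forall>\<mu>. s0 S (Bf M S \<mu>) = - dd S (psi S \<mu>)
        - (\<Sum>a\<in>UNIV. \<Sum>\<nu>\<in>UNIV. pbf M S (pdiff \<mu> (rho K a \<nu>)) *
             (Bf M S \<nu> * eps S a - psi S \<nu> * Af M S a))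
        - (1/2) *\<^sub>R (\<Sum>a\<in>UNIV. \<Sum>b\<in>UNIV. \<Sum>c\<in>UNIV.
             pbf M S (\<lambda>x. pdiff \<mu> (cst K a b c) x + hfl3 K \<mu> a b c x) * Af M S a * Af M S b * eps S c)
        - (1/2) *\<^sub>R (\<Sum>a\<in>UNIV. \<Sum>b\<in>UNIV. \<Sum>\<nu>\<in>UNIV.
             pbf M S (hfl2 K \<mu> \<nu> a b) * eps S a * Af M S b * eqF K M S \<nu>)
        - (1/6) *\<^sub>R (\<Sum>a\<in>UNIV. \<Sum>\<nu>\<in>UNIV. \<Sum>\<tau>\<in>UNIV.
             pbf M S (hfl1 K \<mu> \<nu> \<tau> a) * eps S a * eqF K M S \<nu> * eqF K M S \<tau>)) \<and>
     (\<forall>a. s0 S (eps S a) = - (\<Sum>b\<in>UNIV. etai K a b *\<^sub>R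
          ((\<Sum>\<mu>\<in>UNIV. pbf M S (rho K b \<mu>) * psit S \<mu>)
           + (1/2) *\<^sub>R (\<Sum>c\<in>UNIV. \<Sum>d\<in>UNIV. pbf M S (cst K b c d) * eps S c * eps S d)))) \<and>
     (\<forall>\<mu>. s0 S (psi S \<mu>) = dd S (psit S \<mu>)
        + (\<Sum>a\<in>UNIV. \<Sum>\<nu>\<in>UNIV. pbf M S (pdiff \<mu> (rho K a \<nu>)) *
             (psit S \<nu> * Af M S a + psi S \<nu> * eps S a))
        + (1/2) *\<^sub>R (\<Sum>a\<in>UNIV. \<Sum>b\<in>UNIV. \<Sum>c\<in>UNIV.
             pbf M S (\<lambda>x. pdiff \<mu> (cst K a b c) x + hfl3 K \<mu> a b c x) * Af M S a * eps S b * eps S c)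
        + (1/4) *\<^sub>R (\<Sum>a\<in>UNIV. \<Sum>b\<in>UNIV. \<Sum>\<nu>\<in>UNIV.
             pbf M S (hfl2 K \<mu> \<nu> a b) * eps S a * eps S b * eqF K M S \<nu>)) \<and>
     (\<forall>\<mu>. s0 S (psit S \<mu>) =
        - (\<Sum>a\<in>UNIV. \<Sum>\<nu>\<in>UNIV. pbf M S (pdiff \<mu> (rho K a \<nu>)) * psit S \<nu> * eps S a)
        - (1/6) *\<^sub>R (\<Sum>a\<in>UNIV. \<Sum>b\<in>UNIV. \<Sum>c\<in>UNIV.
             pbf M S (\<lambda>x. pdiff \<mu> (cst K a b c) x + hfl3 K \<mu> a b c x) * eps S a * eps S b * eps S c))"

section \<open>Covariant fields and the covariant transformation\<close>

definition B_nab :: "('m::finite, 'a::finite) courant_data \<Rightarrow> ('m, 'a) connection \<Rightarrow>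
    ('o::real_algebra_1, 'm, 'a) graded_target \<Rightarrow> ('w::real_algebra_1, 'o, 'm, 'a) sigma_model \<Rightarrow>
    'm \<Rightarrow> 'w" where
  "B_nab K N M S \<mu> = Bf M S \<mu>
     + (1/2) *\<^sub>R (\<Sum>a\<in>UNIV. \<Sum>b\<in>UNIV. pbf M S (om_low K N \<mu> a b) * Af M S a * Af M S b)"

definition psi_nab :: "('m::finite, 'a::finite) courant_data \<Rightarrow> ('m, 'a) connection \<Rightarrow>
    ('o::real_algebra_1, 'm, 'a) graded_target \<Rightarrow> ('w::real_algebra_1, 'o, 'm, 'a) sigma_model \<Rightarrow>
    'm \<Rightarrow> 'w" where
  "psi_nab K N M S \<mu> = psi S \<mu>
     + (\<Sum>a\<in>UNIV. \<Sum>b\<in>UNIV. pbf M S (om_low K N \<mu> a b) * Af M S a * eps S b)"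

definition psit_nab :: "('m::finite, 'a::finite) courant_data \<Rightarrow> ('m, 'a) connection \<Rightarrow>
    ('o::real_algebra_1, 'm, 'a) graded_target \<Rightarrow> ('w::real_algebra_1, 'o, 'm, 'a) sigma_model \<Rightarrow>
    'm \<Rightarrow> 'w" where
  "psit_nab K N M S \<mu> = psit S \<mu>
     + (1/2) *\<^sub>R (\<Sum>a\<in>UNIV. \<Sum>b\<in>UNIV. pbf M S (om_low K N \<mu> a b) * eps S a * eps S b)"

text \<open>The tensorial version of \<open>s0\<close> on components with a Latin upper or a Greek lower index.\<close>

definition sbar_up :: "('m::finite, 'a::finite) connection \<Rightarrow>
    ('o::real_algebra_1, 'm, 'a) graded_target \<Rightarrow> ('w::real_algebra_1, 'o, 'm, 'a) sigma_model \<Rightarrow>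
    ('a \<Rightarrow> 'w) \<Rightarrow> 'a \<Rightarrow> 'w" where
  "sbar_up N M S V a = s0 S (V a)
     + (\<Sum>\<mu>\<in>UNIV. \<Sum>b\<in>UNIV. pbf M S (omg N \<mu> b a) * s0 S (Xf M S \<mu>) * V b)"

definition sbar_down :: "('m::finite, 'a::finite) connection \<Rightarrow>
    ('o::real_algebra_1, 'm, 'a) graded_target \<Rightarrow> ('w::real_algebra_1, 'o, 'm, 'a) sigma_model \<Rightarrow>
    ('m \<Rightarrow> 'w) \<Rightarrow> 'm \<Rightarrow> 'w" where
  "sbar_down N M S V \<mu> = s0 S (V \<mu>)
     - (\<Sum>\<nu>\<in>UNIV. \<Sum>\<sigma>\<in>UNIV. pbf M S (gam (torsionless N) \<nu> \<mu> \<sigma>) * s0 S (Xf M S \<sigma>) * V \<nu>)"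

text \<open>$\partial_{(\mu}\omega_{\nu)ab} + \omega^d_{[\mu a}\omega_{\nu]bd}$.\<close>

definition omega_sq :: "('m::finite, 'a::finite) courant_data \<Rightarrow> ('m, 'a) connection \<Rightarrow>
    'm \<Rightarrow> 'm \<Rightarrow> 'a \<Rightarrow> 'a \<Rightarrow> real^'m \<Rightarrow> real" where
  "omega_sq K N \<mu> \<nu> a b x =
     1/2 * (pdiff \<mu> (om_low K N \<nu> a b) x + pdiff \<nu> (om_low K N \<mu> a b) x)
     + 1/2 * (\<Sum>d\<in>UNIV. omg N \<mu> a d x * om_low K N \<nu> b d x - omg N \<nu> a d x * om_low K N \<mu> b d x)"

definition snab_A :: "('m::finite, 'a::finite) courant_data \<Rightarrow> ('m, 'a) connection \<Rightarrow>
    ('o::real_algebra_1, 'm, 'a) graded_target \<Rightarrow> ('w::real_algebra_1, 'o, 'm, 'a) sigma_model \<Rightarrow>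
    'a \<Rightarrow> 'w" where
  "snab_A K N M S a = sbar_up N M S (Af M S) a
     + (\<Sum>\<mu>\<in>UNIV. \<Sum>b\<in>UNIV. pbf M S (omg N \<mu> b a) * eqF K M S \<mu> * eps S b)"

definition snab_B :: "('m::finite, 'a::finite) courant_data \<Rightarrow> ('m, 'a) connection \<Rightarrow>
    ('o::real_algebra_1, 'm, 'a) graded_target \<Rightarrow> ('w::real_algebra_1, 'o, 'm, 'a) sigma_model \<Rightarrow>
    'm \<Rightarrow> 'w" where
  "snab_B K N M S \<mu> = sbar_down N M S (B_nab K N M S) \<mu>
     - (\<Sum>\<nu>\<in>UNIV. \<Sum>\<sigma>\<in>UNIV. pbf M S (gam (torsionless N) \<nu> \<mu> \<sigma>) * psi_nab K N M S \<nu> * eqF K M S \<sigma>)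
     - (\<Sum>\<nu>\<in>UNIV. \<Sum>a\<in>UNIV. \<Sum>b\<in>UNIV.
          pbf M S (omega_sq K N \<mu> \<nu> a b) * eqF K M S \<nu> * Af M S a * eps S b)
     - (\<Sum>a\<in>UNIV. \<Sum>b\<in>UNIV. pbf M S (om_low K N \<mu> a b) * eqG K M S a * eps S b)"

definition snab_psi :: "('m::finite, 'a::finite) courant_data \<Rightarrow> ('m, 'a) connection \<Rightarrow>
    ('o::real_algebra_1, 'm, 'a) graded_target \<Rightarrow> ('w::real_algebra_1, 'o, 'm, 'a) sigma_model \<Rightarrow>
    'm \<Rightarrow> 'w" where
  "snab_psi K N M S \<mu> = sbar_down N M S (psi_nab K N M S) \<mu>
     - (\<Sum>\<nu>\<in>UNIV. \<Sum>\<sigma>\<in>UNIV. pbf M S (gam (torsionless N) \<nu> \<mu> \<sigma>) * psit_nab K N M S \<nu> * eqF K M S \<sigma>)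
     + (1/2) *\<^sub>R (\<Sum>\<nu>\<in>UNIV. \<Sum>a\<in>UNIV. \<Sum>b\<in>UNIV.
          pbf M S (omega_sq K N \<mu> \<nu> a b) * eqF K M S \<nu> * eps S a * eps S b)"

text \<open>
  $s_0^\nabla$ on the components of the fields $(X^\mu, A^a, B^\nabla_\mu)$, of the ghosts
  $(0, \epsilon^a, -\psi^\nabla_\mu)$ and of the ghost for ghost $(0, 0, -\widetilde\psi^\nabla_\mu)$.
\<close>

primrec snab_field :: "('m::finite, 'a::finite) courant_data \<Rightarrow> ('m, 'a) connection \<Rightarrow>
    ('o::real_algebra_1, 'm, 'a) graded_target \<Rightarrow> ('w::real_algebra_1, 'o, 'm, 'a) sigma_model \<Rightarrow>
    ('m, 'a) tindex \<Rightarrow> 'w" where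
  "snab_field K N M S (Base \<mu>) = s0 S (Xf M S \<mu>)"
| "snab_field K N M S (Frame a) = snab_A K N M S a"
| "snab_field K N M S (Fibre \<mu>) = snab_B K N M S \<mu>"

primrec snab_ghost :: "('m::finite, 'a::finite) courant_data \<Rightarrow> ('m, 'a) connection \<Rightarrow>
    ('o::real_algebra_1, 'm, 'a) graded_target \<Rightarrow> ('w::real_algebra_1, 'o, 'm, 'a) sigma_model \<Rightarrow>
    ('m, 'a) tindex \<Rightarrow> 'w" where
  "snab_ghost K N M S (Base \<mu>) = 0"
| "snab_ghost K N M S (Frame a) = sbar_up N M S (eps S) a"
| "snab_ghost K N M S (Fibre \<mu>) = - snab_psi K N M S \<mu>"

primrec snab_ghost2 :: "('m::finite, 'a::finite) courant_data \<Rightarrow> ('m, 'a) connection \<Rightarrow>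
    ('o::real_algebra_1, 'm, 'a) graded_target \<Rightarrow> ('w::real_algebra_1, 'o, 'm, 'a) sigma_model \<Rightarrow>
    ('m, 'a) tindex \<Rightarrow> 'w" where
  "snab_ghost2 K N M S (Base \<mu>) = 0"
| "snab_ghost2 K N M S (Frame a) = 0"
| "snab_ghost2 K N M S (Fibre \<mu>) = - sbar_down N M S (psit_nab K N M S) \<mu>"

primrec ghost :: "('m::finite, 'a::finite) courant_data \<Rightarrow> ('m, 'a) connection \<Rightarrow>
    ('o::real_algebra_1, 'm, 'a) graded_target \<Rightarrow> ('w::real_algebra_1, 'o, 'm, 'a) sigma_model \<Rightarrow>
    ('m, 'a) tindex \<Rightarrow> 'w" where
  "ghost K N M S (Base \<mu>) = 0"
| "ghost K N M S (Frame a) = eps S a"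
| "ghost K N M S (Fibre \<mu>) = - psi_nab K N M S \<mu>"

primrec ghost2 :: "('m::finite, 'a::finite) courant_data \<Rightarrow> ('m, 'a) connection \<Rightarrow>
    ('o::real_algebra_1, 'm, 'a) graded_target \<Rightarrow> ('w::real_algebra_1, 'o, 'm, 'a) sigma_model \<Rightarrow>
    ('m, 'a) tindex \<Rightarrow> 'w" where
  "ghost2 K N M S (Base \<mu>) = 0"
| "ghost2 K N M S (Frame a) = 0"
| "ghost2 K N M S (Fibre \<mu>) = - psit_nab K N M S \<mu>"

text \<open>The terms $s^\nabla_{\mathrm{triv}}$.\<close>

definition striv_B :: "('m::finite, 'a::finite) courant_data \<Rightarrow> ('m, 'a) connection \<Rightarrow>
    ('o::real_algebra_1, 'm, 'a) graded_target \<Rightarrow> ('w::real_algebra_1, 'o, 'm, 'a) sigma_model \<Rightarrow>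
    'm \<Rightarrow> 'w" where
  "striv_B K N M S \<mu> =
     - (1/2) *\<^sub>R (\<Sum>a\<in>UNIV. \<Sum>b\<in>UNIV. \<Sum>\<nu>\<in>UNIV.
          pbf M S (\<lambda>x. hfl2 K \<mu> \<nu> a b x - curv_low K N a b \<mu> \<nu> x) * eps S a * Af M S b * eqF K M S \<nu>)
     - (1/6) *\<^sub>R (\<Sum>a\<in>UNIV. \<Sum>\<nu>\<in>UNIV. \<Sum>\<sigma>\<in>UNIV.
          pbf M S (hfl1 K \<mu> \<nu> \<sigma> a) * eps S a * eqF K M S \<nu> * eqF K M S \<sigma>)"

definition striv_psi :: "('m::finite, 'a::finite) courant_data \<Rightarrow> ('m, 'a) connection \<Rightarrow>
    ('o::real_algebra_1, 'm, 'a) graded_target \<Rightarrow> ('w::real_algebra_1, 'o, 'm, 'a) sigma_model \<Rightarrow>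
    'm \<Rightarrow> 'w" where
  "striv_psi K N M S \<mu> =
     (1/4) *\<^sub>R (\<Sum>a\<in>UNIV. \<Sum>b\<in>UNIV. \<Sum>\<nu>\<in>UNIV.
          pbf M S (\<lambda>x. hfl2 K \<mu> \<nu> a b x - curv_low K N a b \<mu> \<nu> x) * eps S a * eps S b * eqF K M S \<nu>)"

primrec striv_field :: "('m::finite, 'a::finite) courant_data \<Rightarrow> ('m, 'a) connection \<Rightarrow>
    ('o::real_algebra_1, 'm, 'a) graded_target \<Rightarrow> ('w::real_algebra_1, 'o, 'm, 'a) sigma_model \<Rightarrow>
    ('m, 'a) tindex \<Rightarrow> 'w" where
  "striv_field K N M S (Base \<mu>) = 0"
| "striv_field K N M S (Frame a) = 0"
| "striv_field K N M S (Fibre \<mu>) = striv_B K N M S \<mu>"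

primrec striv_ghost :: "('m::finite, 'a::finite) courant_data \<Rightarrow> ('m, 'a) connection \<Rightarrow>
    ('o::real_algebra_1, 'm, 'a) graded_target \<Rightarrow> ('w::real_algebra_1, 'o, 'm, 'a) sigma_model \<Rightarrow>
    ('m, 'a) tindex \<Rightarrow> 'w" where
  "striv_ghost K N M S (Base \<mu>) = 0"
| "striv_ghost K N M S (Frame a) = 0"
| "striv_ghost K N M S (Fibre \<mu>) = - striv_psi K N M S \<mu>"

text \<open>The exterior covariant derivative on \<open>\<Sigma>\<close> of a form with components $v^\alpha$.\<close>

primrec covD :: "('m::finite, 'a::finite) connection \<Rightarrow>
    ('o::real_algebra_1, 'm, 'a) graded_target \<Rightarrow> ('w::real_algebra_1, 'o, 'm, 'a) sigma_model \<Rightarrow>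
    (('m, 'a) tindex \<Rightarrow> 'w) \<Rightarrow> ('m, 'a) tindex \<Rightarrow> 'w" where
  "covD N M S v (Base \<mu>) = dd S (v (Base \<mu>))
     + (\<Sum>\<sigma>\<in>UNIV. \<Sum>\<nu>\<in>UNIV. pbf M S (gam N \<mu> \<sigma> \<nu>) * dd S (Xf M S \<sigma>) * v (Base \<nu>))"
| "covD N M S v (Frame a) = dd S (v (Frame a))
     + (\<Sum>\<mu>\<in>UNIV. \<Sum>b\<in>UNIV. pbf M S (omg N \<mu> b a) * dd S (Xf M S \<mu>) * v (Frame b))"
| "covD N M S v (Fibre \<mu>) = dd S (v (Fibre \<mu>))
     - (\<Sum>\<sigma>\<in>UNIV. \<Sum>\<nu>\<in>UNIV. pbf M S (gam N \<nu> \<sigma> \<mu>) * dd S (Xf M S \<sigma>) * v (Fibre \<nu>))"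

text \<open>
  The contractions $v^\beta \mathrm{D}_\beta Q$, $v^\beta\epsilon^\gamma \mathrm{D}_\beta\mathrm{D}_\gamma Q$
  and $\epsilon^\beta\epsilon^\gamma\epsilon^\delta \mathrm{D}_\beta\mathrm{D}_\gamma\mathrm{D}_\delta Q$ stand for
  iterated actions of $v^\beta\mathrm{D}_\beta$ and $\epsilon^\beta\mathrm{D}_\beta$, in which each
  $\mathrm{D}_\beta$, of form degree minus the degree of its coordinate and of ghost degree 0, has been
  moved to the right of the ghosts at the cost of the usual sign.  Without this sign the terms
  $\epsilon^a\psi^\nabla_\mu$ and $\psi^\nabla_\mu\epsilon^a$ would cancel in the second contraction.  The
  form degree of $\epsilon^\gamma$ is \<^term>\<open>ghost_fdeg \<gamma>\<close>; its value on \<^term>\<open>Base\<close> is immaterial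
  as $\epsilon^\mu = 0$.
\<close>

definition ghost_fdeg :: "('m, 'a) tindex \<Rightarrow> nat" where
  "ghost_fdeg \<gamma> = coord_deg \<gamma> - 1"

definition contr1 :: "('o \<Rightarrow> 'w::real_algebra_1) \<Rightarrow> (('m::finite, 'a::finite) tindex \<Rightarrow> 'o \<Rightarrow> 'o) \<Rightarrow>
    (('m, 'a) tindex \<Rightarrow> 'w) \<Rightarrow> 'o \<Rightarrow> 'w" where
  "contr1 pl D v q = (\<Sum>\<beta>\<in>UNIV. v \<beta> * pl (D \<beta> q))"

definition contr2 :: "('o \<Rightarrow> 'w::real_algebra_1) \<Rightarrow> (('m::finite, 'a::finite) tindex \<Rightarrow> 'o \<Rightarrow> 'o) \<Rightarrow>
    (('m, 'a) tindex \<Rightarrow> 'w) \<Rightarrow> (('m, 'a) tindex \<Rightarrow> 'w) \<Rightarrow> 'o \<Rightarrow> 'w" where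
  "contr2 pl D v e q = (\<Sum>\<beta>\<in>UNIV. \<Sum>\<gamma>\<in>UNIV.
     (-1) ^ (coord_deg \<beta> * ghost_fdeg \<gamma>) * (v \<beta> * e \<gamma> * pl (D \<beta> (D \<gamma> q))))"

definition contr3 :: "('o \<Rightarrow> 'w::real_algebra_1) \<Rightarrow> (('m::finite, 'a::finite) tindex \<Rightarrow> 'o \<Rightarrow> 'o) \<Rightarrow>
    (('m, 'a) tindex \<Rightarrow> 'w) \<Rightarrow> 'o \<Rightarrow> 'w" where
  "contr3 pl D e q = (\<Sum>\<beta>\<in>UNIV. \<Sum>\<gamma>\<in>UNIV. \<Sum>\<delta>\<in>UNIV.
     (-1) ^ (coord_deg \<beta> * (ghost_fdeg \<gamma> + ghost_fdeg \<delta>) + coord_deg \<gamma> * ghost_fdeg \<delta>)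
     * (e \<beta> * e \<gamma> * e \<delta> * pl (D \<beta> (D \<gamma> (D \<delta> q)))))"

end

theory Submission
  imports Defs
begin

text \<open>
  All terms of the transformation depend on \<open>\<nabla>\<close> only through $\mathring\nabla$, so one may assume that
  $\Gamma$ is symmetric.  The ghosts have no component along $x^\mu$, hence only $\mathrm{D}^{(-1)}_a$
  and $\mathrm{D}^\mu_{(-2)}$ occur in the contractions; these annihilate functions of $x$ and see
  $b^\nabla_\mu$ as a coordinate, so differentiating $Q^\alpha_\nabla$ amounts to replacing factors
  $A^a$ and $B^\nabla_\mu$ by ghosts.  The BRST side is computed with the Leibniz rule.  The two meet
  because of the identity
  $$\widetilde{\mathcal S}_{\mu abc} = \tfrac12(\partial_\mu C_{abc} + H_{\mu abc})
    - \tfrac12(k_{\mu abc} + k_{\mu bca} + k_{\mu cab}),$$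
  $$k_{\mu abc} = \partial_\mu\rho_a{}^\nu\omega_{\nu bc} + \rho_a{}^\nu\partial_\nu\omega_{\mu bc}
    - \omega_{\mu a}{}^d\rho_d{}^\nu\omega_{\nu bc} + \omega_{\mu a}{}^dC_{dbc},$$
  in which the derivatives of $\omega_\nu$ along $x^\mu$ and all other terms quadratic in $\omega$ have
  cancelled between $\nabla_\mu\mathcal T_{abc}$ and the curvature; $k_{\mu abc}$ is exactly what the
  terms with $\omega_\mu$ in the covariant fields contribute on the BRST side.
\<close>

section \<open>Smooth functions on a chart\<close>

text \<open>Graded signs are the main obstacle. Every summand is therefore written as a contraction
  \<open>con1\<close>, \<open>con2\<close> or \<open>con3\<close> whose coefficients stand on the
  left and are central, so that a sign arises only when two whole fields change places;
  \<open>scomm\<close> records it as one real number. Tensor identities are proved pointwise for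
  real functions on \<open>U\<close> and only then transported through \<open>p\<close> into the
  field algebra.

  Metric compatibility enters as antisymmetry: it makes the torsion and
  \<open>twisted_basic_curvature\<close> totally antisymmetric, and repeated differentiation of the
  cubic term of Q then merely yields the factors 3, 2, 1, which meet the coefficients 1/3, 1/2 and
  1/3! of the theorem.

  The curvature in the trivial terms has its origin in dX = F + rho A. Differentiating the covariant
  ghosts produces derivatives of omega multiplied by F; the corrections with \<open>omega_sq\<close>
  in the definition of the covariant transformation match them only up to half the curvature. The
  terms with both H and F are already present in \<open>s0\<close>.\<close>

lemma has_derivative_cong_open:
  assumes "open U" "x \<in> U" "\<And>y. y \<in> U \<Longrightarrow> f y = g y"
  shows "(f has_derivative F) (at x) \<longleftrightarrow> (g has_derivative F) (at x)"
proof
  show "(g has_derivative F) (at x)" if "(f has_derivative F) (at x)"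
    by (rule has_derivative_transform_within_open[OF that assms(1,2)]) (rule assms(3))
  show "(f has_derivative F) (at x)" if "(g has_derivative F) (at x)"
    by (rule has_derivative_transform_within_open[OF that assms(1,2)]) (rule assms(3)[symmetric])
qed

text \<open>\<open>frechet_derivative\<close> is a choice from the predicate
  \<open>has_derivative\<close>, so equivalent predicates give equal values, even at points where
  neither function is differentiable.\<close>

lemma pdiff_cong:
  assumes "open U" "x \<in> U" "\<And>y. y \<in> U \<Longrightarrow> f y = g y"
  shows "pdiff \<mu> f x = pdiff \<mu> g x"
proof -
  have "(f has_derivative F) (at x) \<longleftrightarrow> (g has_derivative F) (at x)" for F
    by (rule has_derivative_cong_open[OF assms])
  then show ?thesis unfolding pdiff_def frechet_derivative_def by presburger
qed

lemma differentiable_cong_open: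
  assumes "open U" "x \<in> U" "\<And>y. y \<in> U \<Longrightarrow> f y = g y"
  shows "f differentiable (at x) \<longleftrightarrow> g differentiable (at x)"
proof -
  have "(f has_derivative F) (at x) \<longleftrightarrow> (g has_derivative F) (at x)" for F
    by (rule has_derivative_cong_open[OF assms])
  then show ?thesis unfolding differentiable_def by presburger
qed

lemma smooth_fun_iff:
  "smooth_fun U f \<longleftrightarrow> (\<forall>x\<in>U. f differentiable (at x)) \<and> (\<forall>\<mu>. smooth_fun U (pdiff \<mu> f))"
proof
  assume f: "smooth_fun U f"
  have *: "foldr pdiff \<mu>s f differentiable (at x)" if "x \<in> U" for \<mu>s x
    using f that unfolding smooth_fun_def by blast
  have "foldr pdiff \<mu>s (pdiff \<mu> f) differentiable (at x)" if "x \<in> U" for \<mu>s \<mu> x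
    \<comment> \<open>\<open>foldr\<close> applies the last entry of the list first, so appending
      \<mu> puts its derivative innermost.\<close>
    using *[OF that, of "\<mu>s @ [\<mu>]"] by simp
  moreover have "f differentiable (at x)" if "x \<in> U" for x
    using *[OF that, of "[]"] by simp
  ultimately show "(\<forall>x\<in>U. f differentiable (at x)) \<and> (\<forall>\<mu>. smooth_fun U (pdiff \<mu> f))"
    unfolding smooth_fun_def by blast
next
  assume *: "(\<forall>x\<in>U. f differentiable (at x)) \<and> (\<forall>\<mu>. smooth_fun U (pdiff \<mu> f))"
  have "foldr pdiff \<mu>s f differentiable (at x)" if "x \<in> U" for \<mu>s x
  proof (cases \<mu>s rule: rev_cases)
    case Nil
    then show ?thesis using * that by simp
  next
    case (snoc ys y)
    have "smooth_fun U (pdiff y f)" using * by blast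
    then show ?thesis using snoc that unfolding smooth_fun_def by simp
  qed
  then show "smooth_fun U f" unfolding smooth_fun_def by blast
qed

text \<open>Smoothness is the weakest property that implies differentiability on \<open>U\<close>
  and is stable under partial derivatives. The closure proofs below only need a suitable invariant
  \<open>P\<close>.\<close>

lemma smooth_fun_coinduct:
  assumes "P f" and "\<And>f x. P f \<Longrightarrow> x \<in> U \<Longrightarrow> f differentiable (at x)" and "\<And>f \<mu>. P f \<Longrightarrow> P (pdiff \<mu> f)"
  shows "smooth_fun U f"
proof -
  have "P (foldr pdiff \<mu>s f)" for \<mu>s
    by (induction \<mu>s) (simp_all add: assms(1,3))
  then show ?thesis
    unfolding smooth_fun_def by (intro allI ballI assms(2))
qed

lemma smooth_fun_differentiable: "smooth_fun U f \<Longrightarrow> x \<in> U \<Longrightarrow> f differentiable (at x)"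
  using smooth_fun_iff by blast

lemma smooth_fun_pdiff: "smooth_fun U f \<Longrightarrow> smooth_fun U (pdiff \<mu> f)"
  using smooth_fun_iff by blast

lemma pdiff_const [simp]: "pdiff \<mu> (\<lambda>x. c) = (\<lambda>x. 0)"
  by (simp add: pdiff_def fun_eq_iff)

lemma pdiff_add:
  assumes "f differentiable (at x)" "g differentiable (at x)"
  shows "pdiff \<mu> (\<lambda>x. f x + g x) x = pdiff \<mu> f x + pdiff \<mu> g x"
  using frechet_derivative_at[OF has_derivative_add[OF frechet_derivative_works[THEN iffD1, OF assms(1)] frechet_derivative_works[THEN iffD1, OF assms(2)]], symmetric]
  by (simp add: pdiff_def)

lemma pdiff_mult:
  fixes f g :: "real^'m::finite \<Rightarrow> real"
  assumes "f differentiable (at x)" "g differentiable (at x)"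
  shows "pdiff \<mu> (\<lambda>x. f x * g x) x = f x * pdiff \<mu> g x + pdiff \<mu> f x * g x"
  using frechet_derivative_at[OF has_derivative_mult[OF frechet_derivative_works[THEN iffD1, OF assms(1)] frechet_derivative_works[THEN iffD1, OF assms(2)]], symmetric]
  by (simp add: pdiff_def)

lemma pdiff_sum:
  assumes "\<And>i. i \<in> I \<Longrightarrow> f i differentiable (at x)"
  shows "pdiff \<mu> (\<lambda>x. \<Sum>i\<in>I. f i x) x = (\<Sum>i\<in>I. pdiff \<mu> (f i) x)"
proof (cases "finite I")
  case True
  have "((\<lambda>x. \<Sum>i\<in>I. f i x) has_derivative (\<lambda>y. \<Sum>i\<in>I. frechet_derivative (f i) (at x) y)) (at x)"
    using assms by (intro has_derivative_sum) (simp add: frechet_derivative_works[THEN iffD1])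
  from frechet_derivative_at[OF this, symmetric] show ?thesis
    by (simp add: pdiff_def)
qed simp

lemma pdiff_coord: "pdiff \<mu> (\<lambda>x. x $ \<nu>) = (\<lambda>x::real^'m::finite. if \<mu> = \<nu> then 1 else 0)"
proof
  fix x :: "real^'m"
  have "((\<lambda>x. x $ \<nu>) has_derivative (\<lambda>x. x $ \<nu>)) (at x)"
    by (rule bounded_linear_imp_has_derivative) (rule bounded_linear_vec_nth)
  from frechet_derivative_at[OF this, symmetric]
  show "pdiff \<mu> (\<lambda>x. x $ \<nu>) x = (if \<mu> = \<nu> then 1 else 0)"
    by (auto simp: pdiff_def axis_def)
qed

lemma smooth_fun_cong:
  assumes "open U" "smooth_fun U f" "\<And>y. y \<in> U \<Longrightarrow> f y = g y"
  shows "smooth_fun U g"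
\<comment> \<open>The invariant speaks of equality on \<open>U\<close> only: it is just there that
  the derivatives of the two functions are known to agree.\<close>
proof (rule smooth_fun_coinduct[where P = "\<lambda>g. \<exists>f. smooth_fun U f \<and> (\<forall>y\<in>U. f y = g y)"])
  show "\<exists>f. smooth_fun U f \<and> (\<forall>y\<in>U. f y = g y)"
    using assms by blast
  show "g differentiable (at x)" if "\<exists>f. smooth_fun U f \<and> (\<forall>y\<in>U. f y = g y)" "x \<in> U" for g x
    using that differentiable_cong_open[OF assms(1)] smooth_fun_differentiable by metis
  show "\<exists>f. smooth_fun U f \<and> (\<forall>y\<in>U. f y = pdiff \<mu> g y)" if "\<exists>f. smooth_fun U f \<and> (\<forall>y\<in>U. f y = g y)" for g \<mu>
    using that pdiff_cong[OF assms(1)] smooth_fun_pdiff by metis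
qed

lemma smooth_fun_const: "smooth_fun U (\<lambda>x. c)"
  by (rule smooth_fun_coinduct[where P = "\<lambda>f. \<exists>c. f = (\<lambda>x. c)"]) auto

lemma smooth_fun_coord: "smooth_fun U (\<lambda>x. x $ \<nu>)"
  unfolding smooth_fun_iff[of U "\<lambda>x. x $ \<nu>"] pdiff_coord
  using smooth_fun_const[of U] by (simp add: bounded_linear_imp_differentiable bounded_linear_vec_nth)

lemma smooth_fun_add:
  assumes "open U" "smooth_fun U f" "smooth_fun U g"
  shows "smooth_fun U (\<lambda>x. f x + g x)"
proof (rule smooth_fun_coinduct[where P = "\<lambda>h. \<exists>f g. smooth_fun U f \<and> smooth_fun U g \<and> (\<forall>y\<in>U. h y = f y + g y)"], goal_cases)
  case 1
  then show ?case using assms by blast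
next
  case (2 h x)
  then obtain f g where "smooth_fun U f" "smooth_fun U g" "\<And>y. y \<in> U \<Longrightarrow> h y = f y + g y"
    by blast
  with 2(2) differentiable_cong_open[OF assms(1) 2(2), of h "\<lambda>x. f x + g x"] show ?case
    using smooth_fun_differentiable differentiable_add by metis
next
  case (3 h \<mu>)
  then obtain f g where "smooth_fun U f" "smooth_fun U g" "\<And>y. y \<in> U \<Longrightarrow> h y = f y + g y"
    by blast
  then have "\<forall>y\<in>U. pdiff \<mu> h y = pdiff \<mu> f y + pdiff \<mu> g y"
    using pdiff_cong[OF assms(1), of _ h "\<lambda>x. f x + g x"]
    by (auto simp: pdiff_add smooth_fun_differentiable)
  with \<open>smooth_fun U f\<close> \<open>smooth_fun U g\<close> show ?case
    using smooth_fun_pdiff by blast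
qed

lemma smooth_fun_sum:
  assumes "open U" "\<And>i. i \<in> I \<Longrightarrow> smooth_fun U (f i)"
  shows "smooth_fun U (\<lambda>x. \<Sum>i\<in>I. f i x)"
  using assms(2)
proof (induction I rule: infinite_finite_induct)
  case (insert i I)
  then show ?case using smooth_fun_add[OF assms(1), of "f i" "\<lambda>x. \<Sum>i\<in>I. f i x"] by auto
qed (simp_all add: smooth_fun_const)

lemma smooth_fun_mult:
  fixes f g :: "real^'m::finite \<Rightarrow> real"
  assumes "open U" "smooth_fun U f" "smooth_fun U g"
  shows "smooth_fun U (\<lambda>x. f x * g x)"
proof -
  \<comment> \<open>The derivative of a product is a sum of two products, so products alone are not
    stable under \<open>pdiff\<close>. The invariant is a finite sum of products, kept as a list of
    pairs of factors; the Leibniz rule replaces each pair by two.\<close>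
  let ?P = "\<lambda>h. \<exists>FG::((real^'m \<Rightarrow> real) \<times> (real^'m \<Rightarrow> real)) list. 
     (\<forall>(F,G)\<in>set FG. smooth_fun U F \<and> smooth_fun U G) \<and>
    (\<forall>y\<in>U. h y = (\<Sum>(F,G)\<leftarrow>FG. F y * G y))"
  have diff: "(\<lambda>y. \<Sum>(F,G)\<leftarrow>FG. F y * G y) differentiable (at x)"
    if "\<forall>(F,G)\<in>set FG. smooth_fun U F \<and> smooth_fun U G" "x \<in> U"
    for FG :: "((real^'m \<Rightarrow> real) \<times> (real^'m \<Rightarrow> real)) list" and x
    using that by (induction FG) (auto intro!: differentiable_add differentiable_mult intro: smooth_fun_differentiable[of U])
  have pd: "pdiff \<mu> (\<lambda>y. \<Sum>(F,G)\<leftarrow>FG. F y * G y) x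
      = (\<Sum>(F,G)\<leftarrow>concat (map (\<lambda>(F,G). [(F, pdiff \<mu> G), (pdiff \<mu> F, G)]) FG). F x * G x)"
    if "\<forall>(F,G)\<in>set FG. smooth_fun U F \<and> smooth_fun U G" "x \<in> U"
    for FG :: "((real^'m \<Rightarrow> real) \<times> (real^'m \<Rightarrow> real)) list" and x \<mu>
    using that
  proof (induction FG)
    case (Cons a FG)
    obtain F G where a: "a = (F,G)" by force
    have "pdiff \<mu> (\<lambda>y. F y * G y + (\<Sum>(F,G)\<leftarrow>FG. F y * G y)) x = pdiff \<mu> (\<lambda>y. F y * G y) x
      + pdiff \<mu> (\<lambda>y. \<Sum>(F,G)\<leftarrow>FG. F y * G y) x"
      using Cons a by (intro pdiff_add differentiable_mult diff) (auto intro: smooth_fun_differentiable)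
    also have "pdiff \<mu> (\<lambda>y. F y * G y) x = F x * pdiff \<mu> G x + pdiff \<mu> F x * G x"
      using Cons a by (intro pdiff_mult) (auto intro: smooth_fun_differentiable)
    finally show ?case using Cons a by simp
  qed simp
  show ?thesis
  proof (rule smooth_fun_coinduct[where P = ?P], goal_cases)
    case 1
    then show ?case using assms by (intro exI[of _ "[(f,g)]"]) auto
  next
    case (2 h x)
    then obtain FG where FG: "\<forall>(F,G)\<in>set FG. smooth_fun U F \<and> smooth_fun U G"
      "\<forall>y\<in>U. h y = (\<Sum>(F,G)\<leftarrow>FG. F y * G y)"
      by blast
    have "h differentiable (at x) \<longleftrightarrow> (\<lambda>y. \<Sum>(F,G)\<leftarrow>FG. F y * G y) differentiable (at x)"
      by (rule differentiable_cong_open[OF assms(1) 2(2)]) (rule FG(2)[rule_format])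
    with diff[OF FG(1) 2(2)] show ?case by simp
  next
    case (3 h \<mu>)
    then obtain FG where FG: "\<forall>(F,G)\<in>set FG. smooth_fun U F \<and> smooth_fun U G"
      "\<forall>y\<in>U. h y = (\<Sum>(F,G)\<leftarrow>FG. F y * G y)"
      by blast
    show ?case
    proof (intro exI conjI)
      show "\<forall>(F,G)\<in>set (concat (map (\<lambda>(F,G). [(F, pdiff \<mu> G), (pdiff \<mu> F, G)]) FG)). smooth_fun U F \<and> smooth_fun U G"
        using FG(1) by (induction FG) (auto simp: smooth_fun_pdiff)
      show "\<forall>y\<in>U. pdiff \<mu> h y =
          (\<Sum>(F,G)\<leftarrow>concat (map (\<lambda>(F,G). [(F, pdiff \<mu> G), (pdiff \<mu> F, G)]) FG). F y * G y)"
      proof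
        fix y assume y: "y \<in> U"
        have "pdiff \<mu> h y = pdiff \<mu> (\<lambda>y. \<Sum>(F,G)\<leftarrow>FG. F y * G y) y"
          by (rule pdiff_cong[OF assms(1) y]) (rule FG(2)[rule_format])
        also note pd[OF FG(1) y]
        finally show "pdiff \<mu> h y = (\<Sum>(F,G)\<leftarrow>concat (map (\<lambda>(F,G). [(F, pdiff \<mu> G), (pdiff \<mu> F, G)]) FG). F y * G y)" .
      qed
    qed
  qed
qed

lemma smooth_fun_cmult: "open U \<Longrightarrow> smooth_fun U f \<Longrightarrow> smooth_fun U (\<lambda>x. c * f x)"
  using smooth_fun_mult[OF _ smooth_fun_const] .

lemma smooth_fun_uminus: "open U \<Longrightarrow> smooth_fun U f \<Longrightarrow> smooth_fun U (\<lambda>x. - f x)"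
  using smooth_fun_cmult[of U f "-1"] by simp

lemma smooth_fun_diff: "open U \<Longrightarrow> smooth_fun U f \<Longrightarrow> smooth_fun U g \<Longrightarrow> smooth_fun U (\<lambda>x. f x - g x)"
  using smooth_fun_add[OF _ _ smooth_fun_uminus, of U f g] by simp

section \<open>Contractions with central coefficients\<close>

definition central :: "'w::ring \<Rightarrow> bool" where
  "central x \<longleftrightarrow> (\<forall>w. x * w = w * x)"

lemma centralD: "central x \<Longrightarrow> x * w = w * x"
  by (simp add: central_def)

lemma central_left_commute: "central x \<Longrightarrow> w * (x * z) = x * (w * z)"
  by (metis centralD mult.assoc)

text \<open>In the contractions \<open>f\<close> carries the tensor components, while
  \<open>u\<close>, \<open>v\<close>, \<open>w\<close> are fields or ghosts, whose order is kept
  because it determines the sign.\<close>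

definition con1 :: "('a::finite \<Rightarrow> 'w::real_algebra_1) \<Rightarrow> ('a \<Rightarrow> 'w) \<Rightarrow> 'w" where
  "con1 f u = (\<Sum>a\<in>UNIV. f a * u a)"

definition con2 :: "('a::finite \<Rightarrow> 'b::finite \<Rightarrow> 'w::real_algebra_1) \<Rightarrow> ('a \<Rightarrow> 'w) \<Rightarrow> ('b \<Rightarrow> 'w) \<Rightarrow> 'w" where
  "con2 f u v = (\<Sum>a\<in>UNIV. \<Sum>b\<in>UNIV. f a b * u a * v b)"

definition con3 :: "('a::finite \<Rightarrow> 'b::finite \<Rightarrow> 'c::finite \<Rightarrow> 'w::real_algebra_1) \<Rightarrow>
    ('a \<Rightarrow> 'w) \<Rightarrow> ('b \<Rightarrow> 'w) \<Rightarrow> ('c \<Rightarrow> 'w) \<Rightarrow> 'w" where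
  "con3 f u v w = (\<Sum>a\<in>UNIV. \<Sum>b\<in>UNIV. \<Sum>c\<in>UNIV. f a b c * u a * v b * w c)"

lemmas con_defs = con1_def con2_def con3_def
lemmas con_expand = distrib_left distrib_right left_diff_distrib right_diff_distrib
  sum.distrib sum_subtractf sum_negf scaleR_sum_right[symmetric]

lemma con2_linear:
  "con2 f (\<lambda>a. u a + u' a) v = con2 f u v + con2 f u' v"
  "con2 f (\<lambda>a. u a - u' a) v = con2 f u v - con2 f u' v"
  "con2 f (\<lambda>a. - u a) v = - con2 f u v"
  "con2 f (\<lambda>a. r *\<^sub>R u a) v = r *\<^sub>R con2 f u v"
  "con2 f u (\<lambda>a. v a + v' a) = con2 f u v + con2 f u v'"
  "con2 f u (\<lambda>a. v a - v' a) = con2 f u v - con2 f u v'"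
  "con2 f u (\<lambda>a. - v a) = - con2 f u v"
  "con2 f u (\<lambda>a. r *\<^sub>R v a) = r *\<^sub>R con2 f u v"
  by (simp_all add: con_defs con_expand)

lemma con2_linear_coeff:
  "con2 (\<lambda>a b. f a b + g a b) u v = con2 f u v + con2 g u v"
  "con2 (\<lambda>a b. f a b - g a b) u v = con2 f u v - con2 g u v"
  "con2 (\<lambda>a b. - f a b) u v = - con2 f u v"
  "con2 (\<lambda>a b. r *\<^sub>R f a b) u v = r *\<^sub>R con2 f u v"
  by (simp_all add: con_defs con_expand)

lemma con3_linear_coeff:
  "con3 (\<lambda>a b c. f a b c + g a b c) u v w = con3 f u v w + con3 g u v w"
  "con3 (\<lambda>a b c. f a b c - g a b c) u v w = con3 f u v w - con3 g u v w"
  "con3 (\<lambda>a b c. - f a b c) u v w = - con3 f u v w"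
  "con3 (\<lambda>a b c. r *\<^sub>R f a b c) u v w = r *\<^sub>R con3 f u v w"
  by (simp_all add: con_defs con_expand)

text \<open>A single sign serves all pairs of components, since the components of one field share
  their bidegree.\<close>

definition scomm :: "real \<Rightarrow> ('a \<Rightarrow> 'w::real_algebra_1) \<Rightarrow> ('b \<Rightarrow> 'w) \<Rightarrow> bool" where
  "scomm s u v \<longleftrightarrow> (\<forall>a b. u a * v b = s *\<^sub>R (v b * u a))"

lemma scommD: "scomm s u v \<Longrightarrow> u a * v b = s *\<^sub>R (v b * u a)"
  by (simp add: scomm_def)

lemma scomm_con1_right:
  fixes f :: "'c::finite \<Rightarrow> 'd \<Rightarrow> 'w::real_algebra_1"
  assumes "scomm s v u" "\<And>a b. central (f a b)"
  shows "scomm s v (\<lambda>b. con1 (\<lambda>a. f a b) u)"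
proof -
  have "v c * (f a b * u a) = s *\<^sub>R (f a b * u a * v c)" for a b c
    using scommD[OF assms(1)] central_left_commute[OF assms(2)]
    by (simp add: mult.assoc)
  then show ?thesis
    unfolding scomm_def con1_def sum_distrib_left sum_distrib_right scaleR_sum_right by simp
qed

lemma con2_swap:
  assumes "scomm s u v"
  shows "con2 (\<lambda>a b. f b a) u v = s *\<^sub>R con2 f v u"
  unfolding con2_def scaleR_sum_right
  by (subst sum.swap) (simp add: mult.assoc scommD[OF assms])

text \<open>Moving \<open>u\<close> past \<open>v\<close> and \<open>w\<close> costs the signs
  \<open>s\<close> and \<open>t\<close>; renaming the summation indices restores the argument order
  of \<open>f\<close>. A tensor with cyclic symmetry can thus be passed from one order of the fields
  to another.\<close>

lemma con3_rotate_left: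
  assumes "scomm s u v" "scomm t u w"
  shows "con3 (\<lambda>a b c. f b c a) u v w = (s * t) *\<^sub>R con3 f v w u"
proof -
  have *: "u a * (v b * w c) = (s * t) *\<^sub>R (v b * (w c * u a))" for a b c
  proof -
    have "u a * (v b * w c) = s *\<^sub>R (v b * (u a * w c))"
      using scommD[OF assms(1), of a b] by (simp flip: mult.assoc)
    then show ?thesis
      by (simp add: scommD[OF assms(2), of a c])
  qed
  have "con3 (\<lambda>a b c. f b c a) u v w = (\<Sum>a\<in>UNIV. \<Sum>b\<in>UNIV. \<Sum>c\<in>UNIV. (s * t) *\<^sub>R (f b c a * v b * w c * u a))"
    unfolding con3_def by (simp add: mult.assoc *)
  also have "\<dots> = (\<Sum>b\<in>UNIV. \<Sum>c\<in>UNIV. \<Sum>a\<in>UNIV. (s * t) *\<^sub>R (f b c a * v b * w c * u a))"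
    by (subst sum.swap, intro sum.cong refl, rule sum.swap)
  finally show ?thesis by (simp add: con3_def scaleR_sum_right)
qed

lemma con3_rotate_right:
  assumes "scomm s u w" "scomm t v w"
  shows "con3 (\<lambda>a b c. f c a b) u v w = (s * t) *\<^sub>R con3 f w u v"
proof -
  have *: "u a * (v b * w c) = (s * t) *\<^sub>R (w c * (u a * v b))" for a b c
  proof -
    have "u a * (v b * w c) = t *\<^sub>R (u a * w c * v b)"
      by (simp add: scommD[OF assms(2), of b c] mult.assoc)
    then show ?thesis
      by (simp add: scommD[OF assms(1), of a c] mult.assoc mult.commute)
  qed
  have "con3 (\<lambda>a b c. f c a b) u v w = (\<Sum>a\<in>UNIV. \<Sum>b\<in>UNIV. \<Sum>c\<in>UNIV. (s * t) *\<^sub>R (f c a b * w c * u a * v b))"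
    unfolding con3_def by (simp add: mult.assoc *)
  also have "\<dots> = (\<Sum>a\<in>UNIV. \<Sum>c\<in>UNIV. \<Sum>b\<in>UNIV. (s * t) *\<^sub>R (f c a b * w c * u a * v b))"
    by (intro sum.cong refl, rule sum.swap)
  also have "\<dots> = (\<Sum>c\<in>UNIV. \<Sum>a\<in>UNIV. \<Sum>b\<in>UNIV. (s * t) *\<^sub>R (f c a b * w c * u a * v b))"
    by (rule sum.swap)
  finally show ?thesis by (simp add: con3_def scaleR_sum_right)
qed

lemma con3_swap23:
  assumes "scomm s v w"
  shows "con3 (\<lambda>a b c. f a c b) u v w = s *\<^sub>R con3 f u w v"
proof -
  have *: "u a * (v b * w c) = s *\<^sub>R (u a * (w c * v b))" for a b c
    by (simp add: scommD[OF assms, of b c])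
  have "con3 (\<lambda>a b c. f a c b) u v w = (\<Sum>a\<in>UNIV. \<Sum>b\<in>UNIV. \<Sum>c\<in>UNIV. s *\<^sub>R (f a c b * u a * w c * v b))"
    unfolding con3_def by (simp add: mult.assoc *)
  also have "\<dots> = (\<Sum>a\<in>UNIV. \<Sum>c\<in>UNIV. \<Sum>b\<in>UNIV. s *\<^sub>R (f a c b * u a * w c * v b))"
    by (intro sum.cong refl, rule sum.swap)
  finally show ?thesis by (simp add: con3_def scaleR_sum_right)
qed

lemma con1_con1:
  "con1 f (\<lambda>d. con1 (\<lambda>a. g a d) u) = con1 (\<lambda>a. \<Sum>d\<in>UNIV. f d * g a d) u"
  unfolding con1_def sum_distrib_left sum_distrib_right
  by (subst sum.swap) (simp add: mult.assoc)

lemma con3_con1_left: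
  "con3 f (\<lambda>d. con1 (\<lambda>a. g a d) u) v w = con3 (\<lambda>a b c. \<Sum>d\<in>UNIV. f d b c * g a d) u v w"
proof -
  have "con3 f (\<lambda>d. con1 (\<lambda>a. g a d) u) v w =
      (\<Sum>d\<in>UNIV. \<Sum>b\<in>UNIV. \<Sum>c\<in>UNIV. \<Sum>a\<in>UNIV. f d b c * g a d * u a * v b * w c)"
    unfolding con1_def con3_def by (simp add: sum_distrib_left sum_distrib_right mult.assoc)
  also have "\<dots> = (\<Sum>d\<in>UNIV. \<Sum>b\<in>UNIV. \<Sum>a\<in>UNIV. \<Sum>c\<in>UNIV. f d b c * g a d * u a * v b * w c)"
    by (intro sum.cong refl, rule sum.swap)
  also have "\<dots> = (\<Sum>d\<in>UNIV. \<Sum>a\<in>UNIV. \<Sum>b\<in>UNIV. \<Sum>c\<in>UNIV. f d b c * g a d * u a * v b * w c)"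
    by (intro sum.cong refl, rule sum.swap)
  also have "\<dots> = (\<Sum>a\<in>UNIV. \<Sum>b\<in>UNIV. \<Sum>d\<in>UNIV. \<Sum>c\<in>UNIV. f d b c * g a d * u a * v b * w c)"
    by (subst sum.swap, intro sum.cong refl, rule sum.swap)
  also have "\<dots> = (\<Sum>a\<in>UNIV. \<Sum>b\<in>UNIV. \<Sum>c\<in>UNIV. \<Sum>d\<in>UNIV. f d b c * g a d * u a * v b * w c)"
    by (intro sum.cong refl, rule sum.swap)
  finally show ?thesis by (simp add: con3_def sum_distrib_right)
qed

lemma con3_con1_right:
  assumes "\<And>c d. central (g c d)"
  shows "con3 f u v (\<lambda>d. con1 (\<lambda>c. g c d) w) = con3 (\<lambda>a b c. \<Sum>d\<in>UNIV. f a b d * g c d) u v w"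
proof -
  have *: "f a b d * u a * v b * (g c d * w c) = f a b d * g c d * u a * v b * w c" for a b c d
    by (simp add: mult.assoc central_left_commute[OF assms])
  have "con3 f u v (\<lambda>d. con1 (\<lambda>c. g c d) w) =
      (\<Sum>a\<in>UNIV. \<Sum>b\<in>UNIV. \<Sum>d\<in>UNIV. \<Sum>c\<in>UNIV. f a b d * g c d * u a * v b * w c)"
    unfolding con1_def con3_def by (simp add: sum_distrib_left *)
  also have "\<dots> = (\<Sum>a\<in>UNIV. \<Sum>b\<in>UNIV. \<Sum>c\<in>UNIV. \<Sum>d\<in>UNIV. f a b d * g c d * u a * v b * w c)"
    by (intro sum.cong refl, rule sum.swap)
  finally show ?thesis by (simp add: con3_def sum_distrib_right)
qed

lemma con3_con1_con2:
  fixes f :: "'i::finite \<Rightarrow> 'a::finite \<Rightarrow> 'w::real_algebra_1"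
  assumes "\<And>i b c. central (g i b c)"
  shows "(\<Sum>i\<in>UNIV. con1 (f i) u * con2 (g i) v w) = con3 (\<lambda>a b c. \<Sum>i\<in>UNIV. f i a * g i b c) u v w"
proof -
  have *: "f i a * u a * (g i b c * v b * w c) = f i a * g i b c * u a * v b * w c" for i a b c
    by (simp add: mult.assoc central_left_commute[OF assms])
  have "con1 (f i) u * con2 (g i) v w =
      (\<Sum>a\<in>UNIV. \<Sum>b\<in>UNIV. \<Sum>c\<in>UNIV. f i a * g i b c * u a * v b * w c)" for i
    unfolding con1_def con2_def sum_distrib_right[of "\<lambda>a. f i a * u a"]
    by (simp only: sum_distrib_left *)
  then have "(\<Sum>i\<in>UNIV. con1 (f i) u * con2 (g i) v w) =
      (\<Sum>i\<in>UNIV. \<Sum>a\<in>UNIV. \<Sum>b\<in>UNIV. \<Sum>c\<in>UNIV. f i a * g i b c * u a * v b * w c)"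
    by (simp only:)
  also have "\<dots> = (\<Sum>a\<in>UNIV. \<Sum>b\<in>UNIV. \<Sum>i\<in>UNIV. \<Sum>c\<in>UNIV. f i a * g i b c * u a * v b * w c)"
    by (subst sum.swap, intro sum.cong refl, rule sum.swap)
  also have "\<dots> = (\<Sum>a\<in>UNIV. \<Sum>b\<in>UNIV. \<Sum>c\<in>UNIV. \<Sum>i\<in>UNIV. f i a * g i b c * u a * v b * w c)"
    by (intro sum.cong refl, rule sum.swap)
  finally show ?thesis by (simp add: con3_def sum_distrib_right)
qed

lemma con2_con1_con1:
  fixes f :: "'i::finite \<Rightarrow> 'a::finite \<Rightarrow> 'w::real_algebra_1"
  assumes "\<And>i b. central (g i b)"
  shows "(\<Sum>i\<in>UNIV. con1 (f i) u * con1 (g i) v) = con2 (\<lambda>a b. \<Sum>i\<in>UNIV. f i a * g i b) u v"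
proof -
  have *: "f i a * u a * (g i b * v b) = f i a * g i b * u a * v b" for i a b
    by (simp add: mult.assoc central_left_commute[OF assms])
  have "con1 (f i) u * con1 (g i) v = (\<Sum>a\<in>UNIV. \<Sum>b\<in>UNIV. f i a * g i b * u a * v b)" for i
    unfolding con1_def sum_distrib_right[of "\<lambda>a. f i a * u a"]
    by (simp only: sum_distrib_left *)
  then have "(\<Sum>i\<in>UNIV. con1 (f i) u * con1 (g i) v) =
      (\<Sum>i\<in>UNIV. \<Sum>a\<in>UNIV. \<Sum>b\<in>UNIV. f i a * g i b * u a * v b)"
    by (simp only:)
  also have "\<dots> = (\<Sum>a\<in>UNIV. \<Sum>b\<in>UNIV. \<Sum>i\<in>UNIV. f i a * g i b * u a * v b)"
    by (subst sum.swap, intro sum.cong refl, rule sum.swap)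
  finally show ?thesis by (simp add: con2_def sum_distrib_right)
qed

text \<open>\<open>V\<close> and \<open>v\<close> keep their order, so no sign appears: only central
  coefficients are moved.\<close>

lemma con2_vector_left:
  assumes "\<And>a i. central (g a i)" "\<And>a b. central (f a b)"
  shows "con2 f (\<lambda>a. \<Sum>i\<in>UNIV. g a i * V i) v = (\<Sum>i\<in>UNIV. V i * con1 (\<lambda>b. \<Sum>a\<in>UNIV. f a b * g a i) v)"
proof -
  have *: "V i * (f a b * g a i * v b) = f a b * (g a i * V i) * v b" for a b i
    by (simp add: mult.assoc central_left_commute[OF assms(1), of "V i"] central_left_commute[OF assms(2), of "V i"])
  have "con2 f (\<lambda>a. \<Sum>i\<in>UNIV. g a i * V i) v = (\<Sum>a\<in>UNIV. \<Sum>b\<in>UNIV. \<Sum>i\<in>UNIV. f a b * (g a i * V i) * v b)"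
    unfolding con2_def by (simp add: sum_distrib_left sum_distrib_right)
  also have "\<dots> = (\<Sum>b\<in>UNIV. \<Sum>a\<in>UNIV. \<Sum>i\<in>UNIV. f a b * (g a i * V i) * v b)"
    by (rule sum.swap)
  also have "\<dots> = (\<Sum>b\<in>UNIV. \<Sum>i\<in>UNIV. \<Sum>a\<in>UNIV. f a b * (g a i * V i) * v b)"
    by (intro sum.cong refl, rule sum.swap)
  also have "\<dots> = (\<Sum>i\<in>UNIV. \<Sum>b\<in>UNIV. \<Sum>a\<in>UNIV. f a b * (g a i * V i) * v b)"
    by (rule sum.swap)
  finally show ?thesis by (simp add: con1_def sum_distrib_right sum_distrib_left *)
qed

lemma con2_vector_right:
  assumes "\<And>a i. central (g a i)"
  shows "con2 f v (\<lambda>a. \<Sum>i\<in>UNIV. g a i * V i) = (\<Sum>i\<in>UNIV. con1 (\<lambda>a. \<Sum>b\<in>UNIV. f a b * g b i) v * V i)"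
proof -
  have *: "f a b * v a * (g b i * V i) = f a b * g b i * v a * V i" for a b i
    by (simp add: mult.assoc central_left_commute[OF assms(1)])
  have "con2 f v (\<lambda>a. \<Sum>i\<in>UNIV. g a i * V i) = (\<Sum>a\<in>UNIV. \<Sum>b\<in>UNIV. \<Sum>i\<in>UNIV. f a b * g b i * v a * V i)"
    unfolding con2_def by (simp add: sum_distrib_left sum_distrib_right *)
  also have "\<dots> = (\<Sum>a\<in>UNIV. \<Sum>i\<in>UNIV. \<Sum>b\<in>UNIV. f a b * g b i * v a * V i)"
    by (intro sum.cong refl, rule sum.swap)
  also have "\<dots> = (\<Sum>i\<in>UNIV. \<Sum>a\<in>UNIV. \<Sum>b\<in>UNIV. f a b * g b i * v a * V i)"
    by (rule sum.swap)
  finally show ?thesis by (simp add: con1_def sum_distrib_right sum_distrib_left)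
qed

lemma con2_con2_left:
  shows "con2 f (\<lambda>d. con2 (g d) u v) w = con3 (\<lambda>a b c. \<Sum>d\<in>UNIV. f d c * g d a b) u v w"
proof -
  have "con2 f (\<lambda>d. con2 (g d) u v) w = (\<Sum>d\<in>UNIV. \<Sum>c\<in>UNIV. \<Sum>a\<in>UNIV. \<Sum>b\<in>UNIV. f d c * g d a b * u a * v b * w c)"
    unfolding con2_def by (simp add: sum_distrib_left sum_distrib_right mult.assoc)
  also have "\<dots> = (\<Sum>c\<in>UNIV. \<Sum>a\<in>UNIV. \<Sum>d\<in>UNIV. \<Sum>b\<in>UNIV. f d c * g d a b * u a * v b * w c)"
    by (subst sum.swap, intro sum.cong refl, rule sum.swap)
  also have "\<dots> = (\<Sum>c\<in>UNIV. \<Sum>a\<in>UNIV. \<Sum>b\<in>UNIV. \<Sum>d\<in>UNIV. f d c * g d a b * u a * v b * w c)"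
    by (intro sum.cong refl, rule sum.swap)
  also have "\<dots> = (\<Sum>a\<in>UNIV. \<Sum>b\<in>UNIV. \<Sum>c\<in>UNIV. \<Sum>d\<in>UNIV. f d c * g d a b * u a * v b * w c)"
    by (subst sum.swap, intro sum.cong refl, rule sum.swap)
  finally show ?thesis by (simp add: con3_def sum_distrib_right)
qed

lemma con2_con2_right:
  assumes "\<And>a b c. central (g a b c)"
  shows "con2 f w (\<lambda>d. con2 (g d) u v) = con3 (\<lambda>a b c. \<Sum>d\<in>UNIV. f a d * g d b c) w u v"
proof -
  have *: "f a d * w a * (g d b c * u b * v c) = f a d * g d b c * w a * u b * v c" for a b c d
    by (simp add: mult.assoc central_left_commute[OF assms(1)])
  have "con2 f w (\<lambda>d. con2 (g d) u v) = (\<Sum>a\<in>UNIV. \<Sum>d\<in>UNIV. \<Sum>b\<in>UNIV. \<Sum>c\<in>UNIV. f a d * g d b c * w a * u b * v c)"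
    unfolding con2_def by (simp add: sum_distrib_left sum_distrib_right *)
  also have "\<dots> = (\<Sum>a\<in>UNIV. \<Sum>b\<in>UNIV. \<Sum>c\<in>UNIV. \<Sum>d\<in>UNIV. f a d * g d b c * w a * u b * v c)"
    by (intro sum.cong refl, subst sum.swap, intro sum.cong refl, rule sum.swap)
  finally show ?thesis by (simp add: con3_def sum_distrib_right)
qed

lemma con2_sum_coeff:
  assumes "\<And>i a b. central (g i a b)"
  shows "con2 (\<lambda>a b. \<Sum>i\<in>UNIV. g i a b * V i) u v = (\<Sum>i\<in>UNIV. V i * con2 (g i) u v)"
proof -
  have *: "V i * (g i a b * u a * v b) = g i a b * V i * u a * v b" for a b i
    by (simp add: mult.assoc central_left_commute[OF assms(1)])
  have "con2 (\<lambda>a b. \<Sum>i\<in>UNIV. g i a b * V i) u v = (\<Sum>a\<in>UNIV. \<Sum>b\<in>UNIV. \<Sum>i\<in>UNIV. g i a b * V i * u a * v b)"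
    unfolding con2_def by (simp add: sum_distrib_left sum_distrib_right)
  also have "\<dots> = (\<Sum>a\<in>UNIV. \<Sum>i\<in>UNIV. \<Sum>b\<in>UNIV. g i a b * V i * u a * v b)"
    by (intro sum.cong refl, rule sum.swap)
  also have "\<dots> = (\<Sum>i\<in>UNIV. \<Sum>a\<in>UNIV. \<Sum>b\<in>UNIV. g i a b * V i * u a * v b)"
    by (rule sum.swap)
  finally show ?thesis by (simp add: con2_def sum_distrib_left *)
qed

text \<open>Here \<open>r\<close> is the sign for moving the derivation past \<open>u\<close>;
  coefficients of degree 0 contribute none.\<close>

lemma con2_deriv:
  assumes "linear D" and "\<And>a b. D (f a b * u a * v b) = D (f a b) * u a * v b + f a b * D (u a) * v b + r *\<^sub>R (f a b * u a * D (v b))"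
  shows "D (con2 f u v) = con2 (\<lambda>a b. D (f a b)) u v + con2 f (\<lambda>a. D (u a)) v + r *\<^sub>R con2 f u (\<lambda>b. D (v b))"
  unfolding con2_def by (simp add: linear_sum[OF assms(1)] assms(2) sum.distrib scaleR_sum_right)

section \<open>Smooth functions and fields in the sigma model\<close>

text \<open>Such an element commutes with all homogeneous elements, and every element is a finite
  sum of homogeneous ones.\<close>

lemma graded_comm_algebra_central:
  fixes G :: "'i::comm_monoid_add \<Rightarrow> 'w::real_algebra_1 set"
  assumes "graded_comm_algebra G q" "x \<in> G i" "\<And>j. even (q i j)"
  shows "central x"
  unfolding central_def
proof
  fix w
  have "\<forall>i j. \<forall>x\<in>G i. \<forall>y\<in>G j. x * y \<in> G (i + j) \<and> x * y = (-1) ^ q i j * (y * x)"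
    using assms(1) unfolding graded_comm_algebra_def by (elim conjE)
  then have *: "x * y = y * x" if "y \<in> G j" for y j
    using assms(2,3) that by (metis mult_1 minus_one_power_iff)
  have "\<forall>w. \<exists>!c. (\<forall>i. c i \<in> G i) \<and> finite {i. c i \<noteq> 0} \<and> w = (\<Sum>i | c i \<noteq> 0. c i)"
    using assms(1) unfolding graded_comm_algebra_def by (elim conjE)
  then obtain c where c: "\<forall>i. c i \<in> G i" "w = (\<Sum>i | c i \<noteq> 0. c i)"
    by blast
  then show "x * w = w * x"
    by (simp add: c(2) sum_distrib_left sum_distrib_right *[OF c(1)[rule_format]])
qed

text \<open>The connection of the locale has symmetric coefficients \<open>gam\<close>; in the
  theorem the locale is instantiated with \<open>torsionless N\<close>.\<close>

locale sigma_model_setup =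
  fixes U :: "(real^'m::finite) set"
    and K :: "('m, 'a::finite) courant_data"
    and N :: "('m, 'a) connection"
    and M :: "('o::real_algebra_1, 'm, 'a) graded_target"
    and S :: "('w::real_algebra_1, 'o, 'm, 'a) sigma_model"
  assumes courant: "twisted_courant U K"
    and connection: "smooth_connection U N"
    and torsion_free: "gam N \<nu> \<mu> \<sigma> = gam N \<nu> \<sigma> \<mu>"
    and metric: "metric_connection U K N"
    and target: "target_functions U M"
    and fields: "field_algebra U M S"
    and brst: "brst_transformation K M S"
begin

lemma open_U: "open U"
  using courant unfolding twisted_courant_def by blast

lemmas smooth_intros =
  smooth_fun_const smooth_fun_pdiff
  smooth_fun_add[OF open_U] smooth_fun_diff[OF open_U] smooth_fun_uminus[OF open_U]
  smooth_fun_mult[OF open_U] smooth_fun_sum[OF open_U]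

lemma smooth_rho: "smooth_fun U (rho K a \<mu>)"
proof -
  have "\<forall>a \<mu>. smooth_fun U (rho K a \<mu>)"
    using courant unfolding twisted_courant_def by (elim conjE)
  then show ?thesis by blast
qed

lemma smooth_cst: "smooth_fun U (cst K a b c)"
proof -
  have "\<forall>a b c. smooth_fun U (cst K a b c)"
    using courant unfolding twisted_courant_def by (elim conjE)
  then show ?thesis by blast
qed

lemma smooth_hfl: "smooth_fun U (hfl K \<mu> \<nu> \<kappa> \<tau>)"
proof -
  have "\<forall>\<mu> \<nu> \<kappa> \<tau>. smooth_fun U (hfl K \<mu> \<nu> \<kappa> \<tau>)"
    using courant unfolding twisted_courant_def by (elim conjE)
  then show ?thesis by blast
qed

lemma smooth_gam: "smooth_fun U (gam N \<nu> \<mu> \<sigma>)"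
  using connection unfolding smooth_connection_def by blast

lemma smooth_omg: "smooth_fun U (omg N \<mu> a b)"
  using connection unfolding smooth_connection_def by blast

lemmas smooth_data = smooth_rho smooth_cst smooth_hfl smooth_gam smooth_omg

lemma smooth_cst_up: "smooth_fun U (cst_up K a b c)"
  unfolding cst_up_def[abs_def] by (intro smooth_intros smooth_data)

lemma smooth_hfl1: "smooth_fun U (hfl1 K \<mu> \<nu> \<sigma> a)"
  unfolding hfl1_def[abs_def] by (intro smooth_intros smooth_data)

lemma smooth_hfl2: "smooth_fun U (hfl2 K \<mu> \<nu> a b)"
  unfolding hfl2_def[abs_def] by (intro smooth_intros smooth_data)

lemma smooth_hfl3: "smooth_fun U (hfl3 K \<mu> a b c)"
  unfolding hfl3_def[abs_def] by (intro smooth_intros smooth_data)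

lemma smooth_om_low: "smooth_fun U (om_low K N \<mu> a b)"
  unfolding om_low_def[abs_def] by (intro smooth_intros smooth_data)

lemma smooth_nabla_rho: "smooth_fun U (nabla_rho K N \<mu> a \<nu>)"
  unfolding nabla_rho_def[abs_def] by (intro smooth_intros smooth_data)

lemma smooth_omE: "smooth_fun U (omE K N a b c)"
  unfolding omE_def[abs_def] by (intro smooth_intros smooth_data)

lemma smooth_torsion: "smooth_fun U (gualtieri_torsion K N a b c)"
  unfolding gualtieri_torsion_def[abs_def] by (intro smooth_intros smooth_omE smooth_cst_up)

lemma smooth_torsion_up: "smooth_fun U (gualtieri_torsion_up K N a b c)"
  unfolding gualtieri_torsion_up_def[abs_def] by (intro smooth_intros smooth_torsion)

lemma smooth_curv: "smooth_fun U (curv N a b \<mu> \<nu>)"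
  unfolding curv_def[abs_def] by (intro smooth_intros smooth_data)

lemma smooth_curv_low: "smooth_fun U (curv_low K N a b \<mu> \<nu>)"
  unfolding curv_low_def[abs_def] by (intro smooth_intros smooth_curv)

lemma smooth_calC: "smooth_fun U (calC K N \<mu> a b c)"
  unfolding calC_def[abs_def] by (intro smooth_intros smooth_data smooth_curv)

lemma smooth_nabla_torsion: "smooth_fun U (nabla_torsion K N \<mu> a b c)"
  unfolding nabla_torsion_def[abs_def] by (intro smooth_intros smooth_data smooth_torsion)

lemma smooth_curvature: "smooth_fun U (twisted_basic_curvature K N \<mu> a b c)"
  unfolding twisted_basic_curvature_def[abs_def] basic_curvature_def
  by (intro smooth_intros smooth_nabla_torsion smooth_calC smooth_hfl3)

lemma smooth_omega_sq: "smooth_fun U (omega_sq K N \<mu> \<nu> a b)"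
  unfolding omega_sq_def[abs_def] by (intro smooth_intros smooth_data smooth_om_low)

lemmas smooth_all = smooth_intros smooth_data smooth_cst_up smooth_hfl1 smooth_hfl2 smooth_hfl3
  smooth_om_low smooth_nabla_rho smooth_omE smooth_torsion smooth_torsion_up smooth_curv
  smooth_curv_low smooth_curvature smooth_omega_sq

section \<open>Pulled-back functions, commutation signs and Leibniz rules in the field
  algebra\<close>

abbreviation p :: "(real^'m \<Rightarrow> real) \<Rightarrow> 'w" where
  "p \<equiv> pbf M S"

lemma field_algebra_graded: "graded_comm_algebra (bigr S) (\<lambda>i j. snd i * snd j + fst i * fst j)"
  using fields unfolding field_algebra_def by blast

lemma bigr_commute:
  assumes "x \<in> bigr S (g, f)" "y \<in> bigr S (g', f')"
  shows "x * y = (-1) ^ (f * f' + g * g') *\<^sub>R (y * x)"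
proof -
  have "\<forall>i j. \<forall>x\<in>bigr S i. \<forall>y\<in>bigr S j. x * y \<in> bigr S (i + j) \<and>
      x * y = (-1) ^ (snd i * snd j + fst i * fst j) * (y * x)"
    using field_algebra_graded unfolding graded_comm_algebra_def by (elim conjE)
  from this[rule_format, OF assms] show ?thesis
    unfolding fst_conv snd_conv
    by (cases "even (f * f' + g * g')") (simp_all del: even_add even_mult_iff)
qed

lemma bigr_mult:
  assumes "x \<in> bigr S (g, f)" "y \<in> bigr S (g', f')"
  shows "x * y \<in> bigr S (g + g', f + f')"
proof -
  have "\<forall>i j. \<forall>x\<in>bigr S i. \<forall>y\<in>bigr S j. x * y \<in> bigr S (i + j) \<and>
      x * y = (-1) ^ (snd i * snd j + fst i * fst j) * (y * x)"
    using field_algebra_graded unfolding graded_comm_algebra_def by (elim conjE)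
  from this[rule_format, OF assms, THEN conjunct1] show ?thesis by simp
qed

lemma bigr_subspace: "subspace (bigr S i)"
  using field_algebra_graded unfolding graded_comm_algebra_def by blast

lemma bigr_central:
  assumes "x \<in> bigr S (0, 0)"
  shows "central x"
  by (rule graded_comm_algebra_central[OF field_algebra_graded assms]) simp

lemma pull_linear: "linear (pull S)"
  and pull_1: "pull S 1 = 1"
  and pull_mult: "pull S (u * v) = pull S u * pull S v"
  and pull_grd: "u \<in> grd M n \<Longrightarrow> pull S u \<in> bigr S (0, n)"
  using fields unfolding field_algebra_def by blast+

lemma fn_grd: "smooth_fun U f \<Longrightarrow> fn M f \<in> grd M 0"
  using target unfolding target_functions_def by (elim conjE) blast

lemma fn_const: "fn M (\<lambda>x. r) = of_real r"
  using target unfolding target_functions_def by (elim conjE) blast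

lemma fn_ring:
  assumes "smooth_fun U f" "smooth_fun U g"
  shows "fn M (\<lambda>x. f x + g x) = fn M f + fn M g \<and> fn M (\<lambda>x. f x * g x) = fn M f * fn M g \<and>
    (fn M f = fn M g \<longleftrightarrow> (\<forall>x\<in>U. f x = g x))"
proof -
  have "\<forall>f g. smooth_fun U f \<longrightarrow> smooth_fun U g \<longrightarrow>
      fn M (\<lambda>x. f x + g x) = fn M f + fn M g \<and> fn M (\<lambda>x. f x * g x) = fn M f * fn M g \<and>
      (fn M f = fn M g \<longleftrightarrow> (\<forall>x\<in>U. f x = g x))"
    using target unfolding target_functions_def by (elim conjE)
  from this[rule_format, OF assms] show ?thesis .
qed

lemmas fn_add = fn_ring[THEN conjunct1]
lemmas fn_mult = fn_ring[THEN conjunct2, THEN conjunct1]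

lemma fn_cong: "smooth_fun U f \<Longrightarrow> (\<And>x. x \<in> U \<Longrightarrow> f x = g x) \<Longrightarrow> fn M f = fn M g"
  using fn_ring[of f g] smooth_fun_cong[OF open_U, of f g] by simp

lemma fn_minus: "smooth_fun U f \<Longrightarrow> fn M (\<lambda>x. - f x) = - fn M f"
  using fn_mult[OF smooth_fun_const, of f "-1"] by (simp add: fn_const)

lemma p_mem: "smooth_fun U f \<Longrightarrow> p f \<in> bigr S (0, 0)"
  by (simp add: pbf_def pull_grd fn_grd)

lemma p_central: "smooth_fun U f \<Longrightarrow> central (p f)"
  by (simp add: bigr_central p_mem)

lemma p_cong: "smooth_fun U f \<Longrightarrow> (\<And>x. x \<in> U \<Longrightarrow> f x = g x) \<Longrightarrow> p f = p g"
  unfolding pbf_def using fn_cong[of f g] by simp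

lemma p_const: "p (\<lambda>x. r) = of_real r"
  by (simp add: pbf_def fn_const of_real_def linear_scale[OF pull_linear] pull_1)

lemma p_add: "smooth_fun U f \<Longrightarrow> smooth_fun U g \<Longrightarrow> p (\<lambda>x. f x + g x) = p f + p g"
  by (simp add: pbf_def fn_add linear_add[OF pull_linear])

lemma p_mult: "smooth_fun U f \<Longrightarrow> smooth_fun U g \<Longrightarrow> p (\<lambda>x. f x * g x) = p f * p g"
  by (simp add: pbf_def fn_mult pull_mult)

lemma p_scale: "smooth_fun U f \<Longrightarrow> p (\<lambda>x. r * f x) = r *\<^sub>R p f"
  using p_mult[OF smooth_fun_const, of f r] by (simp add: p_const scaleR_conv_of_real)

lemma p_minus: "smooth_fun U f \<Longrightarrow> p (\<lambda>x. - f x) = - p f"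
  using p_scale[of f "-1"] by simp

lemma p_diff: "smooth_fun U f \<Longrightarrow> smooth_fun U g \<Longrightarrow> p (\<lambda>x. f x - g x) = p f - p g"
  using p_add[of f "\<lambda>x. - g x"] by (simp add: p_minus smooth_fun_uminus open_U)

lemma p_sum: "(\<And>i. smooth_fun U (f i)) \<Longrightarrow> p (\<lambda>x. \<Sum>i\<in>I. f i x) = (\<Sum>i\<in>I. p (f i))"
proof (induction I rule: infinite_finite_induct)
  case (insert i I)
  then show ?case
    using p_add[of "f i" "\<lambda>x. \<Sum>i\<in>I. f i x"] by (simp add: smooth_fun_sum open_U)
qed (simp_all add: p_const)

lemma dd_linear: "linear (dd S)"
  and s0_linear: "linear (s0 S)"
  using fields unfolding field_algebra_def graded_derivation_def by blast+

lemma minus_one_power_mult: "(-1) ^ n * (x::'w) = ((-1::real) ^ n) *\<^sub>R x"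
  by (cases "even n") simp_all

lemma graded_derivationD:
  assumes "graded_derivation G q D" "x \<in> G i"
  shows "D (x * y) = D x * y + (-1) ^ q i * (x * D y)"
  using assms unfolding graded_derivation_def by blast

lemma dd_mult:
  assumes "x \<in> bigr S (g, f)"
  shows "dd S (x * y) = dd S x * y + (-1) ^ f *\<^sub>R (x * dd S y)"
proof -
  have "graded_derivation (bigr S) snd (dd S)"
    using fields unfolding field_algebra_def by (elim conjE)
  from graded_derivationD[OF this assms] show ?thesis
    by (simp add: minus_one_power_mult)
qed

lemma s0_mult:
  assumes "x \<in> bigr S (g, f)"
  shows "s0 S (x * y) = s0 S x * y + (-1) ^ g *\<^sub>R (x * s0 S y)"
proof -
  have "graded_derivation (bigr S) fst (s0 S)"
    using fields unfolding field_algebra_def by (elim conjE)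
  from graded_derivationD[OF this assms] show ?thesis
    by (simp add: minus_one_power_mult)
qed

lemma dd_bigr: "x \<in> bigr S (g, f) \<Longrightarrow> dd S x \<in> bigr S (g, f + 1)"
  using fields unfolding field_algebra_def by (elim conjE) blast

lemma s0_bigr: "x \<in> bigr S (g, f) \<Longrightarrow> s0 S x \<in> bigr S (g + 1, f)"
  using fields unfolding field_algebra_def by (elim conjE) blast

lemma
  assumes "smooth_fun U h"
  shows dd_p: "dd S (p h) = (\<Sum>\<mu>\<in>UNIV. p (pdiff \<mu> h) * dd S (Xf M S \<mu>))"
    and s0_p: "s0 S (p h) = (\<Sum>\<mu>\<in>UNIV. p (pdiff \<mu> h) * s0 S (Xf M S \<mu>))"
proof -
  have "\<forall>h. smooth_fun U h \<longrightarrow>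
      dd S (p h) = (\<Sum>\<mu>\<in>UNIV. p (pdiff \<mu> h) * dd S (Xf M S \<mu>)) \<and>
      s0 S (p h) = (\<Sum>\<mu>\<in>UNIV. p (pdiff \<mu> h) * s0 S (Xf M S \<mu>))"
    using fields unfolding field_algebra_def by (elim conjE)
  from this[rule_format, OF assms]
  show "dd S (p h) = (\<Sum>\<mu>\<in>UNIV. p (pdiff \<mu> h) * dd S (Xf M S \<mu>))"
    "s0 S (p h) = (\<Sum>\<mu>\<in>UNIV. p (pdiff \<mu> h) * s0 S (Xf M S \<mu>))" by simp_all
qed

lemma ca_grd: "ca M a \<in> grd M 1"
proof -
  have "\<forall>a. ca M a \<in> grd M 1"
    using target unfolding target_functions_def by (elim conjE)
  then show ?thesis ..
qed

lemma cb_grd: "cb M \<mu> \<in> grd M 2"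
proof -
  have "\<forall>\<mu>. cb M \<mu> \<in> grd M 2"
    using target unfolding target_functions_def by (elim conjE)
  then show ?thesis ..
qed

lemma Af_bigr: "Af M S a \<in> bigr S (0, 1)"
  unfolding Af_def by (intro pull_grd ca_grd)

lemma Bf_bigr: "Bf M S \<mu> \<in> bigr S (0, 2)"
  unfolding Bf_def by (intro pull_grd cb_grd)

lemma Xf_bigr: "Xf M S \<mu> \<in> bigr S (0, 0)"
  unfolding Xf_def by (intro p_mem smooth_fun_coord)

lemma eps_bigr: "eps S a \<in> bigr S (1, 0)"
  and psi_bigr: "psi S \<mu> \<in> bigr S (1, 1)"
  and psit_bigr: "psit S \<mu> \<in> bigr S (2, 0)"
  using fields unfolding field_algebra_def by (elim conjE, blast)+

lemma dX_bigr: "dd S (Xf M S \<mu>) \<in> bigr S (0, 1)"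
  using dd_bigr[OF Xf_bigr] by simp

lemma deps_bigr: "dd S (eps S a) \<in> bigr S (1, 1)"
  using dd_bigr[OF eps_bigr] by simp

lemma sA_bigr: "s0 S (Af M S a) \<in> bigr S (1, 1)"
  using s0_bigr[OF Af_bigr] by simp

lemma scomm_bigr:
  assumes "\<And>a. u a \<in> bigr S (g, f)" "\<And>b. v b \<in> bigr S (g', f')"
  shows "scomm ((-1) ^ (f * f' + g * g')) u v"
  unfolding scomm_def using bigr_commute[OF assms] by blast

lemma con1_bigr:
  assumes "\<And>a. smooth_fun U (f a)" "\<And>a. u a \<in> bigr S (g, k)"
  shows "con1 (\<lambda>a. p (f a)) u \<in> bigr S (g, k)"
  unfolding con1_def
  by (intro subspace_sum bigr_subspace) (use bigr_mult[OF p_mem[OF assms(1)] assms(2)] in simp)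

lemma con2_bigr:
  assumes "\<And>a b. smooth_fun U (f a b)" "\<And>a. u a \<in> bigr S (g, k)" "\<And>a. v a \<in> bigr S (g', k')"
  shows "con2 (\<lambda>a b. p (f a b)) u v \<in> bigr S (g + g', k + k')"
  unfolding con2_def
  by (intro subspace_sum bigr_subspace)
    (use bigr_mult[OF bigr_mult[OF p_mem[OF assms(1)] assms(2)] assms(3)] in simp)

text \<open>The coefficients depend on X, so their differential is a sum over dX. Each dX stands to
  the left of both fields and can be pulled out without a sign.\<close>

lemma dd_con2:
  assumes "\<And>a b. smooth_fun U (f a b)" "\<And>a. u a \<in> bigr S (g, k)"
  shows "dd S (con2 (\<lambda>a b. p (f a b)) u v) =
    (\<Sum>\<sigma>\<in>UNIV. dd S (Xf M S \<sigma>) * con2 (\<lambda>a b. p (pdiff \<sigma> (f a b))) u v)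
    + con2 (\<lambda>a b. p (f a b)) (\<lambda>a. dd S (u a)) v
    + (-1) ^ k *\<^sub>R con2 (\<lambda>a b. p (f a b)) u (\<lambda>b. dd S (v b))"
proof -
  have "dd S (p (f a b) * u a * v b) = dd S (p (f a b)) * u a * v b + p (f a b) * dd S (u a) * v b
      + (-1) ^ k *\<^sub>R (p (f a b) * u a * dd S (v b))" for a b
    using dd_mult[OF p_mem[OF assms(1)], of a b "u a * v b"] dd_mult[OF assms(2), of a "v b"]
    by (simp add: mult.assoc distrib_left)
  from con2_deriv[where D = "dd S" and f = "\<lambda>a b. p (f a b)", OF dd_linear this]
  show ?thesis
    using con2_sum_coeff[where g = "\<lambda>\<sigma> a b. p (pdiff \<sigma> (f a b))" and V = "\<lambda>\<sigma>. dd S (Xf M S \<sigma>)"]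
    by (simp add: dd_p assms(1) p_central smooth_fun_pdiff)
qed

lemma s0_con2:
  assumes "\<And>a b. smooth_fun U (f a b)" "\<And>a. u a \<in> bigr S (g, k)"
  shows "s0 S (con2 (\<lambda>a b. p (f a b)) u v) =
    (\<Sum>\<sigma>\<in>UNIV. s0 S (Xf M S \<sigma>) * con2 (\<lambda>a b. p (pdiff \<sigma> (f a b))) u v)
    + con2 (\<lambda>a b. p (f a b)) (\<lambda>a. s0 S (u a)) v
    + (-1) ^ g *\<^sub>R con2 (\<lambda>a b. p (f a b)) u (\<lambda>b. s0 S (v b))"
proof -
  have "s0 S (p (f a b) * u a * v b) = s0 S (p (f a b)) * u a * v b + p (f a b) * s0 S (u a) * v b
      + (-1) ^ g *\<^sub>R (p (f a b) * u a * s0 S (v b))" for a b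
    using s0_mult[OF p_mem[OF assms(1)], of a b "u a * v b"] s0_mult[OF assms(2), of a "v b"]
    by (simp add: mult.assoc distrib_left)
  from con2_deriv[where D = "s0 S" and f = "\<lambda>a b. p (f a b)", OF s0_linear this]
  show ?thesis
    using con2_sum_coeff[where g = "\<lambda>\<sigma> a b. p (pdiff \<sigma> (f a b))" and V = "\<lambda>\<sigma>. s0 S (Xf M S \<sigma>)"]
    by (simp add: s0_p assms(1) p_central smooth_fun_pdiff)
qed


section \<open>Pointwise tensor identities\<close>

lemma eta_symmetric: "eta K $ a $ b = eta K $ b $ a"
proof -
  have "transpose (eta K) = eta K"
    using courant unfolding twisted_courant_def by blast
  from arg_cong[OF this, of "\<lambda>A. A $ a $ b"] show ?thesis by (simp add: transpose_def)
qed

lemma eta_invertible: "invertible (eta K)"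
  using courant unfolding twisted_courant_def by blast

lemma eta_etai: "(\<Sum>d\<in>UNIV. eta K $ a $ d * etai K d b) = (if a = b then 1 else 0)"
proof -
  have "(eta K ** matrix_inv (eta K)) $ a $ b = mat 1 $ a $ b"
    using someI_ex[OF eta_invertible[unfolded invertible_def]] by (simp add: matrix_inv_def)
  then show ?thesis by (simp add: matrix_matrix_mult_def etai_def mat_def)
qed

lemma etai_eta: "(\<Sum>d\<in>UNIV. etai K a d * eta K $ d $ b) = (if a = b then 1 else 0)"
proof -
  have "(matrix_inv (eta K) ** eta K) $ a $ b = mat 1 $ a $ b"
    using someI_ex[OF eta_invertible[unfolded invertible_def]] by (simp add: matrix_inv_def)
  then show ?thesis by (simp add: matrix_matrix_mult_def etai_def mat_def)
qed

lemma etai_symmetric: "etai K a b = etai K b a"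
proof -
  have "etai K a b = (\<Sum>c\<in>UNIV. etai K a c * (\<Sum>d\<in>UNIV. eta K $ d $ c * etai K b d))"
    by (simp add: mult.commute[of "eta K $ _ $ _"] etai_eta if_distrib cong: if_cong)
  also have "\<dots> = (\<Sum>d\<in>UNIV. (\<Sum>c\<in>UNIV. etai K a c * eta K $ c $ d) * etai K b d)"
    unfolding sum_distrib_left sum_distrib_right
    by (subst sum.swap) (simp add: mult.assoc eta_symmetric)
  also have "\<dots> = etai K b a"
    by (simp add: etai_eta if_distrib if_distribR cong: if_cong)
  finally show ?thesis .
qed

lemma cst_antisym:
  assumes "x \<in> U"
  shows "cst K a b c x = - cst K b a c x" "cst K a b c x = - cst K a c b x"
proof -
  have "\<forall>x\<in>U. \<forall>a b c. cst K a b c x = - cst K b a c x \<and> cst K a b c x = - cst K a c b x"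
    using courant unfolding twisted_courant_def by (elim conjE)
  with assms show "cst K a b c x = - cst K b a c x" "cst K a b c x = - cst K a c b x"
    by blast+
qed

lemma cst_cyclic: "x \<in> U \<Longrightarrow> cst K a b c x = cst K b c a x"
  using cst_antisym(1)[of x a b c] cst_antisym(2)[of x b a c] by simp

lemma hfl_antisym:
  assumes "x \<in> U"
  shows "hfl K \<mu> \<nu> \<kappa> \<tau> x = - hfl K \<mu> \<kappa> \<nu> \<tau> x" "hfl K \<mu> \<nu> \<kappa> \<tau> x = - hfl K \<mu> \<nu> \<tau> \<kappa> x"
proof -
  have "\<forall>x\<in>U. \<forall>\<mu> \<nu> \<kappa> \<tau>. hfl K \<mu> \<nu> \<kappa> \<tau> x = - hfl K \<nu> \<mu> \<kappa> \<tau> x \<and>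
        hfl K \<mu> \<nu> \<kappa> \<tau> x = - hfl K \<mu> \<kappa> \<nu> \<tau> x \<and> hfl K \<mu> \<nu> \<kappa> \<tau> x = - hfl K \<mu> \<nu> \<tau> \<kappa> x"
    using courant unfolding twisted_courant_def by (elim conjE)
  with assms show "hfl K \<mu> \<nu> \<kappa> \<tau> x = - hfl K \<mu> \<kappa> \<nu> \<tau> x" "hfl K \<mu> \<nu> \<kappa> \<tau> x = - hfl K \<mu> \<nu> \<tau> \<kappa> x"
    by blast+
qed

lemma hfl3_antisym:
  assumes "x \<in> U"
  shows "hfl3 K \<mu> a b c x = - hfl3 K \<mu> b a c x" "hfl3 K \<mu> a b c x = - hfl3 K \<mu> a c b x"
proof -
  have "(\<Sum>\<kappa>\<in>UNIV. \<Sum>\<tau>\<in>UNIV. \<Sum>\<nu>\<in>UNIV. rho K b \<kappa> x * rho K a \<tau> x * rho K c \<nu> x * hfl K \<mu> \<kappa> \<tau> \<nu> x) =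
      (\<Sum>\<kappa>\<in>UNIV. \<Sum>\<tau>\<in>UNIV. \<Sum>\<nu>\<in>UNIV. - (rho K a \<kappa> x * rho K b \<tau> x * rho K c \<nu> x * hfl K \<mu> \<kappa> \<tau> \<nu> x))"
  proof (rule trans[OF sum.swap], intro sum.cong refl)
    fix \<kappa> \<tau> \<nu>
    show "rho K b \<tau> x * rho K a \<kappa> x * rho K c \<nu> x * hfl K \<mu> \<tau> \<kappa> \<nu> x =
        - (rho K a \<kappa> x * rho K b \<tau> x * rho K c \<nu> x * hfl K \<mu> \<kappa> \<tau> \<nu> x)"
      using hfl_antisym(1)[OF assms, of \<mu> \<tau> \<kappa> \<nu>] by simp
  qed
  then show "hfl3 K \<mu> a b c x = - hfl3 K \<mu> b a c x"
    unfolding hfl3_def by (simp add: sum_negf)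
  have "(\<Sum>\<tau>\<in>UNIV. \<Sum>\<nu>\<in>UNIV. rho K a \<kappa> x * rho K c \<tau> x * rho K b \<nu> x * hfl K \<mu> \<kappa> \<tau> \<nu> x) =
      (\<Sum>\<tau>\<in>UNIV. \<Sum>\<nu>\<in>UNIV. - (rho K a \<kappa> x * rho K b \<tau> x * rho K c \<nu> x * hfl K \<mu> \<kappa> \<tau> \<nu> x))" for \<kappa>
  proof (rule trans[OF sum.swap], intro sum.cong refl)
    fix \<tau> \<nu>
    show "rho K a \<kappa> x * rho K c \<nu> x * rho K b \<tau> x * hfl K \<mu> \<kappa> \<nu> \<tau> x =
        - (rho K a \<kappa> x * rho K b \<tau> x * rho K c \<nu> x * hfl K \<mu> \<kappa> \<tau> \<nu> x)"
      using hfl_antisym(2)[OF assms, of \<mu> \<kappa> \<nu> \<tau>] by simp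
  qed
  then show "hfl3 K \<mu> a b c x = - hfl3 K \<mu> a c b x"
    unfolding hfl3_def by (simp add: sum_negf)
qed

lemma om_low_antisym: "x \<in> U \<Longrightarrow> om_low K N \<mu> a b x = - om_low K N \<mu> b a x"
  using metric unfolding metric_connection_def by (simp add: eq_neg_iff_add_eq_0)

lemma pdiff_uminus: "pdiff \<mu> (\<lambda>x. - f x) x = - pdiff \<mu> f x" if "f differentiable (at x)" for f :: "real^'m \<Rightarrow> real"
  using pdiff_mult[of "\<lambda>_. -1" x f \<mu>] that by simp

lemma pdiff_antisym:
  assumes "x \<in> U" "smooth_fun U g" "\<And>x. x \<in> U \<Longrightarrow> f x = - g x"
  shows "pdiff \<mu> f x = - pdiff \<mu> g x"
  using pdiff_cong[OF open_U assms(1), of f "\<lambda>x. - g x" \<mu>] assms(3)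
    pdiff_uminus[OF smooth_fun_differentiable[OF assms(2,1)]] by simp

lemma pdiff_om_low_antisym: "x \<in> U \<Longrightarrow> pdiff \<nu> (om_low K N \<mu> a b) x = - pdiff \<nu> (om_low K N \<mu> b a) x"
  by (intro pdiff_antisym smooth_om_low om_low_antisym)

lemma pdiff_cst_antisym:
  assumes "x \<in> U"
  shows "pdiff \<mu> (cst K a b c) x = - pdiff \<mu> (cst K b a c) x"
    "pdiff \<mu> (cst K a b c) x = - pdiff \<mu> (cst K a c b) x"
  by (rule pdiff_antisym[OF assms smooth_cst], erule cst_antisym)+

section \<open>Torsion and curvature of a metric connection in lowered indices\<close>

lemma om_low_raise: "(\<Sum>d\<in>UNIV. om_low K N \<mu> a d x * etai K d b) = omg N \<mu> a b x"
proof -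
  have "(\<Sum>d\<in>UNIV. om_low K N \<mu> a d x * etai K d b) =
      (\<Sum>c\<in>UNIV. omg N \<mu> a c x * (\<Sum>d\<in>UNIV. eta K $ c $ d * etai K d b))"
    unfolding om_low_def sum_distrib_left sum_distrib_right
    by (subst sum.swap) (simp add: mult.assoc)
  then show ?thesis by (simp add: eta_etai if_distrib cong: if_cong)
qed

text \<open>The minus sign is due to metric compatibility: the index contracted here is the first
  Latin index of \<open>om_low\<close>, not the one that was lowered.\<close>

lemma om_low_raise': "x \<in> U \<Longrightarrow> (\<Sum>d\<in>UNIV. etai K b d * om_low K N \<mu> d a x) = - omg N \<mu> a b x"
  using om_low_raise[of \<mu> a x b] om_low_antisym[of x \<mu> _ a]
  by (simp add: sum_negf mult.commute etai_symmetric[of b])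

text \<open>The coefficients $\omega_{abc} = \rho_a{}^\mu\omega_{\mu bc}$ of the induced connection.\<close>

definition omE_low :: "'a \<Rightarrow> 'a \<Rightarrow> 'a \<Rightarrow> real^'m \<Rightarrow> real" where
  "omE_low a b c x = (\<Sum>\<mu>\<in>UNIV. rho K a \<mu> x * om_low K N \<mu> b c x)"

lemma omE_low_antisym: "x \<in> U \<Longrightarrow> omE_low a b c x = - omE_low a c b x"
  unfolding omE_low_def using om_low_antisym[of x _ b c] by (simp add: sum_negf)

lemma omE_lower: "(\<Sum>d\<in>UNIV. omE K N d a b x * eta K $ c $ d) = omE_low a b c x"
  unfolding omE_low_def omE_def om_low_def sum_distrib_left sum_distrib_right
  by (subst sum.swap) (simp add: mult.assoc eta_symmetric[of c])

lemma cst_up_lower: "(\<Sum>d\<in>UNIV. cst_up K d a b x * eta K $ d $ c) = cst K a b c x"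
proof -
  have "(\<Sum>d\<in>UNIV. cst_up K d a b x * eta K $ d $ c) =
      (\<Sum>e\<in>UNIV. cst K a b e x * (\<Sum>d\<in>UNIV. etai K e d * eta K $ d $ c))"
    unfolding cst_up_def sum_distrib_left sum_distrib_right
    by (subst sum.swap) (simp add: mult_ac etai_symmetric)
  then show ?thesis by (simp add: etai_eta if_distrib cong: if_cong)
qed

text \<open>For a metric connection omega_abc is antisymmetric in b and c. Hence the antisymmetrised
  term is half of omega_abc + omega_bca, and the correction term of the Gualtieri torsion adds half
  of omega_cab, completing the cyclic sum. Total antisymmetry can be read off from this
  form.\<close>

lemma torsion_eq:
  assumes "x \<in> U"
  shows "gualtieri_torsion K N a b c x =
    1/2 * (omE_low a b c x + omE_low b c a x + omE_low c a b x) - 1/2 * cst K a b c x"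
proof -
  have "gualtieri_torsion K N a b c x =
      1/2 * (omE_low a b c x - omE_low b a c x) - 1/2 * cst K a b c x
      + 1/4 * (omE_low c a b x - omE_low c b a x)"
    unfolding gualtieri_torsion_def cst_up_lower omE_lower[symmetric]
    by (simp add: sum_distrib_left sum_subtractf[symmetric] algebra_simps)
  then show ?thesis
    using omE_low_antisym[OF assms, of b a c] omE_low_antisym[OF assms, of c b a] by (simp add: field_simps)
qed

lemma torsion_antisym:
  assumes "x \<in> U"
  shows "gualtieri_torsion K N a b c x = - gualtieri_torsion K N b a c x"
    and "gualtieri_torsion K N a b c x = gualtieri_torsion K N b c a x"
  unfolding torsion_eq[OF assms]
  using omE_low_antisym[OF assms, of b a c] omE_low_antisym[OF assms, of c b a] omE_low_antisym[OF assms, of a b c]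
    cst_antisym(1)[OF assms, of a b c] cst_cyclic[OF assms, of a b c]
  by (simp_all add: field_simps)

text \<open>In the cyclic sum the raised index sits on the last slot of one term, on the middle slot
  of another, where antisymmetry gives a sign, and on the anchor of the third, where it leaves
  \<open>om_low\<close> contracted with the raised anchor.\<close>

lemma torsion_up_eq:
  assumes "x \<in> U"
  shows "gualtieri_torsion_up K N b c a x =
    1/2 * (omE K N a b c x - omE K N a c b x
      + (\<Sum>\<mu>\<in>UNIV. (\<Sum>d\<in>UNIV. etai K a d * rho K d \<mu> x) * om_low K N \<mu> b c x)) - 1/2 * cst_up K a b c x"
proof -
  have raise: "(\<Sum>d\<in>UNIV. etai K a d * omE_low b c d x) = omE K N a b c x" for b c
  proof -
    have "(\<Sum>d\<in>UNIV. etai K a d * omE_low b c d x) =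
        (\<Sum>\<mu>\<in>UNIV. rho K b \<mu> x * (\<Sum>d\<in>UNIV. om_low K N \<mu> c d x * etai K d a))"
      unfolding omE_low_def sum_distrib_left
      by (subst sum.swap) (simp add: mult_ac etai_symmetric[of a])
    then show ?thesis by (simp add: om_low_raise omE_def)
  qed
  have "(\<Sum>d\<in>UNIV. etai K a d * omE_low d b c x) =
      (\<Sum>\<mu>\<in>UNIV. (\<Sum>d\<in>UNIV. etai K a d * rho K d \<mu> x) * om_low K N \<mu> b c x)"
    unfolding omE_low_def sum_distrib_left sum_distrib_right
    by (subst sum.swap) (simp add: mult_ac)
  moreover have "(\<Sum>d\<in>UNIV. etai K a d * omE_low c d b x) = - omE K N a c b x"
    using raise[of c b] omE_low_antisym[OF assms, of c _ b] by (simp add: sum_negf)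
  ultimately show ?thesis
    using raise[of b c]
    by (simp add: gualtieri_torsion_up_def torsion_eq[OF assms] cst_up_def algebra_simps
        sum.distrib sum_subtractf sum_divide_distrib[symmetric])
qed

lemma pdiff_om_low:
  assumes "x \<in> U"
  shows "pdiff \<nu> (om_low K N \<mu> a b) x = (\<Sum>c\<in>UNIV. pdiff \<nu> (omg N \<mu> a c) x * eta K $ c $ b)"
proof -
  have d: "omg N \<mu> a c differentiable (at x)" for c
    by (rule smooth_fun_differentiable[OF smooth_omg assms])
  then show ?thesis
    unfolding om_low_def[abs_def]
    by (subst pdiff_sum) (simp_all add: differentiable_mult pdiff_mult)
qed

lemma curv_low_eq:
  assumes "x \<in> U"
  shows "curv_low K N c b \<mu> \<nu> x = pdiff \<mu> (om_low K N \<nu> b c) x - pdiff \<nu> (om_low K N \<mu> b c) x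
    + (\<Sum>e\<in>UNIV. omg N \<nu> b e x * om_low K N \<mu> e c x) - (\<Sum>e\<in>UNIV. omg N \<mu> b e x * om_low K N \<nu> e c x)"
proof -
  have *: "(\<Sum>d\<in>UNIV. eta K $ c $ d * (\<Sum>e\<in>UNIV. omg N \<mu> e d x * omg N \<nu> b e x)) =
      (\<Sum>e\<in>UNIV. omg N \<nu> b e x * om_low K N \<mu> e c x)" for \<mu> \<nu>
    unfolding om_low_def sum_distrib_left
    by (subst sum.swap) (simp add: mult_ac eta_symmetric[of c])
  show ?thesis
    unfolding curv_low_def curv_def pdiff_om_low[OF assms] *[symmetric]
    by (simp add: algebra_simps sum.distrib sum_subtractf eta_symmetric[of c])
qed

lemma calC_eq:
  assumes "x \<in> U"
  shows "calC K N \<mu> a b c x =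
    (\<Sum>\<nu>\<in>UNIV. rho K a \<nu> x * pdiff \<nu> (om_low K N \<mu> b c) x) - (\<Sum>\<nu>\<in>UNIV. rho K a \<nu> x * pdiff \<mu> (om_low K N \<nu> b c) x)
    + (\<Sum>e\<in>UNIV. omg N \<mu> b e x * omE_low a e c x) + (\<Sum>e\<in>UNIV. omg N \<mu> c e x * omE_low a b e x)"
proof -
  have 1: "calC K N \<mu> a b c x = (\<Sum>\<nu>\<in>UNIV. rho K a \<nu> x * curv_low K N c b \<nu> \<mu> x)"
    unfolding calC_def curv_low_def sum_distrib_left
    by (subst sum.swap) (simp add: mult_ac)
  \<comment> \<open>Metric compatibility moves the free index \<open>c\<close> onto omega_\<mu>.
    Every quadratic term is then omega_\<mu> times an omega with an anchor, the shape in which they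
    occur in the covariant derivative of the torsion.\<close>
  have 2: "(\<Sum>e\<in>UNIV. omg N \<nu> b e x * om_low K N \<mu> e c x) = - (\<Sum>e\<in>UNIV. omg N \<mu> c e x * om_low K N \<nu> b e x)" for \<nu>
  proof -
    have "(\<Sum>e\<in>UNIV. omg N \<nu> b e x * om_low K N \<mu> c e x) = (\<Sum>e\<in>UNIV. omg N \<mu> c e x * om_low K N \<nu> b e x)"
      unfolding om_low_def sum_distrib_left
      by (subst sum.swap) (simp add: mult_ac eta_symmetric)
    then show ?thesis using om_low_antisym[OF assms, of \<mu> _ c] by (simp add: sum_negf)
  qed
  have 3: "(\<Sum>e\<in>UNIV. omg N \<mu> b e x * omE_low a e c x) = (\<Sum>\<nu>\<in>UNIV. rho K a \<nu> x * (\<Sum>e\<in>UNIV. omg N \<mu> b e x * om_low K N \<nu> e c x))"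
    "(\<Sum>e\<in>UNIV. omg N \<mu> c e x * omE_low a b e x) = (\<Sum>\<nu>\<in>UNIV. rho K a \<nu> x * (\<Sum>e\<in>UNIV. omg N \<mu> c e x * om_low K N \<nu> b e x))"
    unfolding omE_low_def sum_distrib_left
    by (subst sum.swap, simp add: mult_ac)+
  show ?thesis
    unfolding 1 curv_low_eq[OF assms] 2 3
    by (simp add: algebra_simps sum.distrib sum_subtractf sum_negf)
qed

text \<open>The tensor $k_{\mu abc}$ of the introduction; $\omega_{dbc}$ stands for $\rho_d{}^\nu\omega_{\nu bc}$.\<close>

definition kfun :: "'m \<Rightarrow> 'a \<Rightarrow> 'a \<Rightarrow> 'a \<Rightarrow> real^'m \<Rightarrow> real" where
  "kfun \<mu> a b c x =
     (\<Sum>\<nu>\<in>UNIV. pdiff \<mu> (rho K a \<nu>) x * om_low K N \<nu> b c x)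
     + (\<Sum>\<nu>\<in>UNIV. rho K a \<nu> x * pdiff \<nu> (om_low K N \<mu> b c) x)
     - (\<Sum>d\<in>UNIV. omE_low d b c x * omg N \<mu> a d x)
     + (\<Sum>d\<in>UNIV. cst K d b c x * omg N \<mu> a d x)"

lemma twisted_basic_curvature_eq:
  assumes "x \<in> U"
  shows "twisted_basic_curvature K N \<mu> a b c x =
    1/2 * (pdiff \<mu> (cst K a b c) x + hfl3 K \<mu> a b c x)
    - 1/2 * (kfun \<mu> a b c x + kfun \<mu> b c a x + kfun \<mu> c a b x)"
proof -
  \<comment> \<open>The letters sort the terms by shape: \<open>P\<close>, \<open>Q\<close>,
    \<open>L\<close> contain a derivative, \<open>X\<close> and \<open>Y\<close> are quadratic in
    omega with the dummy index on the anchor or on the last slot of omega, and \<open>C\<close>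
    contains the structure functions. \<open>Q\<close> and \<open>Y\<close> cancel, while
    \<open>L\<close>, \<open>P\<close>, \<open>X\<close>, \<open>C\<close> form
    \<open>kfun\<close>.\<close>
  define P where "P a b c = (\<Sum>\<nu>\<in>UNIV. rho K a \<nu> x * pdiff \<nu> (om_low K N \<mu> b c) x)" for a b c
  define Q where "Q a b c = (\<Sum>\<nu>\<in>UNIV. rho K a \<nu> x * pdiff \<mu> (om_low K N \<nu> b c) x)" for a b c
  define L where "L a b c = (\<Sum>\<nu>\<in>UNIV. pdiff \<mu> (rho K a \<nu>) x * om_low K N \<nu> b c x)" for a b c
  define X where "X a b c = (\<Sum>d\<in>UNIV. omg N \<mu> a d x * omE_low d b c x)" for a b c
  define Y where "Y a b c = (\<Sum>d\<in>UNIV. omg N \<mu> a d x * omE_low b c d x)" for a b c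
  define C where "C a b c = (\<Sum>d\<in>UNIV. omg N \<mu> a d x * cst K d b c x)" for a b c
  have Y': "(\<Sum>d\<in>UNIV. omg N \<mu> a d x * omE_low b d c x) = - Y a b c" for a b c
    unfolding Y_def using omE_low_antisym[OF assms, of b _ c] by (simp add: sum_negf)
  have calC: "calC K N \<mu> a b c x = P a b c - Q a b c - Y b a c + Y c a b" for a b c
    unfolding calC_eq[OF assms] Y' by (simp add: P_def Q_def Y_def)
  have k: "kfun \<mu> a b c x = L a b c + P a b c - X a b c + C a b c" for a b c
    by (simp add: kfun_def L_def P_def X_def C_def mult.commute)
  have omT: "(\<Sum>d\<in>UNIV. omg N \<mu> a d x * gualtieri_torsion K N d b c x) =
      1/2 * (X a b c + Y a b c - Y a c b) - 1/2 * C a b c" for a b c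
    unfolding torsion_eq[OF assms] X_def C_def Y_def
    using Y'[of a c b]
    by (simp add: Y_def algebra_simps sum.distrib sum_subtractf sum_divide_distrib[symmetric])
  have dT: "pdiff \<mu> (gualtieri_torsion K N a b c) x =
      1/2 * (L a b c + Q a b c + L b c a + Q b c a + L c a b + Q c a b) - 1/2 * pdiff \<mu> (cst K a b c) x"
  proof -
    have dif: "f differentiable (at x)" if "smooth_fun U f" for f
      using smooth_fun_differentiable[OF that assms] .
    have om: "smooth_fun U (omE_low a b c)" for a b c
      unfolding omE_low_def[abs_def] by (intro smooth_all)
    have dom: "pdiff \<mu> (omE_low a b c) x = L a b c + Q a b c" for a b c
      unfolding omE_low_def[abs_def] L_def Q_def
      by (subst pdiff_sum)
        (auto simp: pdiff_mult dif smooth_rho smooth_om_low sum.distrib intro!: differentiable_mult)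
    have "pdiff \<mu> (gualtieri_torsion K N a b c) x =
        pdiff \<mu> (\<lambda>x. 1/2 * (omE_low a b c x + omE_low b c a x + omE_low c a b x) + (-1/2) * cst K a b c x) x"
      by (rule pdiff_cong[OF open_U assms]) (simp add: torsion_eq)
    also have "\<dots> = 1/2 * (pdiff \<mu> (omE_low a b c) x + pdiff \<mu> (omE_low b c a) x + pdiff \<mu> (omE_low c a b) x)
        - 1/2 * pdiff \<mu> (cst K a b c) x"
      by (subst pdiff_add pdiff_mult, intro dif smooth_all om, intro dif smooth_all om)+ simp
    finally show ?thesis by (simp add: dom)
  qed
  \<comment> \<open>Cyclic symmetry brings the index on which the connection acts to the front, so
    that the three connection terms are cyclic copies of the one computed in
    \<open>omT\<close>.\<close>
  have Tcyc: "gualtieri_torsion K N a d c x = gualtieri_torsion K N d c a x"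
    "gualtieri_torsion K N a b d x = gualtieri_torsion K N d a b x" for d
    using torsion_antisym(2)[OF assms] by metis+
  have anti: "P a b c = - P a c b" "Q a b c = - Q a c b" for a b c
    unfolding P_def Q_def
    using pdiff_om_low_antisym[OF assms, of _ _ b c] by (simp_all add: sum_negf)
  have "nabla_torsion K N \<mu> a b c x = pdiff \<mu> (gualtieri_torsion K N a b c) x
     - ((\<Sum>d\<in>UNIV. omg N \<mu> a d x * gualtieri_torsion K N d b c x)
       + (\<Sum>d\<in>UNIV. omg N \<mu> b d x * gualtieri_torsion K N d c a x)
       + (\<Sum>d\<in>UNIV. omg N \<mu> c d x * gualtieri_torsion K N d a b x))"
    unfolding nabla_torsion_def Tcyc by (simp add: sum.distrib)
  then show ?thesis
    unfolding twisted_basic_curvature_def basic_curvature_def calC k omT dT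
    using anti[of c b a] anti[of b a c] by (simp add: field_simps)
qed

text \<open>Since \<open>kfun\<close> is antisymmetric in its last two indices, its cyclic sum is
  totally antisymmetric; the derivative of the structure functions and \<open>hfl3\<close> have the
  same symmetry.\<close>

lemma twisted_basic_curvature_antisym:
  assumes "x \<in> U"
  shows "twisted_basic_curvature K N \<mu> a b c x = - twisted_basic_curvature K N \<mu> b a c x"
    and "twisted_basic_curvature K N \<mu> a b c x = - twisted_basic_curvature K N \<mu> a c b x"
proof -
  have k: "kfun \<mu> a b c x = - kfun \<mu> a c b x" for a b c
    unfolding kfun_def
    using om_low_antisym[OF assms, of _ b c] pdiff_om_low_antisym[OF assms, of _ _ b c]
      omE_low_antisym[OF assms, of _ b c] cst_antisym(2)[OF assms, of _ b c]
    by (simp add: sum_negf)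
  show "twisted_basic_curvature K N \<mu> a b c x = - twisted_basic_curvature K N \<mu> b a c x"
    "twisted_basic_curvature K N \<mu> a b c x = - twisted_basic_curvature K N \<mu> a c b x"
    unfolding twisted_basic_curvature_eq[OF assms]
    using k[of a b c] k[of b c a] k[of c a b]
      hfl3_antisym[OF assms, of \<mu> a b c] pdiff_cst_antisym[OF assms, of \<mu> a b c]
    by (simp_all add: field_simps)
qed

end

lemma sum_tindex:
  "(\<Sum>\<beta>\<in>UNIV. g \<beta>) = (\<Sum>\<mu>\<in>UNIV. g (Base \<mu>)) + (\<Sum>a\<in>UNIV. g (Frame a)) + (\<Sum>\<mu>\<in>UNIV. g (Fibre \<mu>))"
  for g :: "('m::finite, 'a::finite) tindex \<Rightarrow> 'w::comm_monoid_add"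
proof -
  have U: "(UNIV :: ('m, 'a) tindex set) = range Base \<union> range Frame \<union> range Fibre"
  proof -
    have "x \<in> range Base \<union> range Frame \<union> range Fibre" for x :: "('m, 'a) tindex"
      by (cases x) auto
    then show ?thesis by blast
  qed
  have "(\<Sum>\<beta>\<in>UNIV. g \<beta>) = (\<Sum>\<beta>\<in>range Base. g \<beta>) + (\<Sum>\<beta>\<in>range Frame. g \<beta>) + (\<Sum>\<beta>\<in>range Fibre. g \<beta>)"
    unfolding U by (subst sum.union_disjoint, simp_all, blast, subst sum.union_disjoint, simp_all, blast)
  then show ?thesis
    by (simp add: sum.reindex inj_def)
qed

context sigma_model_setup
begin

section \<open>The covariant derivations and the contractions\<close>

lemma target_graded: "graded_comm_algebra (grd M) (\<lambda>i j. i * j)"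
  using target unfolding target_functions_def by (elim conjE)

lemma fn_central: "smooth_fun U f \<Longrightarrow> central (fn M f)"
  by (rule graded_comm_algebra_central[OF target_graded fn_grd]) simp_all

lemma grd_commute:
  assumes "x \<in> grd M i" "y \<in> grd M j"
  shows "x * y = (-1) ^ (i * j) *\<^sub>R (y * x)"
proof -
  have "\<forall>i j. \<forall>x\<in>grd M i. \<forall>y\<in>grd M j. x * y \<in> grd M (i + j) \<and> x * y = (-1) ^ (i * j) * (y * x)"
    using target_graded unfolding graded_comm_algebra_def by (elim conjE)
  from this[rule_format, OF assms] show ?thesis
    by (cases "even (i * j)") (simp_all del: even_mult_iff)
qed

lemma grd_mult:
  assumes "x \<in> grd M i" "y \<in> grd M j"
  shows "x * y \<in> grd M (i + j)"
proof -
  have "\<forall>i j. \<forall>x\<in>grd M i. \<forall>y\<in>grd M j. x * y \<in> grd M (i + j) \<and> x * y = (-1) ^ (i * j) * (y * x)"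
    using target_graded unfolding graded_comm_algebra_def by (elim conjE)
  from this[rule_format, OF assms, THEN conjunct1] show ?thesis .
qed

lemma grd_subspace: "subspace (grd M i)"
  using target_graded unfolding graded_comm_algebra_def by blast

lemma pa_derivation: "graded_derivation (grd M) (\<lambda>i. i) (pa M a)"
proof -
  have "\<forall>a. graded_derivation (grd M) (\<lambda>i. i) (pa M a)"
    using target unfolding target_functions_def by (elim conjE)
  then show ?thesis ..
qed

lemma pb_derivation: "graded_derivation (grd M) (\<lambda>i. 0) (pb M \<mu>)"
proof -
  have "\<forall>\<mu>. graded_derivation (grd M) (\<lambda>i. 0) (pb M \<mu>)"
    using target unfolding target_functions_def by (elim conjE)
  then show ?thesis ..
qed

lemma pa_linear: "linear (pa M a)"
  using pa_derivation unfolding graded_derivation_def by blast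

lemma pb_linear: "linear (pb M \<mu>)"
  using pb_derivation unfolding graded_derivation_def by blast

lemma pa_mult: "x \<in> grd M i \<Longrightarrow> pa M a (x * y) = pa M a x * y + (-1) ^ i *\<^sub>R (x * pa M a y)"
  using graded_derivationD[OF pa_derivation, of x i a y] by (cases "even i") simp_all

lemma pb_mult: "x \<in> grd M i \<Longrightarrow> pb M \<mu> (x * y) = pb M \<mu> x * y + x * pb M \<mu> y"
  using graded_derivationD[OF pb_derivation, of x i \<mu> y] by simp

lemma partials_fn:
  assumes "smooth_fun U f"
  shows "pb M \<mu> (fn M f) = 0" "pa M a (fn M f) = 0"
proof -
  have "\<forall>f. smooth_fun U f \<longrightarrow>
        (\<forall>\<mu>. px M \<mu> (fn M f) = fn M (pdiff \<mu> f) \<and> pb M \<mu> (fn M f) = 0) \<and> (\<forall>a. pa M a (fn M f) = 0)"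
    using target unfolding target_functions_def by (elim conjE)
  with assms show "pb M \<mu> (fn M f) = 0" "pa M a (fn M f) = 0" by blast+
qed

lemma pb_ca: "pb M \<mu> (ca M a) = 0"
proof -
  have "\<forall>\<mu> a. px M \<mu> (ca M a) = 0 \<and> pb M \<mu> (ca M a) = 0"
    using target unfolding target_functions_def by (elim conjE)
  then show ?thesis by blast
qed

lemma pa_ca: "pa M a (ca M b) = (if a = b then 1 else 0)"
proof -
  have "\<forall>a b. pa M a (ca M b) = (if a = b then 1 else 0)"
    using target unfolding target_functions_def by (elim conjE)
  then show ?thesis by blast
qed

lemma pb_cb: "pb M \<mu> (cb M \<nu>) = (if \<mu> = \<nu> then 1 else 0)"
proof -
  have "\<forall>\<mu> \<nu>. px M \<mu> (cb M \<nu>) = 0 \<and> pb M \<mu> (cb M \<nu>) = (if \<mu> = \<nu> then 1 else 0)"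
    using target unfolding target_functions_def by (elim conjE)
  then show ?thesis by blast
qed

lemma pa_cb: "pa M a (cb M \<mu>) = 0"
proof -
  have "\<forall>a \<mu>. pa M a (cb M \<mu>) = 0"
    using target unfolding target_functions_def by (elim conjE)
  then show ?thesis by blast
qed

lemma pb_con1:
  assumes "\<And>a. smooth_fun U (f a)"
  shows "pb M \<mu> (con1 (\<lambda>a. fn M (f a)) (ca M)) = 0"
  unfolding con1_def linear_sum[OF pb_linear]
  by (simp add: pb_mult[OF fn_grd[OF assms]] partials_fn[OF assms] pb_ca)

lemma pb_con2:
  assumes "\<And>a b. smooth_fun U (f a b)"
  shows "pb M \<mu> (con2 (\<lambda>a b. fn M (f a b)) (ca M) (ca M)) = 0"
  unfolding con2_def linear_sum[OF pb_linear] mult.assoc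
  by (simp add: pb_mult[OF fn_grd[OF assms]] partials_fn[OF assms] pb_ca pb_mult[OF ca_grd])

lemma pb_con3:
  assumes "\<And>a b c. smooth_fun U (f a b c)"
  shows "pb M \<mu> (con3 (\<lambda>a b c. fn M (f a b c)) (ca M) (ca M) (ca M)) = 0"
  unfolding con3_def linear_sum[OF pb_linear] mult.assoc
  by (simp add: pb_mult[OF fn_grd[OF assms]] partials_fn[OF assms] pb_ca pb_mult[OF ca_grd])

lemma bnab_eq: "bnab K N M \<mu> = cb M \<mu> + (1/2) *\<^sub>R con2 (\<lambda>a b. fn M (om_low K N \<mu> a b)) (ca M) (ca M)"
  by (simp add: bnab_def con2_def)

lemma pb_bnab: "pb M \<mu> (bnab K N M \<nu>) = (if \<mu> = \<nu> then 1 else 0)"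
  unfolding bnab_eq linear_add[OF pb_linear] linear_scale[OF pb_linear]
  by (simp add: pb_con2 smooth_om_low pb_cb)

lemma Dm1_linear: "linear (Dm1 K N M a)"
proof -
  have "linear (\<lambda>u. w * pb M \<mu> u)" for w \<mu>
    using linear_compose[OF pb_linear, of "\<lambda>u. w * u" \<mu>]
    by (simp add: o_def linear_iff distrib_left)
  then show ?thesis
    unfolding Dm1_def[abs_def] by (intro linear_compose_add linear_compose_sum ballI pa_linear)
qed

text \<open>In the connection term the even derivation by b_\<mu> gives no sign, but the odd
  coordinate in front of it passes \<open>x\<close> with (-1)^i. Hence both parts of
  \<open>Dm1\<close> are derivations of odd degree.\<close>

lemma Dm1_mult:
  assumes "x \<in> grd M i"
  shows "Dm1 K N M a (x * y) = Dm1 K N M a x * y + (-1) ^ i *\<^sub>R (x * Dm1 K N M a y)"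
proof -
  have "fn M (om_low K N \<mu> b a) * ca M b * (x * z) =
      (-1) ^ i *\<^sub>R (x * (fn M (om_low K N \<mu> b a) * ca M b * z))" for \<mu> b z
  proof -
    have "ca M b * (x * z) = (-1) ^ i *\<^sub>R (x * (ca M b * z))"
      using grd_commute[OF ca_grd assms, of b] by (simp flip: mult.assoc)
    then show ?thesis
      using central_left_commute[OF fn_central[OF smooth_om_low], of x] by (simp add: mult.assoc)
  qed
  then show ?thesis
    unfolding Dm1_def pa_mult[OF assms] pb_mult[OF assms]
    by (simp add: distrib_left distrib_right sum.distrib sum_distrib_left sum_distrib_right
        scaleR_sum_right scaleR_add_right mult.assoc)
qed

lemma Dm1_fn: "smooth_fun U f \<Longrightarrow> Dm1 K N M a (fn M f) = 0"
  by (simp add: Dm1_def partials_fn)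

lemma Dm1_ca: "Dm1 K N M a (ca M b) = (if a = b then 1 else 0)"
  by (simp add: Dm1_def pb_ca pa_ca)

lemma Dm1_con1:
  assumes "\<And>a. smooth_fun U (f a)"
  shows "Dm1 K N M d (con1 (\<lambda>a. fn M (f a)) (ca M)) = fn M (f d)"
  unfolding con1_def linear_sum[OF Dm1_linear]
  by (simp add: Dm1_mult[OF fn_grd[OF assms]] Dm1_fn[OF assms] Dm1_ca if_distrib cong: if_cong)

lemma fn_antisym:
  assumes "smooth_fun U f" "smooth_fun U g" "\<And>x. x \<in> U \<Longrightarrow> f x = - g x"
  shows "fn M f = - fn M g"
  using fn_cong[of f "\<lambda>x. - g x"] assms fn_minus[of g] by simp

text \<open>The coordinate with index \<open>d\<close> can be removed from either slot. The sign of
  passing an odd factor is compensated by the antisymmetry of the coefficients, so all slots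
  contribute equally; with three slots the factor becomes 3.\<close>

lemma Dm1_con2:
  assumes "\<And>a b. smooth_fun U (f a b)" "\<And>x a b. x \<in> U \<Longrightarrow> f a b x = - f b a x"
  shows "Dm1 K N M d (con2 (\<lambda>a b. fn M (f a b)) (ca M) (ca M)) = 2 *\<^sub>R con1 (\<lambda>b. fn M (f d b)) (ca M)"
proof -
  have f: "fn M (f a d) = - fn M (f d a)" for a
    by (rule fn_antisym[OF assms(1) assms(1) assms(2)])
  have "Dm1 K N M d (fn M (f a b) * ca M a * ca M b) =
      fn M (f a b) * (if d = a then ca M b else 0) - fn M (f a b) * (if d = b then ca M a else 0)" for a b
    by (simp add: mult.assoc Dm1_mult[OF fn_grd[OF assms(1)]] Dm1_fn[OF assms(1)] Dm1_mult[OF ca_grd]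
        Dm1_ca right_diff_distrib)
  then have "Dm1 K N M d (con2 (\<lambda>a b. fn M (f a b)) (ca M) (ca M)) =
      (\<Sum>a\<in>UNIV. \<Sum>b\<in>UNIV. fn M (f a b) * (if d = a then ca M b else 0))
      - (\<Sum>a\<in>UNIV. \<Sum>b\<in>UNIV. fn M (f a b) * (if d = b then ca M a else 0))"
    unfolding con2_def linear_sum[OF Dm1_linear] by (simp add: sum_subtractf)
  also have "(\<Sum>a\<in>UNIV. \<Sum>b\<in>UNIV. fn M (f a b) * (if d = a then ca M b else 0)) = con1 (\<lambda>b. fn M (f d b)) (ca M)"
    by (subst sum.swap) (simp add: con1_def if_distrib cong: if_cong)
  also have "(\<Sum>a\<in>UNIV. \<Sum>b\<in>UNIV. fn M (f a b) * (if d = b then ca M a else 0)) = - con1 (\<lambda>b. fn M (f d b)) (ca M)"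
    by (simp add: con1_def if_distrib f sum_negf cong: if_cong)
  finally show ?thesis by (simp add: scaleR_2)
qed

lemma Dm1_con3:
  assumes "\<And>a b c. smooth_fun U (f a b c)" "\<And>x a b c. x \<in> U \<Longrightarrow> f a b c x = - f b a c x"
    "\<And>x a b c. x \<in> U \<Longrightarrow> f a b c x = - f a c b x"
  shows "Dm1 K N M d (con3 (\<lambda>a b c. fn M (f a b c)) (ca M) (ca M) (ca M)) =
    3 *\<^sub>R con2 (\<lambda>b c. fn M (f d b c)) (ca M) (ca M)"
proof -
  have f1: "fn M (f a d c) = - fn M (f d a c)" for a c
    by (rule fn_antisym[OF assms(1) assms(1) assms(2)])
  have "fn M (f a b d) = - fn M (f a d b)" for a b
    by (rule fn_antisym[OF assms(1) assms(1) assms(3)])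
  then have f2: "fn M (f a b d) = fn M (f d a b)" for a b
    by (simp add: f1)
  have "Dm1 K N M d (fn M (f a b c) * ca M a * ca M b * ca M c) =
      fn M (f a b c) * (if d = a then ca M b * ca M c else 0)
      - fn M (f a b c) * (if d = b then ca M a * ca M c else 0)
      + fn M (f a b c) * (if d = c then ca M a * ca M b else 0)" for a b c
    by (simp add: mult.assoc Dm1_mult[OF fn_grd[OF assms(1)]] Dm1_fn[OF assms(1)] Dm1_mult[OF ca_grd]
        Dm1_ca right_diff_distrib distrib_left)
  then have "Dm1 K N M d (con3 (\<lambda>a b c. fn M (f a b c)) (ca M) (ca M) (ca M)) =
      (\<Sum>a\<in>UNIV. \<Sum>b\<in>UNIV. \<Sum>c\<in>UNIV. fn M (f a b c) * (if d = a then ca M b * ca M c else 0))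
      - (\<Sum>a\<in>UNIV. \<Sum>b\<in>UNIV. \<Sum>c\<in>UNIV. fn M (f a b c) * (if d = b then ca M a * ca M c else 0))
      + (\<Sum>a\<in>UNIV. \<Sum>b\<in>UNIV. \<Sum>c\<in>UNIV. fn M (f a b c) * (if d = c then ca M a * ca M b else 0))"
    unfolding con3_def linear_sum[OF Dm1_linear] by (simp add: sum_subtractf sum.distrib)
  also have "(\<Sum>a\<in>UNIV. \<Sum>b\<in>UNIV. \<Sum>c\<in>UNIV. fn M (f a b c) * (if d = a then ca M b * ca M c else 0)) =
      con2 (\<lambda>b c. fn M (f d b c)) (ca M) (ca M)"
  proof -
    have "(\<Sum>b\<in>UNIV. \<Sum>c\<in>UNIV. fn M (f a b c) * (if d = a then ca M b * ca M c else 0)) =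
        (if d = a then con2 (\<lambda>b c. fn M (f d b c)) (ca M) (ca M) else 0)" for a
      by (simp add: con2_def mult.assoc)
    then show ?thesis by simp
  qed
  also have "(\<Sum>a\<in>UNIV. \<Sum>b\<in>UNIV. \<Sum>c\<in>UNIV. fn M (f a b c) * (if d = b then ca M a * ca M c else 0)) =
      - con2 (\<lambda>b c. fn M (f d b c)) (ca M) (ca M)"
  proof -
    have "(\<Sum>b\<in>UNIV. \<Sum>c\<in>UNIV. fn M (f a b c) * (if d = b then ca M a * ca M c else 0)) =
        (\<Sum>c\<in>UNIV. - (fn M (f d a c) * ca M a * ca M c))" for a
      by (subst sum.swap) (simp add: mult.assoc if_distrib f1 cong: if_cong)
    then show ?thesis by (simp add: con2_def sum_negf)
  qed
  also have "(\<Sum>a\<in>UNIV. \<Sum>b\<in>UNIV. \<Sum>c\<in>UNIV. fn M (f a b c) * (if d = c then ca M a * ca M b else 0)) =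
      con2 (\<lambda>b c. fn M (f d b c)) (ca M) (ca M)"
    by (simp add: con2_def if_distrib f2 mult.assoc cong: if_cong)
  finally show ?thesis
    using scaleR_left_distrib[of 2 1 "con2 (\<lambda>b c. fn M (f d b c)) (ca M) (ca M)"] by (simp add: scaleR_2)
qed

text \<open>This explains the connection term in \<open>Dm1\<close>: its action on b_\<mu> cancels
  the derivative of the quadratic part of b^nabla, where the factor 2 of \<open>Dm1_con2\<close>
  meets the coefficient 1/2.\<close>

lemma Dm1_bnab: "Dm1 K N M d (bnab K N M \<mu>) = 0"
proof -
  have a: "fn M (om_low K N \<mu> b d) = - fn M (om_low K N \<mu> d b)" for b
    by (rule fn_antisym[OF smooth_om_low smooth_om_low om_low_antisym])
  have "Dm1 K N M d (cb M \<mu>) = - con1 (\<lambda>b. fn M (om_low K N \<mu> d b)) (ca M)"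
    by (simp add: Dm1_def pa_cb pb_cb con1_def a if_distrib sum_negf cong: if_cong)
      (subst sum.swap, simp add: sum_negf)
  moreover have "Dm1 K N M d (con2 (\<lambda>a b. fn M (om_low K N \<mu> a b)) (ca M) (ca M)) =
      2 *\<^sub>R con1 (\<lambda>b. fn M (om_low K N \<mu> d b)) (ca M)"
    by (intro Dm1_con2 smooth_om_low om_low_antisym)
  ultimately show ?thesis
    unfolding bnab_eq linear_add[OF Dm1_linear] linear_scale[OF Dm1_linear] by simp
qed


lemma p_antisym:
  assumes "smooth_fun U f" "smooth_fun U g" "\<And>x. x \<in> U \<Longrightarrow> f x = - g x"
  shows "p f = - p g"
  using fn_antisym[OF assms] by (simp add: pbf_def linear_neg[OF pull_linear])

section \<open>The components of Q as contractions, and their first and second derivatives\<close>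

definition rho_up :: "'m \<Rightarrow> 'a \<Rightarrow> real^'m \<Rightarrow> real" where
  "rho_up \<mu> a x = (\<Sum>b\<in>UNIV. etai K a b * rho K b \<mu> x)"

lemma smooth_rho_up: "smooth_fun U (rho_up \<mu> a)"
  unfolding rho_up_def[abs_def] by (intro smooth_all)

lemma fn_scale: "smooth_fun U f \<Longrightarrow> fn M (\<lambda>x. r * f x) = r *\<^sub>R fn M f"
  using fn_mult[OF smooth_fun_const, of f r] by (simp add: fn_const scaleR_conv_of_real)

lemma fn_sum: "(\<And>i. smooth_fun U (f i)) \<Longrightarrow> fn M (\<lambda>x. \<Sum>i\<in>I. f i x) = (\<Sum>i\<in>I. fn M (f i))"
proof (induction I rule: infinite_finite_induct)
  case (insert i I)
  then show ?case
    using fn_add[of "f i" "\<lambda>x. \<Sum>i\<in>I. f i x"] by (simp add: smooth_fun_sum open_U)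
qed (simp_all add: fn_const)

lemma fn_rho_up: "fn M (rho_up \<mu> a) = (\<Sum>b\<in>UNIV. etai K a b *\<^sub>R fn M (rho K b \<mu>))"
  unfolding rho_up_def[abs_def] by (subst fn_sum) (simp_all add: fn_scale smooth_rho smooth_fun_cmult open_U)

lemma bnab_grd: "bnab K N M \<mu> \<in> grd M 2"
proof -
  have "fn M (om_low K N \<mu> a b) * ca M a * ca M b \<in> grd M 2" for a b
    using grd_mult[OF grd_mult[OF fn_grd[OF smooth_om_low] ca_grd] ca_grd] by (simp add: numeral_2_eq_2)
  then show ?thesis
    unfolding bnab_eq con2_def
    by (intro subspace_add subspace_scale subspace_sum grd_subspace cb_grd)
qed

lemma pull_con1: "pull S (con1 (\<lambda>a. fn M (f a)) (ca M)) = con1 (\<lambda>a. p (f a)) (Af M S)"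
  by (simp add: con1_def linear_sum[OF pull_linear] pull_mult pbf_def Af_def)

lemma pull_con2: "pull S (con2 (\<lambda>a b. fn M (f a b)) (ca M) (ca M)) = con2 (\<lambda>a b. p (f a b)) (Af M S) (Af M S)"
  by (simp add: con2_def linear_sum[OF pull_linear] pull_mult pbf_def Af_def)

lemma pull_fn: "pull S (fn M f) = p f"
  by (simp add: pbf_def)

lemma pull_bnab: "pull S (bnab K N M \<mu>) = B_nab K N M S \<mu>"
  unfolding bnab_eq B_nab_def linear_add[OF pull_linear] linear_scale[OF pull_linear] pull_con2
  by (simp add: con2_def Bf_def)

lemma sum_left_con1:
  assumes "\<And>a b. central (f a b)"
  shows "(\<Sum>a\<in>UNIV. u a * con1 (f a) v) = con2 f u v"
  unfolding con1_def con2_def sum_distrib_left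
  by (simp add: central_left_commute[OF assms] mult.assoc)

lemma sum_left_con2:
  assumes "\<And>a b c. central (f a b c)"
  shows "(\<Sum>a\<in>UNIV. u a * con2 (f a) v w) = con3 f u v w"
  unfolding con2_def con3_def sum_distrib_left
  by (simp add: central_left_commute[OF assms] mult.assoc)

abbreviation "Q \<equiv> Qcomp K N M"
abbreviation "D \<equiv> Dcov K N M"
abbreviation "e \<equiv> ghost K N M S"
abbreviation "et \<equiv> ghost2 K N M S"
abbreviation "Bn \<equiv> B_nab K N M S"
abbreviation "pn \<equiv> psi_nab K N M S"
abbreviation "tn \<equiv> psit_nab K N M S"

lemma Q_Base: "Q (Base \<mu>) = con1 (\<lambda>a. fn M (rho K a \<mu>)) (ca M)"
  by (simp add: con1_def centralD[OF fn_central[OF smooth_rho]])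

lemma Q_Frame: "Q (Frame a) = - (\<Sum>\<mu>\<in>UNIV. fn M (rho_up \<mu> a) * bnab K N M \<mu>)
    + con2 (\<lambda>b c. fn M (gualtieri_torsion_up K N b c a)) (ca M) (ca M)"
proof -
  have "(\<Sum>b\<in>UNIV. \<Sum>\<mu>\<in>UNIV. etai K a b *\<^sub>R (fn M (rho K b \<mu>) * bnab K N M \<mu>)) =
      (\<Sum>\<mu>\<in>UNIV. fn M (rho_up \<mu> a) * bnab K N M \<mu>)"
    unfolding fn_rho_up sum_distrib_right by (subst sum.swap) simp
  then show ?thesis by (simp add: con2_def)
qed

lemma Q_Fibre: "Q (Fibre \<mu>) = - (\<Sum>\<nu>\<in>UNIV. con1 (\<lambda>a. fn M (nabla_rho K N \<mu> a \<nu>)) (ca M) * bnab K N M \<nu>)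
    - (1/3) *\<^sub>R con3 (\<lambda>a b c. fn M (twisted_basic_curvature K N \<mu> a b c)) (ca M) (ca M) (ca M)"
proof -
  have "ca M a * bnab K N M \<nu> = bnab K N M \<nu> * ca M a" for a \<nu>
    using grd_commute[OF ca_grd bnab_grd, of a \<nu>] by simp
  then have "(\<Sum>a\<in>UNIV. \<Sum>\<nu>\<in>UNIV. fn M (nabla_rho K N \<mu> a \<nu>) * bnab K N M \<nu> * ca M a) =
      (\<Sum>\<nu>\<in>UNIV. con1 (\<lambda>a. fn M (nabla_rho K N \<mu> a \<nu>)) (ca M) * bnab K N M \<nu>)"
    unfolding con1_def sum_distrib_right by (subst sum.swap) (simp add: mult.assoc)
  then show ?thesis by (simp add: con3_def)
qed

lemma con1_grd:
  assumes "\<And>a. smooth_fun U (f a)"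
  shows "con1 (\<lambda>a. fn M (f a)) (ca M) \<in> grd M 1"
  unfolding con1_def
  by (intro subspace_sum grd_subspace) (use grd_mult[OF fn_grd[OF assms] ca_grd] in simp)

lemma torsion_up_antisym:
  assumes "x \<in> U"
  shows "gualtieri_torsion_up K N b c a x = - gualtieri_torsion_up K N c b a x"
proof -
  have "gualtieri_torsion_up K N b c a x = (\<Sum>d\<in>UNIV. etai K a d * (- gualtieri_torsion K N c b d x))"
    unfolding gualtieri_torsion_up_def by (intro sum.cong refl arg_cong2[of _ _ _ _ "(*)"] torsion_antisym(1) assms)
  then show ?thesis by (simp add: gualtieri_torsion_up_def sum_negf)
qed

lemma D_Q_Base:
  "D (Frame d) (Q (Base \<mu>)) = fn M (rho K d \<mu>)"
  "D (Fibre \<nu>) (Q (Base \<mu>)) = 0"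
  unfolding Q_Base by (simp_all add: Dm1_con1 pb_con1 smooth_rho)

lemma D_Q_Frame:
  "D (Frame d) (Q (Frame a)) = 2 *\<^sub>R con1 (\<lambda>b. fn M (gualtieri_torsion_up K N d b a)) (ca M)"
  "D (Fibre \<nu>) (Q (Frame a)) = - fn M (rho_up \<nu> a)"
proof -
  have "Dm1 K N M d (fn M (rho_up \<mu> a) * bnab K N M \<mu>) = 0" for \<mu>
    by (simp add: Dm1_mult[OF fn_grd[OF smooth_rho_up]] Dm1_fn[OF smooth_rho_up] Dm1_bnab)
  moreover have "Dm1 K N M d (con2 (\<lambda>b c. fn M (gualtieri_torsion_up K N b c a)) (ca M) (ca M)) =
      2 *\<^sub>R con1 (\<lambda>b. fn M (gualtieri_torsion_up K N d b a)) (ca M)"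
    by (intro Dm1_con2 smooth_torsion_up torsion_up_antisym)
  ultimately show "D (Frame d) (Q (Frame a)) = 2 *\<^sub>R con1 (\<lambda>b. fn M (gualtieri_torsion_up K N d b a)) (ca M)"
    unfolding Q_Frame Dcov.simps linear_add[OF Dm1_linear] linear_neg[OF Dm1_linear] linear_sum[OF Dm1_linear]
    by simp
  show "D (Fibre \<nu>) (Q (Frame a)) = - fn M (rho_up \<nu> a)"
    unfolding Q_Frame Dcov.simps linear_add[OF pb_linear] linear_neg[OF pb_linear] linear_sum[OF pb_linear]
    by (simp add: pb_con2 smooth_torsion_up pb_mult[OF fn_grd[OF smooth_rho_up]] partials_fn[OF smooth_rho_up]
        pb_bnab if_distrib cong: if_cong)
qed

lemma D_Q_Fibre:
  "D (Frame d) (Q (Fibre \<mu>)) = - (\<Sum>\<nu>\<in>UNIV. fn M (nabla_rho K N \<mu> d \<nu>) * bnab K N M \<nu>)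
    - con2 (\<lambda>b c. fn M (twisted_basic_curvature K N \<mu> d b c)) (ca M) (ca M)"
  "D (Fibre \<nu>) (Q (Fibre \<mu>)) = - con1 (\<lambda>a. fn M (nabla_rho K N \<mu> a \<nu>)) (ca M)"
proof -
  have "Dm1 K N M d (con1 (\<lambda>a. fn M (nabla_rho K N \<mu> a \<nu>)) (ca M) * bnab K N M \<nu>) =
      fn M (nabla_rho K N \<mu> d \<nu>) * bnab K N M \<nu>" for \<nu>
    by (simp add: Dm1_mult[OF con1_grd[OF smooth_nabla_rho]] Dm1_con1[OF smooth_nabla_rho] Dm1_bnab)
  moreover have "Dm1 K N M d (con3 (\<lambda>a b c. fn M (twisted_basic_curvature K N \<mu> a b c)) (ca M) (ca M) (ca M)) =
      3 *\<^sub>R con2 (\<lambda>b c. fn M (twisted_basic_curvature K N \<mu> d b c)) (ca M) (ca M)"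
    by (intro Dm1_con3 smooth_curvature twisted_basic_curvature_antisym)
  ultimately show "D (Frame d) (Q (Fibre \<mu>)) = - (\<Sum>\<nu>\<in>UNIV. fn M (nabla_rho K N \<mu> d \<nu>) * bnab K N M \<nu>)
    - con2 (\<lambda>b c. fn M (twisted_basic_curvature K N \<mu> d b c)) (ca M) (ca M)"
    unfolding Q_Fibre Dcov.simps linear_diff[OF Dm1_linear] linear_neg[OF Dm1_linear] linear_sum[OF Dm1_linear]
      linear_scale[OF Dm1_linear]
    by simp
  show "D (Fibre \<nu>) (Q (Fibre \<mu>)) = - con1 (\<lambda>a. fn M (nabla_rho K N \<mu> a \<nu>)) (ca M)"
    unfolding Q_Fibre Dcov.simps linear_diff[OF pb_linear] linear_neg[OF pb_linear] linear_sum[OF pb_linear]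
      linear_scale[OF pb_linear]
    by (simp add: pb_con3 smooth_curvature pb_mult[OF con1_grd[OF smooth_nabla_rho]] pb_con1[OF smooth_nabla_rho]
        pb_bnab if_distrib cong: if_cong)
qed

lemmas D_linear = linear_0[OF Dm1_linear] linear_0[OF pb_linear] linear_neg[OF Dm1_linear] linear_neg[OF pb_linear]
  linear_scale[OF Dm1_linear] linear_scale[OF pb_linear] linear_diff[OF Dm1_linear] linear_diff[OF pb_linear]

lemma DD_Q_Base:
  "D (Frame b) (D (Frame c) (Q (Base \<mu>))) = 0"
  "D (Frame b) (D (Fibre \<nu>) (Q (Base \<mu>))) = 0"
  "D (Fibre \<nu>) (D (Frame c) (Q (Base \<mu>))) = 0"
  "D (Fibre \<nu>) (D (Fibre \<nu>') (Q (Base \<mu>))) = 0"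
  unfolding D_Q_Base by (simp_all add: Dm1_fn partials_fn smooth_rho D_linear)

text \<open>The inner derivation acts first and so takes the first index of the coefficient. The
  indices come in the order opposite to the ghosts in the contractions, and antisymmetry converts
  this into the signs found there.\<close>

lemma DD_Q_Frame:
  "D (Frame b) (D (Frame c) (Q (Frame a))) = 2 *\<^sub>R fn M (gualtieri_torsion_up K N c b a)"
  "D (Frame b) (D (Fibre \<nu>) (Q (Frame a))) = 0"
  "D (Fibre \<nu>) (D (Frame c) (Q (Frame a))) = 0"
  "D (Fibre \<nu>) (D (Fibre \<nu>') (Q (Frame a))) = 0"
  unfolding D_Q_Frame
  by (simp_all add: Dm1_fn partials_fn smooth_rho_up D_linear Dm1_con1 pb_con1 smooth_torsion_up)

lemma DD_Q_Fibre:
  "D (Frame c) (D (Frame d) (Q (Fibre \<mu>))) =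
    - 2 *\<^sub>R con1 (\<lambda>b. fn M (twisted_basic_curvature K N \<mu> d c b)) (ca M)"
  "D (Frame b) (D (Fibre \<nu>) (Q (Fibre \<mu>))) = - fn M (nabla_rho K N \<mu> b \<nu>)"
  "D (Fibre \<nu>) (D (Frame d) (Q (Fibre \<mu>))) = - fn M (nabla_rho K N \<mu> d \<nu>)"
  "D (Fibre \<nu>) (D (Fibre \<nu>') (Q (Fibre \<mu>))) = 0"
proof -
  have "Dm1 K N M c (con2 (\<lambda>b c. fn M (twisted_basic_curvature K N \<mu> d b c)) (ca M) (ca M)) =
      2 *\<^sub>R con1 (\<lambda>b. fn M (twisted_basic_curvature K N \<mu> d c b)) (ca M)"
    by (intro Dm1_con2 smooth_curvature twisted_basic_curvature_antisym)
  then show "D (Frame c) (D (Frame d) (Q (Fibre \<mu>))) =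
    - 2 *\<^sub>R con1 (\<lambda>b. fn M (twisted_basic_curvature K N \<mu> d c b)) (ca M)"
    unfolding D_Q_Fibre unfolding Dcov.simps
    by (simp add: D_linear linear_sum[OF Dm1_linear] Dm1_mult[OF fn_grd[OF smooth_nabla_rho]]
        Dm1_fn[OF smooth_nabla_rho] Dm1_bnab)
  show "D (Frame b) (D (Fibre \<nu>) (Q (Fibre \<mu>))) = - fn M (nabla_rho K N \<mu> b \<nu>)"
    "D (Fibre \<nu>) (D (Fibre \<nu>') (Q (Fibre \<mu>))) = 0"
    unfolding D_Q_Fibre by (simp_all add: D_linear Dm1_con1 pb_con1 smooth_nabla_rho)
  show "D (Fibre \<nu>) (D (Frame d) (Q (Fibre \<mu>))) = - fn M (nabla_rho K N \<mu> d \<nu>)"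
    unfolding D_Q_Fibre unfolding Dcov.simps
    by (simp add: D_linear linear_sum[OF pb_linear] pb_mult[OF fn_grd[OF smooth_nabla_rho]]
        partials_fn[OF smooth_nabla_rho] pb_con2 smooth_curvature pb_bnab if_distrib cong: if_cong)
qed

lemmas pull_simps = linear_0[OF pull_linear] linear_neg[OF pull_linear] linear_scale[OF pull_linear]
  linear_diff[OF pull_linear] linear_sum[OF pull_linear] pull_con1 pull_con2 pull_fn pull_mult pull_bnab

section \<open>The contractions of the theorem evaluated on ghosts and fields\<close>

lemma contr_Base:
  "contr1 (pull S) D e (Q (Base \<mu>)) = con1 (\<lambda>a. p (rho K a \<mu>)) (eps S)"
  "contr1 (pull S) D et (Q (Base \<mu>)) = 0"
  "contr2 (pull S) D e e (Q (Base \<mu>)) = 0"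
  "contr2 (pull S) D et e (Q (Base \<mu>)) = 0"
  "contr3 (pull S) D e (Q (Base \<mu>)) = 0"
  unfolding contr1_def contr2_def contr3_def sum_tindex
  by (simp_all add: D_Q_Base DD_Q_Base pull_simps con1_def centralD[OF p_central[OF smooth_rho]]
      del: Qcomp.simps Dcov.simps)
    (simp_all add: D_linear pull_simps Dm1_fn partials_fn smooth_rho)

lemma contr_Frame:
  "contr1 (pull S) D e (Q (Frame a)) =
    2 *\<^sub>R con2 (\<lambda>b c. p (gualtieri_torsion_up K N b c a)) (eps S) (Af M S) + (\<Sum>\<mu>\<in>UNIV. p (rho_up \<mu> a) * pn \<mu>)"
  "contr1 (pull S) D et (Q (Frame a)) = (\<Sum>\<mu>\<in>UNIV. p (rho_up \<mu> a) * tn \<mu>)"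
  "contr2 (pull S) D e e (Q (Frame a)) = - 2 *\<^sub>R con2 (\<lambda>b c. p (gualtieri_torsion_up K N b c a)) (eps S) (eps S)"
  "contr2 (pull S) D et e (Q (Frame a)) = 0"
  "contr3 (pull S) D e (Q (Frame a)) = 0"
proof -
  have T: "p (gualtieri_torsion_up K N c b a) = - p (gualtieri_torsion_up K N b c a)" for b c
    by (intro p_antisym smooth_torsion_up torsion_up_antisym)
  have c: "x * p (rho_up \<mu> a) = p (rho_up \<mu> a) * x" for x \<mu>
    by (rule centralD[OF p_central[OF smooth_rho_up], symmetric])
  show "contr1 (pull S) D e (Q (Frame a)) =
    2 *\<^sub>R con2 (\<lambda>b c. p (gualtieri_torsion_up K N b c a)) (eps S) (Af M S) + (\<Sum>\<mu>\<in>UNIV. p (rho_up \<mu> a) * pn \<mu>)"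
    unfolding contr1_def sum_tindex
    by (simp add: D_Q_Frame pull_simps del: Qcomp.simps Dcov.simps)
      (simp add: c sum_left_con1 p_central smooth_torsion_up flip: scaleR_sum_right)
  show "contr1 (pull S) D et (Q (Frame a)) = (\<Sum>\<mu>\<in>UNIV. p (rho_up \<mu> a) * tn \<mu>)"
    unfolding contr1_def sum_tindex
    by (simp add: D_Q_Frame pull_simps c del: Qcomp.simps Dcov.simps)
  have "eps S b * eps S c * p (gualtieri_torsion_up K N c b a) =
      - (p (gualtieri_torsion_up K N b c a) * eps S b * eps S c)" for b c
    using centralD[OF p_central[OF smooth_torsion_up], of b c a "eps S b * eps S c"]
    unfolding T[of c b] by (simp add: mult.assoc)
  then have "(\<Sum>b\<in>UNIV. \<Sum>c\<in>UNIV. eps S b * eps S c * p (gualtieri_torsion_up K N c b a)) =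
      - con2 (\<lambda>b c. p (gualtieri_torsion_up K N b c a)) (eps S) (eps S)"
    by (simp add: con2_def sum_negf)
  then show "contr2 (pull S) D e e (Q (Frame a)) = - 2 *\<^sub>R con2 (\<lambda>b c. p (gualtieri_torsion_up K N b c a)) (eps S) (eps S)"
    unfolding contr2_def sum_tindex
    by (simp add: DD_Q_Frame pull_simps ghost_fdeg_def del: Qcomp.simps Dcov.simps flip: scaleR_sum_right)
  show "contr2 (pull S) D et e (Q (Frame a)) = 0"
    unfolding contr2_def sum_tindex
    by (simp add: DD_Q_Frame pull_simps del: Qcomp.simps Dcov.simps)
  show "contr3 (pull S) D e (Q (Frame a)) = 0"
    unfolding contr3_def sum_tindex
    by (simp add: DD_Q_Frame pull_simps del: Qcomp.simps Dcov.simps)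
      (simp add: pull_simps D_linear Dm1_fn partials_fn smooth_torsion_up)
qed

lemma psi_nab_bigr: "pn \<mu> \<in> bigr S (1, 1)"
proof -
  have "pn \<mu> = psi S \<mu> + con2 (\<lambda>a b. p (om_low K N \<mu> a b)) (Af M S) (eps S)"
    by (simp add: psi_nab_def con2_def)
  moreover have "con2 (\<lambda>a b. p (om_low K N \<mu> a b)) (Af M S) (eps S) \<in> bigr S (0 + 1, 1 + 0)"
    by (intro con2_bigr smooth_om_low Af_bigr eps_bigr)
  ultimately show ?thesis
    using subspace_add[OF bigr_subspace psi_bigr] by simp
qed

lemma contr_Fibre:
  "contr1 (pull S) D e (Q (Fibre \<mu>)) =
    - (\<Sum>\<nu>\<in>UNIV. con1 (\<lambda>a. p (nabla_rho K N \<mu> a \<nu>)) (eps S) * Bn \<nu>)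
    - con3 (\<lambda>a b c. p (twisted_basic_curvature K N \<mu> a b c)) (eps S) (Af M S) (Af M S)
    + (\<Sum>\<nu>\<in>UNIV. pn \<nu> * con1 (\<lambda>a. p (nabla_rho K N \<mu> a \<nu>)) (Af M S))"
  "contr1 (pull S) D et (Q (Fibre \<mu>)) = (\<Sum>\<nu>\<in>UNIV. tn \<nu> * con1 (\<lambda>a. p (nabla_rho K N \<mu> a \<nu>)) (Af M S))"
  "contr2 (pull S) D e e (Q (Fibre \<mu>)) =
    2 *\<^sub>R con3 (\<lambda>a b c. p (twisted_basic_curvature K N \<mu> a b c)) (eps S) (eps S) (Af M S)
    + 2 *\<^sub>R (\<Sum>\<nu>\<in>UNIV. pn \<nu> * con1 (\<lambda>a. p (nabla_rho K N \<mu> a \<nu>)) (eps S))"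
  "contr2 (pull S) D et e (Q (Fibre \<mu>)) = (\<Sum>\<nu>\<in>UNIV. tn \<nu> * con1 (\<lambda>a. p (nabla_rho K N \<mu> a \<nu>)) (eps S))"
  "contr3 (pull S) D e (Q (Fibre \<mu>)) =
    2 *\<^sub>R con3 (\<lambda>a b c. p (twisted_basic_curvature K N \<mu> a b c)) (eps S) (eps S) (eps S)"
proof -
  let ?nr = "\<lambda>a \<nu>. p (nabla_rho K N \<mu> a \<nu>)"
  let ?S = "\<lambda>a b c. p (twisted_basic_curvature K N \<mu> a b c)"
  note cn = p_central[OF smooth_nabla_rho[of \<mu>]]
  note cS = p_central[OF smooth_curvature[of \<mu>]]
  have S12: "?S b a c = - ?S a b c" for a b c
    by (rule p_antisym[OF smooth_curvature smooth_curvature twisted_basic_curvature_antisym(1)])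
  have S23: "?S a c b = - ?S a b c" for a b c
    by (rule p_antisym[OF smooth_curvature smooth_curvature twisted_basic_curvature_antisym(2)])
  have S13: "?S c b a = - ?S a b c" for a b c
    using S12[of b c a] S23[of b c a] S12[of b a c] by simp
  have lr: "(\<Sum>a\<in>UNIV. x * u a * ?nr a \<nu>) = x * con1 (\<lambda>a. ?nr a \<nu>) u" for x u \<nu>
  proof -
    have "x * u a * ?nr a \<nu> = x * (?nr a \<nu> * u a)" for a
      using centralD[OF cn, of a \<nu> "u a"] by (simp add: mult.assoc)
    then show ?thesis by (simp add: con1_def sum_distrib_left)
  qed
  have "(\<Sum>a\<in>UNIV. eps S a * (\<Sum>\<nu>\<in>UNIV. ?nr a \<nu> * Bn \<nu>)) = (\<Sum>\<nu>\<in>UNIV. con1 (\<lambda>a. ?nr a \<nu>) (eps S) * Bn \<nu>)"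
    unfolding con1_def sum_distrib_right sum_distrib_left
    by (subst sum.swap) (simp add: central_left_commute[OF cn] mult.assoc)
  then show "contr1 (pull S) D e (Q (Fibre \<mu>)) =
    - (\<Sum>\<nu>\<in>UNIV. con1 (\<lambda>a. ?nr a \<nu>) (eps S) * Bn \<nu>) - con3 ?S (eps S) (Af M S) (Af M S)
    + (\<Sum>\<nu>\<in>UNIV. pn \<nu> * con1 (\<lambda>a. ?nr a \<nu>) (Af M S))"
    unfolding contr1_def sum_tindex
    by (simp add: D_Q_Fibre pull_simps del: Qcomp.simps Dcov.simps)
      (simp add: right_diff_distrib sum_subtractf sum_negf sum_left_con2[OF cS])
  show "contr1 (pull S) D et (Q (Fibre \<mu>)) = (\<Sum>\<nu>\<in>UNIV. tn \<nu> * con1 (\<lambda>a. ?nr a \<nu>) (Af M S))"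
    unfolding contr1_def sum_tindex
    by (simp add: D_Q_Fibre pull_simps del: Qcomp.simps Dcov.simps)
  \<comment> \<open>Of the two mixed terms, the one with epsilon before psi carries the sign -1 of
    \<open>contr2\<close>. Exchanging the two ghosts, both of ghost degree 1, yields another -1, so
    the mixed terms add up instead of cancelling.\<close>
  have comm: "(\<Sum>a\<in>UNIV. eps S a * pn \<nu> * ?nr a \<nu>) = - (pn \<nu> * con1 (\<lambda>a. ?nr a \<nu>) (eps S))" for \<nu>
  proof -
    have "eps S a * pn \<nu> * ?nr a \<nu> = - (pn \<nu> * eps S a * ?nr a \<nu>)" for a
      using bigr_commute[OF eps_bigr psi_nab_bigr, of a \<nu>] by simp
    then show ?thesis by (simp add: sum_negf lr)
  qed
  have "eps S a * eps S b * con1 (\<lambda>c. ?S b a c) (Af M S) =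
      - (\<Sum>c\<in>UNIV. ?S a b c * eps S a * eps S b * Af M S c)" for a b
    unfolding con1_def S12[of b a]
    by (simp add: sum_distrib_left sum_negf central_left_commute[OF cS] mult.assoc)
  then have SA: "(\<Sum>a\<in>UNIV. \<Sum>b\<in>UNIV. eps S a * eps S b * con1 (\<lambda>c. ?S b a c) (Af M S)) =
      - con3 ?S (eps S) (eps S) (Af M S)"
    by (simp add: con3_def sum_negf)
  have "contr2 (pull S) D e e (Q (Fibre \<mu>)) =
      - 2 *\<^sub>R (\<Sum>a\<in>UNIV. \<Sum>b\<in>UNIV. eps S a * eps S b * con1 (\<lambda>c. ?S b a c) (Af M S))
      - (\<Sum>a\<in>UNIV. \<Sum>\<nu>\<in>UNIV. eps S a * pn \<nu> * ?nr a \<nu>)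
      + (\<Sum>\<nu>\<in>UNIV. \<Sum>a\<in>UNIV. pn \<nu> * eps S a * ?nr a \<nu>)"
    unfolding contr2_def sum_tindex
    by (simp add: DD_Q_Fibre pull_simps ghost_fdeg_def del: Qcomp.simps Dcov.simps)
      (simp add: sum.distrib sum_negf sum_subtractf flip: scaleR_sum_right)
  also have "(\<Sum>a\<in>UNIV. \<Sum>\<nu>\<in>UNIV. eps S a * pn \<nu> * ?nr a \<nu>) = - (\<Sum>\<nu>\<in>UNIV. pn \<nu> * con1 (\<lambda>a. ?nr a \<nu>) (eps S))"
    by (subst sum.swap) (simp add: comm sum_negf)
  finally show "contr2 (pull S) D e e (Q (Fibre \<mu>)) = 2 *\<^sub>R con3 ?S (eps S) (eps S) (Af M S)
    + 2 *\<^sub>R (\<Sum>\<nu>\<in>UNIV. pn \<nu> * con1 (\<lambda>a. ?nr a \<nu>) (eps S))"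
    by (simp add: SA lr scaleR_2)
  show "contr2 (pull S) D et e (Q (Fibre \<mu>)) = (\<Sum>\<nu>\<in>UNIV. tn \<nu> * con1 (\<lambda>a. ?nr a \<nu>) (eps S))"
    unfolding contr2_def sum_tindex
    by (simp add: DD_Q_Fibre pull_simps ghost_fdeg_def lr del: Qcomp.simps Dcov.simps)
  have "eps S a * eps S b * eps S c * ?S c b a = - (?S a b c * eps S a * eps S b * eps S c)" for a b c
    using centralD[OF cS, of a b c "eps S a * eps S b * eps S c"]
    unfolding S13[of c b a] by (simp add: mult.assoc)
  then have "(\<Sum>a\<in>UNIV. \<Sum>b\<in>UNIV. \<Sum>c\<in>UNIV. eps S a * eps S b * eps S c * ?S c b a) = - con3 ?S (eps S) (eps S) (eps S)"
    by (simp add: con3_def sum_negf)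
  moreover have "contr3 (pull S) D e (Q (Fibre \<mu>)) =
      - 2 *\<^sub>R (\<Sum>a\<in>UNIV. \<Sum>b\<in>UNIV. \<Sum>c\<in>UNIV. eps S a * eps S b * eps S c * ?S c b a)"
  proof -
    \<comment> \<open>A derivative along b^nabla leaves at most one coordinate a, so only three
      frame derivatives survive. The cubic term contributes -1/3 times 3!, that is -2, and reversing
      three indices, an odd permutation, changes the sign.\<close>
    have 1: "D (Frame a) (D (Frame b) (D (Frame c) (Q (Fibre \<mu>)))) = - 2 *\<^sub>R fn M (twisted_basic_curvature K N \<mu> c b a)"
      "D (Fibre \<nu>) (D (Frame b) (D (Frame c) (Q (Fibre \<mu>)))) = 0"
      "D (Frame a) (D (Fibre \<nu>) (D (Frame c) (Q (Fibre \<mu>)))) = 0"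
      "D (Fibre \<nu>) (D (Fibre \<nu>') (D (Frame c) (Q (Fibre \<mu>)))) = 0"
      "D (Frame a) (D (Frame b) (D (Fibre \<nu>) (Q (Fibre \<mu>)))) = 0"
      "D (Fibre \<nu>) (D (Frame b) (D (Fibre \<nu>') (Q (Fibre \<mu>)))) = 0"
      "D (Frame a) (D (Fibre \<nu>) (D (Fibre \<nu>') (Q (Fibre \<mu>)))) = 0"
      "D (Fibre \<nu>'') (D (Fibre \<nu>) (D (Fibre \<nu>') (Q (Fibre \<mu>)))) = 0" for a b c \<nu> \<nu>' \<nu>''
      unfolding DD_Q_Fibre
      by (simp_all add: D_linear Dm1_con1 pb_con1 smooth_curvature Dm1_fn partials_fn smooth_nabla_rho)
    show ?thesis
      unfolding contr3_def sum_tindex 1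
      by (simp add: pull_simps ghost_fdeg_def del: Qcomp.simps Dcov.simps)
        (simp add: sum_negf flip: scaleR_sum_right)
  qed
  ultimately show "contr3 (pull S) D e (Q (Fibre \<mu>)) = 2 *\<^sub>R con3 ?S (eps S) (eps S) (eps S)"
    by simp
qed


section \<open>The covariant transformation\<close>

text \<open>Contractions with unspecified fields, so that one identity covers every placement of
  \<open>A\<close> and \<open>E\<close>. In \<open>dW \<sigma> \<mu>\<close> the derivative is taken
  along \<sigma>.\<close>

definition R where "R \<nu> u = con1 (\<lambda>a. p (rho K a \<nu>)) u"
definition dR where "dR \<mu> \<nu> u = con1 (\<lambda>a. p (pdiff \<mu> (rho K a \<nu>))) u"
definition NR where "NR \<mu> \<nu> u = con1 (\<lambda>a. p (nabla_rho K N \<mu> a \<nu>)) u"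
definition W where "W \<mu> u v = con2 (\<lambda>a b. p (om_low K N \<mu> a b)) u v"
definition dW where "dW \<sigma> \<mu> u v = con2 (\<lambda>a b. p (pdiff \<sigma> (om_low K N \<mu> a b))) u v"
definition Om where "Om \<mu> u c = con1 (\<lambda>a. p (omg N \<mu> a c)) u"
definition C3 where "C3 u v w = con3 (\<lambda>a b c. p (cst K a b c)) u v w"
definition CH where "CH \<mu> u v w = con3 (\<lambda>a b c. p (\<lambda>x. pdiff \<mu> (cst K a b c) x + hfl3 K \<mu> a b c x)) u v w"
definition TS where "TS \<mu> u v w = con3 (\<lambda>a b c. p (twisted_basic_curvature K N \<mu> a b c)) u v w"
definition CU where "CU u v a = con2 (\<lambda>b c. p (cst_up K a b c)) u v"
definition up where "up V a = (\<Sum>\<mu>\<in>UNIV. p (rho_up \<mu> a) * V \<mu>)"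
text \<open>This is \<open>kfun\<close> contracted with three fields, as \<open>kfun_con\<close>
  confirms. It is spelled out because its four terms arise separately in the BRST
  variations.\<close>

definition KK where "KK \<mu> u v w = (\<Sum>\<nu>\<in>UNIV. dR \<mu> \<nu> u * W \<nu> v w) + (\<Sum>\<nu>\<in>UNIV. R \<nu> u * dW \<nu> \<mu> v w)
    - (\<Sum>\<nu>\<in>UNIV. R \<nu> (Om \<mu> u) * W \<nu> v w) + C3 (Om \<mu> u) v w"

lemma R_Om: "R \<nu> (Om \<mu> u) = con1 (\<lambda>a. p (\<lambda>x. \<Sum>b\<in>UNIV. omg N \<mu> a b x * rho K b \<nu> x)) u"
proof -
  have "(\<Sum>d\<in>UNIV. p (rho K d \<nu>) * p (omg N \<mu> a d)) = p (\<lambda>x. \<Sum>b\<in>UNIV. omg N \<mu> a b x * rho K b \<nu> x)" for a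
    by (simp add: p_sum p_mult smooth_all centralD[OF p_central[OF smooth_rho]])
  then show ?thesis unfolding R_def Om_def[abs_def] con1_con1 by simp
qed

lemma NR_eq: "NR \<mu> \<nu> u = dR \<mu> \<nu> u + (\<Sum>\<sigma>\<in>UNIV. p (gam N \<nu> \<mu> \<sigma>) * R \<sigma> u) - R \<nu> (Om \<mu> u)"
proof -
  have "(\<Sum>\<sigma>\<in>UNIV. p (gam N \<nu> \<mu> \<sigma>) * R \<sigma> u) = con1 (\<lambda>a. p (\<lambda>x. \<Sum>\<sigma>\<in>UNIV. gam N \<nu> \<mu> \<sigma> x * rho K a \<sigma> x)) u"
    unfolding R_def con1_def sum_distrib_left
    by (subst sum.swap) (simp add: p_sum p_mult smooth_all sum_distrib_right mult.assoc)
  moreover have "p (nabla_rho K N \<mu> a \<nu>) = p (pdiff \<mu> (rho K a \<nu>))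
      + p (\<lambda>x. \<Sum>\<sigma>\<in>UNIV. gam N \<nu> \<mu> \<sigma> x * rho K a \<sigma> x) - p (\<lambda>x. \<Sum>b\<in>UNIV. omg N \<mu> a b x * rho K b \<nu> x)" for a
    unfolding nabla_rho_def[abs_def] by (subst p_diff p_add, intro smooth_all, intro smooth_all)+ (rule refl)
  ultimately show ?thesis
    unfolding NR_def dR_def R_Om by (simp add: con1_def distrib_right left_diff_distrib sum.distrib sum_subtractf)
qed

text \<open>The metric in omega undoes the raised index of \<open>up\<close>, and contracting the
  first index of omega gives the sign. The result has the shape of the omega part of nabla
  rho.\<close>

lemma W_up_left: "W \<mu> (up V) v = - (\<Sum>\<nu>\<in>UNIV. V \<nu> * R \<nu> (Om \<mu> v))"
proof -
  have "(\<Sum>a\<in>UNIV. p (om_low K N \<mu> a b) * p (rho_up \<nu> a)) = - p (\<lambda>x. \<Sum>c\<in>UNIV. omg N \<mu> b c x * rho K c \<nu> x)" for b \<nu>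
  proof -
    have "(\<Sum>a\<in>UNIV. p (om_low K N \<mu> a b) * p (rho_up \<nu> a)) = p (\<lambda>x. \<Sum>a\<in>UNIV. om_low K N \<mu> a b x * rho_up \<nu> a x)"
      by (simp add: p_sum p_mult smooth_all smooth_rho_up)
    also have "\<dots> = - p (\<lambda>x. \<Sum>c\<in>UNIV. omg N \<mu> b c x * rho K c \<nu> x)"
    proof (rule p_antisym)
      fix x assume x: "x \<in> U"
      have "(\<Sum>a\<in>UNIV. om_low K N \<mu> a b x * rho_up \<nu> a x) =
          (\<Sum>c\<in>UNIV. (\<Sum>a\<in>UNIV. etai K c a * om_low K N \<mu> a b x) * rho K c \<nu> x)"
        unfolding rho_up_def sum_distrib_left sum_distrib_right
        by (subst sum.swap) (simp add: mult_ac etai_symmetric)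
      then show "(\<Sum>a\<in>UNIV. om_low K N \<mu> a b x * rho_up \<nu> a x) = - (\<Sum>c\<in>UNIV. omg N \<mu> b c x * rho K c \<nu> x)"
        by (simp add: om_low_raise'[OF x] sum_negf)
    qed (intro smooth_all smooth_rho_up)+
    finally show ?thesis .
  qed
  then show ?thesis
    unfolding W_def up_def[abs_def] R_Om
    by (subst con2_vector_left)
      (simp_all add: p_central smooth_rho_up smooth_om_low con1_def sum_negf)
qed

lemma W_up_right: "W \<mu> v (up V) = (\<Sum>\<nu>\<in>UNIV. R \<nu> (Om \<mu> v) * V \<nu>)"
proof -
  have "(\<Sum>a\<in>UNIV. p (om_low K N \<mu> b a) * p (rho_up \<nu> a)) = p (\<lambda>x. \<Sum>c\<in>UNIV. omg N \<mu> b c x * rho K c \<nu> x)" for b \<nu>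
  proof -
    have "(\<Sum>a\<in>UNIV. p (om_low K N \<mu> b a) * p (rho_up \<nu> a)) = p (\<lambda>x. \<Sum>a\<in>UNIV. om_low K N \<mu> b a x * rho_up \<nu> a x)"
      by (simp add: p_sum p_mult smooth_all smooth_rho_up)
    also have "\<dots> = p (\<lambda>x. \<Sum>c\<in>UNIV. omg N \<mu> b c x * rho K c \<nu> x)"
    proof (rule p_cong)
      fix x assume x: "x \<in> U"
      show "(\<Sum>a\<in>UNIV. om_low K N \<mu> b a x * rho_up \<nu> a x) = (\<Sum>c\<in>UNIV. omg N \<mu> b c x * rho K c \<nu> x)"
        unfolding rho_up_def om_low_raise[symmetric] sum_distrib_left sum_distrib_right
        by (subst sum.swap) (simp add: mult_ac)
    qed (intro smooth_all smooth_rho_up)+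
    finally show ?thesis .
  qed
  then show ?thesis
    unfolding W_def up_def[abs_def] R_Om
    by (subst con2_vector_right) (simp_all add: p_central smooth_rho_up)
qed

text \<open>As for \<open>up\<close>, omega absorbs the raised index of the bracket term, and its
  other index turns \<open>w\<close> into \<open>Om \<mu> w\<close>. These are the terms of
  \<open>KK\<close> with structure functions.\<close>

lemma W_CU_left: "W \<mu> (CU u v) w = - C3 u v (Om \<mu> w)"
proof -
  have "(\<Sum>d\<in>UNIV. p (om_low K N \<mu> d c) * p (cst_up K d a b)) = - (\<Sum>d\<in>UNIV. p (cst K a b d) * p (omg N \<mu> c d))" for a b c
  proof -
    have "(\<Sum>d\<in>UNIV. p (om_low K N \<mu> d c) * p (cst_up K d a b)) = p (\<lambda>x. \<Sum>d\<in>UNIV. om_low K N \<mu> d c x * cst_up K d a b x)"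
      by (simp add: p_sum p_mult smooth_all)
    also have "\<dots> = - p (\<lambda>x. \<Sum>d\<in>UNIV. cst K a b d x * omg N \<mu> c d x)"
    proof (rule p_antisym)
      fix x assume x: "x \<in> U"
      have "(\<Sum>d\<in>UNIV. om_low K N \<mu> d c x * cst_up K d a b x) =
          (\<Sum>e\<in>UNIV. cst K a b e x * (\<Sum>d\<in>UNIV. etai K e d * om_low K N \<mu> d c x))"
        unfolding cst_up_def sum_distrib_left
        by (subst sum.swap) (simp add: mult_ac etai_symmetric)
      then show "(\<Sum>d\<in>UNIV. om_low K N \<mu> d c x * cst_up K d a b x) = - (\<Sum>d\<in>UNIV. cst K a b d x * omg N \<mu> c d x)"
        by (simp add: om_low_raise'[OF x] sum_negf)
    qed (intro smooth_all)+
    finally show ?thesis by (simp add: p_sum p_mult smooth_all)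
  qed
  then show ?thesis
    unfolding W_def CU_def[abs_def] C3_def Om_def[abs_def] con2_con2_left
    by (subst con3_con1_right) (simp_all add: p_central smooth_omg con3_linear_coeff)
qed

lemma W_CU_right: "W \<mu> w (CU u v) = C3 (Om \<mu> w) u v"
proof -
  have "(\<Sum>d\<in>UNIV. p (om_low K N \<mu> c d) * p (cst_up K d a b)) = (\<Sum>d\<in>UNIV. p (cst K d a b) * p (omg N \<mu> c d))" for a b c
  proof -
    have "(\<Sum>d\<in>UNIV. p (om_low K N \<mu> c d) * p (cst_up K d a b)) = p (\<lambda>x. \<Sum>d\<in>UNIV. om_low K N \<mu> c d x * cst_up K d a b x)"
      by (simp add: p_sum p_mult smooth_all)
    also have "\<dots> = p (\<lambda>x. \<Sum>d\<in>UNIV. cst K d a b x * omg N \<mu> c d x)"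
    proof (rule p_cong)
      fix x assume x: "x \<in> U"
      have "(\<Sum>d\<in>UNIV. om_low K N \<mu> c d x * cst_up K d a b x) =
          (\<Sum>e\<in>UNIV. cst K a b e x * (\<Sum>d\<in>UNIV. om_low K N \<mu> c d x * etai K d e))"
        unfolding cst_up_def sum_distrib_left
        by (subst sum.swap) (simp add: mult_ac)
      then show "(\<Sum>d\<in>UNIV. om_low K N \<mu> c d x * cst_up K d a b x) = (\<Sum>d\<in>UNIV. cst K d a b x * omg N \<mu> c d x)"
        by (simp add: om_low_raise cst_cyclic[OF x, of _ a b])
    qed (intro smooth_all)+
    finally show ?thesis by (simp add: p_sum p_mult smooth_all)
  qed
  then show ?thesis
    unfolding W_def CU_def[abs_def] C3_def Om_def[abs_def] con3_con1_left
    by (subst con2_con2_right) (simp_all add: p_central smooth_cst_up)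
qed

lemma smooth_omE_low: "smooth_fun U (omE_low a b c)"
  unfolding omE_low_def[abs_def] by (intro smooth_all)

lemma smooth_kfun: "smooth_fun U (kfun \<mu> a b c)"
  unfolding kfun_def[abs_def] by (intro smooth_all smooth_omE_low)

lemma kfun_con: "con3 (\<lambda>a b c. p (kfun \<mu> a b c)) u v w = KK \<mu> u v w"
proof -
  have p: "p (kfun \<mu> a b c) = (\<Sum>\<nu>\<in>UNIV. p (pdiff \<mu> (rho K a \<nu>)) * p (om_low K N \<nu> b c))
      + (\<Sum>\<nu>\<in>UNIV. p (rho K a \<nu>) * p (pdiff \<nu> (om_low K N \<mu> b c)))
      - (\<Sum>d\<in>UNIV. p (omE_low d b c) * p (omg N \<mu> a d))
      + (\<Sum>d\<in>UNIV. p (cst K d b c) * p (omg N \<mu> a d))" for a b c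
    unfolding kfun_def[abs_def]
    by (simp add: p_sum p_mult p_add p_diff smooth_all smooth_omE_low)
  have "con3 (\<lambda>a b c. p (omE_low a b c)) z v w = (\<Sum>\<nu>\<in>UNIV. R \<nu> z * W \<nu> v w)" for z
    unfolding R_def W_def
    by (subst con3_con1_con2) (simp_all add: p_central smooth_all omE_low_def[abs_def] p_sum p_mult)
  from this[of "Om \<mu> u"] show ?thesis
    unfolding KK_def p con3_linear_coeff dR_def R_def W_def dW_def C3_def
    by (simp add: con3_con1_con2 p_central smooth_all Om_def[abs_def] con3_con1_left)
qed

text \<open>The two permuted copies of \<open>kfun\<close> remain as they are, because rotating the
  fields requires their commutation signs.\<close>

lemma TS_eq: "TS \<mu> u v w = (1/2) *\<^sub>R CH \<mu> u v w
    - (1/2) *\<^sub>R (KK \<mu> u v w + con3 (\<lambda>a b c. p (kfun \<mu> b c a)) u v w + con3 (\<lambda>a b c. p (kfun \<mu> c a b)) u v w)"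
proof -
  have "p (twisted_basic_curvature K N \<mu> a b c) =
      (1/2) *\<^sub>R p (\<lambda>x. pdiff \<mu> (cst K a b c) x + hfl3 K \<mu> a b c x)
      - (1/2) *\<^sub>R (p (kfun \<mu> a b c) + p (kfun \<mu> b c a) + p (kfun \<mu> c a b))" for a b c
  proof -
    have "p (twisted_basic_curvature K N \<mu> a b c) =
        p (\<lambda>x. 1/2 * (pdiff \<mu> (cst K a b c) x + hfl3 K \<mu> a b c x)
          - 1/2 * (kfun \<mu> a b c x + kfun \<mu> b c a x + kfun \<mu> c a b x))"
      by (rule p_cong[OF smooth_curvature twisted_basic_curvature_eq])
    also have "\<dots> = (1/2) *\<^sub>R p (\<lambda>x. pdiff \<mu> (cst K a b c) x + hfl3 K \<mu> a b c x)
      - (1/2) *\<^sub>R (p (kfun \<mu> a b c) + p (kfun \<mu> b c a) + p (kfun \<mu> c a b))"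
      by (subst p_diff p_scale p_add, (intro smooth_all smooth_kfun)+)+ (rule refl)
    finally show ?thesis .
  qed
  then show ?thesis
    by (simp only: TS_def con3_linear_coeff kfun_con[symmetric] CH_def)
qed

lemma kfun_antisym: "x \<in> U \<Longrightarrow> kfun \<mu> a b c x = - kfun \<mu> a c b x"
  unfolding kfun_def
  using om_low_antisym[of x _ b c] pdiff_om_low_antisym[of x _ _ b c]
    omE_low_antisym[of x _ b c] cst_antisym(2)[of x _ b c]
  by (simp add: sum_negf)

lemma KK_swap:
  assumes "scomm s v w"
  shows "KK \<mu> u v w = - s *\<^sub>R KK \<mu> u w v"
proof -
  have "p (kfun \<mu> a b c) = - p (kfun \<mu> a c b)" for a b c
    by (intro p_antisym smooth_kfun kfun_antisym)
  then have "con3 (\<lambda>a b c. p (kfun \<mu> a b c)) u v w = con3 (\<lambda>a b c. - p (kfun \<mu> a c b)) u v w"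
    by (intro arg_cong[of _ _ "\<lambda>f. con3 f u v w"] ext)
  also have "\<dots> = - s *\<^sub>R con3 (\<lambda>a b c. p (kfun \<mu> a b c)) u w v"
    unfolding con3_linear_coeff con3_swap23[OF assms, of "\<lambda>a b c. p (kfun \<mu> a b c)"] by simp
  finally show ?thesis by (simp add: kfun_con)
qed

lemma TS_rotate:
  assumes "scomm s u v" "scomm t u w"
  shows "TS \<mu> u v w = (s * t) *\<^sub>R TS \<mu> v w u"
proof -
  have "p (twisted_basic_curvature K N \<mu> a b c) = p (twisted_basic_curvature K N \<mu> b c a)" for a b c
    using p_antisym[OF smooth_curvature smooth_curvature twisted_basic_curvature_antisym(1), of \<mu> a b c]
      p_antisym[OF smooth_curvature smooth_curvature twisted_basic_curvature_antisym(2), of \<mu> b a c] by simp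
  then have "TS \<mu> u v w = con3 (\<lambda>a b c. p (twisted_basic_curvature K N \<mu> b c a)) u v w"
    unfolding TS_def by (intro arg_cong[of _ _ "\<lambda>f. con3 f u v w"] ext)
  then show ?thesis
    unfolding con3_rotate_left[OF assms, of "\<lambda>a b c. p (twisted_basic_curvature K N \<mu> a b c)"] TS_def .
qed

lemma C3_rotate:
  assumes "scomm s u w" "scomm t v w"
  shows "C3 u v w = (s * t) *\<^sub>R C3 w u v"
proof -
  have "p (cst K a b c) = p (cst K c a b)" for a b c
    by (rule p_cong[OF smooth_cst]) (rule cst_cyclic[symmetric])
  then have "C3 u v w = con3 (\<lambda>a b c. p (cst K c a b)) u v w"
    unfolding C3_def by (intro arg_cong[of _ _ "\<lambda>f. con3 f u v w"] ext)
  then show ?thesis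
    unfolding con3_rotate_right[OF assms, of "\<lambda>a b c. p (cst K a b c)"] C3_def .
qed

text \<open>Rotation turns the permuted copies of \<open>kfun\<close> into \<open>KK\<close> with
  the fields in another order, and equal ones are merged by \<open>KK_swap\<close>: three if all
  fields agree, two if one differs. The assumed signs are those of \<open>A\<close> and
  \<open>E\<close>, in either role.\<close>

lemma TS_eq_KK:
  assumes "scomm (-1) u u" "scomm (-1) v v" "scomm 1 u v" "scomm 1 v u"
  shows "TS \<mu> u u u = (1/2) *\<^sub>R CH \<mu> u u u - (3/2) *\<^sub>R KK \<mu> u u u"
    and "TS \<mu> u v v = (1/2) *\<^sub>R CH \<mu> u v v - (1/2) *\<^sub>R KK \<mu> u v v + KK \<mu> v u v"
    and "TS \<mu> u u v = (1/2) *\<^sub>R CH \<mu> u u v - KK \<mu> u u v - (1/2) *\<^sub>R KK \<mu> v u u"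
proof -
  note rl = con3_rotate_left[where f = "\<lambda>a b c. p (kfun \<mu> a b c)", unfolded kfun_con]
  note rr = con3_rotate_right[where f = "\<lambda>a b c. p (kfun \<mu> a b c)", unfolded kfun_con]
  have three: "x + x + x = 3 *\<^sub>R x" for x :: 'w
    using scaleR_left_distrib[of 2 1 x] by (simp add: scaleR_2)
  show "TS \<mu> u u u = (1/2) *\<^sub>R CH \<mu> u u u - (3/2) *\<^sub>R KK \<mu> u u u"
    unfolding TS_eq rl[OF assms(1,1)] rr[OF assms(1,1)] by (simp add: three)
  have half: "(1/2) *\<^sub>R (x + y + y) = (1/2) *\<^sub>R x + y" for x y :: 'w
    by (simp add: scaleR_right_distrib flip: scaleR_left_distrib)
  show "TS \<mu> u v v = (1/2) *\<^sub>R CH \<mu> u v v - (1/2) *\<^sub>R KK \<mu> u v v + KK \<mu> v u v"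
    unfolding TS_eq rl[OF assms(3,3)] rr[OF assms(3,2)] KK_swap[OF assms(4), of \<mu> v]
    using half[of "KK \<mu> u v v" "- KK \<mu> v u v"] by simp
  show "TS \<mu> u u v = (1/2) *\<^sub>R CH \<mu> u u v - KK \<mu> u u v - (1/2) *\<^sub>R KK \<mu> v u u"
    unfolding TS_eq rl[OF assms(1,3)] rr[OF assms(3,3)] KK_swap[OF assms(4), of \<mu> u]
    using half[of "KK \<mu> v u u" "KK \<mu> u u v"] by (simp add: algebra_simps)
qed

text \<open>A single derivative of omega splits into its symmetric and antisymmetric parts in \<mu>
  and \<nu>. The antisymmetric part, together with the quadratic terms, is half the
  curvature.\<close>

lemma omega_sq_eq:
  assumes "x \<in> U"
  shows "omega_sq K N \<mu> \<nu> a b x = pdiff \<nu> (om_low K N \<mu> a b) x - 1/2 * curv_low K N a b \<mu> \<nu> x"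
proof -
  have *: "(\<Sum>e\<in>UNIV. omg N \<nu> b e x * om_low K N \<mu> e a x) = - (\<Sum>d\<in>UNIV. omg N \<mu> a d x * om_low K N \<nu> b d x)" for \<mu> \<nu> a b
  proof -
    have "(\<Sum>e\<in>UNIV. omg N \<nu> b e x * om_low K N \<mu> a e x) = (\<Sum>d\<in>UNIV. omg N \<mu> a d x * om_low K N \<nu> b d x)"
      unfolding om_low_def sum_distrib_left
      by (subst sum.swap) (simp add: mult_ac eta_symmetric)
    then show ?thesis using om_low_antisym[OF assms, of \<mu> _ a] by (simp add: sum_negf)
  qed
  have **: "(\<Sum>e\<in>UNIV. omg N \<mu> b e x * om_low K N \<nu> e a x) = - (\<Sum>d\<in>UNIV. omg N \<nu> a d x * om_low K N \<mu> b d x)"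
    by (rule *)
  show ?thesis
    unfolding omega_sq_def curv_low_eq[OF assms] * **
    using pdiff_om_low_antisym[OF assms, of \<mu> \<nu> b a] pdiff_om_low_antisym[OF assms, of \<nu> \<mu> b a]
    by (simp add: sum_subtractf field_simps)
qed

end

text \<open>Doubling clears the coefficients 1/2 and leaves an identity in an abelian group.\<close>

lemma eq_if_double_eq: "2 *\<^sub>R x = 2 *\<^sub>R y \<Longrightarrow> x = (y::'w::real_vector)"
  by simp

lemma half_add_half: "(1/2) *\<^sub>R x + (1/2) *\<^sub>R x = (x::'w::real_vector)"
  by (simp flip: scaleR_left_distrib)

context sigma_model_setup
begin

section \<open>BRST variations and exterior derivatives of the covariant fields and ghosts\<close>

abbreviation A where "A \<equiv> Af M S"
abbreviation E where "E \<equiv> eps S"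
abbreviation dE where "dE \<equiv> \<lambda>a. dd S (eps S a)"
abbreviation dA where "dA \<equiv> \<lambda>a. dd S (Af M S a)"
abbreviation F where "F \<equiv> eqF K M S"

definition H2 where "H2 \<mu> \<nu> u v = con2 (\<lambda>a b. p (hfl2 K \<mu> \<nu> a b)) u v"

text \<open>In the bigraded convention \<open>A\<close> of bidegree (0,1) and \<open>E\<close> of
  bidegree (1,0) commute, each anticommutes with itself, and objects of bidegree (1,1) anticommute
  with both.\<close>

lemma scomm_fields: "scomm (-1) A A" "scomm (-1) E E" "scomm 1 A E" "scomm 1 E A"
  "scomm (-1) dE E" "scomm (-1) E dE" "scomm (-1) dE A" "scomm (-1) A dE"
  "scomm (-1) A (\<lambda>a. s0 S (A a))"
  using scomm_bigr[of A 0 1 A 0 1] scomm_bigr[of E 1 0 E 1 0] scomm_bigr[of A 0 1 E 1 0] scomm_bigr[of E 1 0 A 0 1]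
    scomm_bigr[of dE 1 1 E 1 0] scomm_bigr[of E 1 0 dE 1 1] scomm_bigr[of dE 1 1 A 0 1] scomm_bigr[of A 0 1 dE 1 1]
    scomm_bigr[of A 0 1 "\<lambda>a. s0 S (A a)" 1 1]
  by (simp_all add: Af_bigr[simplified] eps_bigr[simplified] deps_bigr[simplified] sA_bigr[simplified])

lemma scomm_Om_right: "scomm s v u \<Longrightarrow> scomm s v (Om \<mu> u)"
  unfolding Om_def[abs_def] by (rule scomm_con1_right) (simp_all add: p_central smooth_omg)

lemma Om_bigr: "(\<And>a. u a \<in> bigr S (g, k)) \<Longrightarrow> Om \<mu> u a \<in> bigr S (g, k)"
  unfolding Om_def by (intro con1_bigr smooth_omg)

lemma R_bigr: "(\<And>a. u a \<in> bigr S (g, k)) \<Longrightarrow> R \<nu> u \<in> bigr S (g, k)"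
  unfolding R_def by (intro con1_bigr smooth_rho)

lemma dR_bigr: "(\<And>a. u a \<in> bigr S (g, k)) \<Longrightarrow> dR \<mu> \<nu> u \<in> bigr S (g, k)"
  unfolding dR_def by (intro con1_bigr smooth_all)

lemma W_bigr: "(\<And>a. u a \<in> bigr S (g, k)) \<Longrightarrow> (\<And>a. v a \<in> bigr S (g', k')) \<Longrightarrow> W \<mu> u v \<in> bigr S (g + g', k + k')"
  unfolding W_def by (intro con2_bigr smooth_om_low)

lemma W_AA: "W \<mu> A A \<in> bigr S (0, 2)" and W_AE: "W \<mu> A E \<in> bigr S (1, 1)" and W_EE: "W \<mu> E E \<in> bigr S (2, 0)"
  using W_bigr[OF Af_bigr Af_bigr] W_bigr[OF Af_bigr eps_bigr] W_bigr[OF eps_bigr eps_bigr]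
  by (simp_all add: numeral_2_eq_2)

lemma dR_A: "dR \<mu> \<nu> A \<in> bigr S (0, 1)" and dR_E: "dR \<mu> \<nu> E \<in> bigr S (1, 0)"
  and R_Om_A: "R \<nu> (Om \<mu> A) \<in> bigr S (0, 1)" and R_Om_E: "R \<nu> (Om \<mu> E) \<in> bigr S (1, 0)"
  and R_A: "R \<nu> A \<in> bigr S (0, 1)" and R_E: "R \<nu> E \<in> bigr S (1, 0)"
  by (intro dR_bigr R_bigr Om_bigr Af_bigr eps_bigr)+

lemmas W_linear = con2_linear[where f = "\<lambda>a b. p (om_low K N \<mu> a b)" for \<mu>, folded W_def]

lemma W_swap: "scomm s u v \<Longrightarrow> W \<mu> u v = - s *\<^sub>R W \<mu> v u"
proof -
  assume s: "scomm s u v"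
  have "p (om_low K N \<mu> a b) = - p (om_low K N \<mu> b a)" for a b
    by (intro p_antisym smooth_om_low om_low_antisym)
  then have "W \<mu> u v = con2 (\<lambda>a b. - p (om_low K N \<mu> b a)) u v"
    unfolding W_def by (intro arg_cong[of _ _ "\<lambda>f. con2 f u v"] ext)
  then show ?thesis
    unfolding con2_linear_coeff con2_swap[OF s, of "\<lambda>a b. p (om_low K N \<mu> a b)"] W_def by simp
qed

lemma s0_W: "(\<And>a. u a \<in> bigr S (g, k)) \<Longrightarrow> s0 S (W \<mu> u v) =
    (\<Sum>\<sigma>\<in>UNIV. s0 S (Xf M S \<sigma>) * dW \<sigma> \<mu> u v) + W \<mu> (\<lambda>a. s0 S (u a)) v + (-1) ^ g *\<^sub>R W \<mu> u (\<lambda>a. s0 S (v a))"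
  unfolding W_def dW_def by (intro s0_con2 smooth_om_low)

lemma dd_W: "(\<And>a. u a \<in> bigr S (g, k)) \<Longrightarrow> dd S (W \<mu> u v) =
    (\<Sum>\<sigma>\<in>UNIV. dd S (Xf M S \<sigma>) * dW \<sigma> \<mu> u v) + W \<mu> (\<lambda>a. dd S (u a)) v + (-1) ^ k *\<^sub>R W \<mu> u (\<lambda>a. dd S (v a))"
  unfolding W_def dW_def by (intro dd_con2 smooth_om_low)

lemma pn_eq: "pn \<mu> = psi S \<mu> + W \<mu> A E"
  by (simp add: psi_nab_def W_def con2_def)

lemma tn_eq: "tn \<mu> = psit S \<mu> + (1/2) *\<^sub>R W \<mu> E E"
  by (simp add: psit_nab_def W_def con2_def)

lemma Bn_eq: "Bn \<mu> = Bf M S \<mu> + (1/2) *\<^sub>R W \<mu> A A"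
  by (simp add: B_nab_def W_def con2_def)

lemma up_eq: "(\<Sum>b\<in>UNIV. \<Sum>\<mu>\<in>UNIV. etai K a b *\<^sub>R (p (rho K b \<mu>) * V \<mu>)) = up V a"
proof -
  have "p (rho_up \<mu> a) = (\<Sum>b\<in>UNIV. etai K a b *\<^sub>R p (rho K b \<mu>))" for \<mu>
    by (simp add: pbf_def fn_rho_up linear_sum[OF pull_linear] linear_scale[OF pull_linear])
  then show ?thesis
    unfolding up_def by (subst sum.swap) (simp add: sum_distrib_right)
qed

lemma s0_Xf: "s0 S (Xf M S \<mu>) = R \<mu> E"
  using brst unfolding brst_transformation_def R_def con1_def by (elim conjE) blast

text \<open>Separates dX into a field equation and the part rho A that is comparable with the BRST
  side.\<close>

lemma dd_Xf: "dd S (Xf M S \<mu>) = F \<mu> + R \<mu> A"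
  by (simp add: eqF_def R_def con1_def)

lemma s0_Af: "s0 S (A a) = dd S (E a) + up (psi S) a + CU A E a"
proof -
  have "\<forall>a. s0 S (Af M S a) = dd S (eps S a)
        + (\<Sum>b\<in>UNIV. \<Sum>\<mu>\<in>UNIV. etai K a b *\<^sub>R (pbf M S (rho K b \<mu>) * psi S \<mu>))
        + (\<Sum>b\<in>UNIV. \<Sum>c\<in>UNIV. pbf M S (cst_up K a b c) * Af M S b * eps S c)"
    using brst unfolding brst_transformation_def by (elim conjE)
  from this[rule_format, of a] show ?thesis by (simp only: up_eq CU_def con2_def)
qed

lemma s0_eps: "s0 S (E a) = - up (psit S) a - (1/2) *\<^sub>R CU E E a"
proof -
  have "\<forall>a. s0 S (eps S a) = - (\<Sum>b\<in>UNIV. etai K a b *\<^sub>R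
          ((\<Sum>\<mu>\<in>UNIV. pbf M S (rho K b \<mu>) * psit S \<mu>)
           + (1/2) *\<^sub>R (\<Sum>c\<in>UNIV. \<Sum>d\<in>UNIV. pbf M S (cst K b c d) * eps S c * eps S d)))"
    using brst unfolding brst_transformation_def by (elim conjE)
  from this[rule_format, of a]
  have 1: "s0 S (E a) = - (\<Sum>b\<in>UNIV. \<Sum>\<mu>\<in>UNIV. etai K a b *\<^sub>R (p (rho K b \<mu>) * psit S \<mu>))
      - (1/2) *\<^sub>R (\<Sum>b\<in>UNIV. etai K a b *\<^sub>R con2 (\<lambda>c d. p (cst K b c d)) E E)"
    by (simp add: con2_def scaleR_add_right sum.distrib scaleR_sum_right mult.commute)
  \<comment> \<open>The transformation of the ghost raises the first index of the structure
    functions, \<open>cst_up\<close> the last; cyclic symmetry relates them.\<close>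
  have cu: "p (cst_up K a c d) = (\<Sum>b\<in>UNIV. etai K a b *\<^sub>R p (cst K b c d))" for c d
  proof -
    have "p (cst_up K a c d) = p (\<lambda>x. \<Sum>b\<in>UNIV. etai K a b * cst K b c d x)"
      by (rule p_cong[OF smooth_cst_up]) (simp add: cst_up_def cst_cyclic[of _ _ c d])
    then show ?thesis by (simp add: p_sum p_scale smooth_all)
  qed
  have "(\<Sum>b\<in>UNIV. etai K a b *\<^sub>R con2 (\<lambda>c d. p (cst K b c d)) E E) = CU E E a"
  proof -
    have "(\<Sum>b\<in>UNIV. etai K a b *\<^sub>R con2 (\<lambda>c d. p (cst K b c d)) E E) =
        (\<Sum>b\<in>UNIV. \<Sum>c\<in>UNIV. \<Sum>d\<in>UNIV. etai K a b *\<^sub>R p (cst K b c d) * E c * E d)"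
      by (simp add: con2_def scaleR_sum_right)
    also have "\<dots> = (\<Sum>c\<in>UNIV. \<Sum>d\<in>UNIV. \<Sum>b\<in>UNIV. etai K a b *\<^sub>R p (cst K b c d) * E c * E d)"
      by (rule trans[OF sum.swap], rule sum.cong[OF refl], rule sum.swap)
    finally show ?thesis
      by (simp only: CU_def con2_def cu sum_distrib_right)
  qed
  with 1 show ?thesis by (simp only: up_eq)
qed

lemma eqG_eq: "eqG K M S a = dd S (A a) + up (Bf M S) a + (1/2) *\<^sub>R CU A A a"
  by (simp only: eqG_def up_eq CU_def con2_def)

lemma sum_dR: "(\<Sum>a\<in>UNIV. \<Sum>\<nu>\<in>UNIV. p (pdiff \<mu> (rho K a \<nu>)) * (V \<nu> * u a)) = (\<Sum>\<nu>\<in>UNIV. V \<nu> * dR \<mu> \<nu> u)"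
  unfolding dR_def con1_def sum_distrib_left
  by (subst sum.swap) (simp add: central_left_commute[OF p_central[OF smooth_fun_pdiff[OF smooth_rho]]])

lemma sum_con2_times: "(\<Sum>a\<in>UNIV. \<Sum>b\<in>UNIV. \<Sum>\<nu>\<in>UNIV. f \<nu> a b * u a * v b * (V \<nu> :: 'w)) = (\<Sum>\<nu>\<in>UNIV. con2 (f \<nu>) u v * V \<nu>)"
proof -
  have "(\<Sum>a\<in>UNIV. \<Sum>b\<in>UNIV. \<Sum>\<nu>\<in>UNIV. f \<nu> a b * u a * v b * V \<nu>) =
      (\<Sum>a\<in>UNIV. \<Sum>\<nu>\<in>UNIV. \<Sum>b\<in>UNIV. f \<nu> a b * u a * v b * V \<nu>)"
    by (intro sum.cong refl, rule sum.swap)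
  also have "\<dots> = (\<Sum>\<nu>\<in>UNIV. \<Sum>a\<in>UNIV. \<Sum>b\<in>UNIV. f \<nu> a b * u a * v b * V \<nu>)"
    by (rule sum.swap)
  finally show ?thesis by (simp add: con2_def sum_distrib_right)
qed

lemma s0_psit: "s0 S (psit S \<mu>) = - (\<Sum>\<nu>\<in>UNIV. psit S \<nu> * dR \<mu> \<nu> E) - (1/6) *\<^sub>R CH \<mu> E E E"
proof -
  have "\<forall>\<mu>. s0 S (psit S \<mu>) =
        - (\<Sum>a\<in>UNIV. \<Sum>\<nu>\<in>UNIV. pbf M S (pdiff \<mu> (rho K a \<nu>)) * psit S \<nu> * eps S a)
        - (1/6) *\<^sub>R (\<Sum>a\<in>UNIV. \<Sum>b\<in>UNIV. \<Sum>c\<in>UNIV.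
             pbf M S (\<lambda>x. pdiff \<mu> (cst K a b c) x + hfl3 K \<mu> a b c x) * eps S a * eps S b * eps S c)"
    using brst unfolding brst_transformation_def by (elim conjE)
  from this[rule_format, of \<mu>] show ?thesis
    by (simp only: CH_def con3_def sum_dR[symmetric] mult.assoc)
qed

lemma s0_psi: "s0 S (psi S \<mu>) = dd S (psit S \<mu>) + (\<Sum>\<nu>\<in>UNIV. psit S \<nu> * dR \<mu> \<nu> A) + (\<Sum>\<nu>\<in>UNIV. psi S \<nu> * dR \<mu> \<nu> E)
    + (1/2) *\<^sub>R CH \<mu> A E E + (1/4) *\<^sub>R (\<Sum>\<nu>\<in>UNIV. H2 \<mu> \<nu> E E * F \<nu>)"
proof -
  have "\<forall>\<mu>. s0 S (psi S \<mu>) = dd S (psit S \<mu>)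
        + (\<Sum>a\<in>UNIV. \<Sum>\<nu>\<in>UNIV. pbf M S (pdiff \<mu> (rho K a \<nu>)) *
             (psit S \<nu> * Af M S a + psi S \<nu> * eps S a))
        + (1/2) *\<^sub>R (\<Sum>a\<in>UNIV. \<Sum>b\<in>UNIV. \<Sum>c\<in>UNIV.
             pbf M S (\<lambda>x. pdiff \<mu> (cst K a b c) x + hfl3 K \<mu> a b c x) * Af M S a * eps S b * eps S c)
        + (1/4) *\<^sub>R (\<Sum>a\<in>UNIV. \<Sum>b\<in>UNIV. \<Sum>\<nu>\<in>UNIV.
             pbf M S (hfl2 K \<mu> \<nu> a b) * eps S a * eps S b * eqF K M S \<nu>)"
    using brst unfolding brst_transformation_def by (elim conjE)
  from this[rule_format, of \<mu>] show ?thesis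
    by (simp only: CH_def con3_def sum_dR[symmetric] distrib_left sum.distrib H2_def sum_con2_times add.assoc)
qed

lemma s0_Bf: "s0 S (Bf M S \<mu>) = - dd S (psi S \<mu>) - (\<Sum>\<nu>\<in>UNIV. Bf M S \<nu> * dR \<mu> \<nu> E) + (\<Sum>\<nu>\<in>UNIV. psi S \<nu> * dR \<mu> \<nu> A)
    - (1/2) *\<^sub>R CH \<mu> A A E - (1/2) *\<^sub>R (\<Sum>\<nu>\<in>UNIV. H2 \<mu> \<nu> E A * F \<nu>)
    - (1/6) *\<^sub>R (\<Sum>a\<in>UNIV. \<Sum>\<nu>\<in>UNIV. \<Sum>\<tau>\<in>UNIV. p (hfl1 K \<mu> \<nu> \<tau> a) * E a * F \<nu> * F \<tau>)"
proof -
  have "\<forall>\<mu>. s0 S (Bf M S \<mu>) = - dd S (psi S \<mu>)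
        - (\<Sum>a\<in>UNIV. \<Sum>\<nu>\<in>UNIV. pbf M S (pdiff \<mu> (rho K a \<nu>)) *
             (Bf M S \<nu> * eps S a - psi S \<nu> * Af M S a))
        - (1/2) *\<^sub>R (\<Sum>a\<in>UNIV. \<Sum>b\<in>UNIV. \<Sum>c\<in>UNIV.
             pbf M S (\<lambda>x. pdiff \<mu> (cst K a b c) x + hfl3 K \<mu> a b c x) * Af M S a * Af M S b * eps S c)
        - (1/2) *\<^sub>R (\<Sum>a\<in>UNIV. \<Sum>b\<in>UNIV. \<Sum>\<nu>\<in>UNIV.
             pbf M S (hfl2 K \<mu> \<nu> a b) * eps S a * Af M S b * eqF K M S \<nu>)
        - (1/6) *\<^sub>R (\<Sum>a\<in>UNIV. \<Sum>\<nu>\<in>UNIV. \<Sum>\<tau>\<in>UNIV.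
             pbf M S (hfl1 K \<mu> \<nu> \<tau> a) * eps S a * eqF K M S \<nu> * eqF K M S \<tau>)"
    using brst unfolding brst_transformation_def by (elim conjE)
  from this[rule_format, of \<mu>] show ?thesis
    by (simp only: CH_def con3_def sum_dR[symmetric] right_diff_distrib sum_subtractf H2_def sum_con2_times
        diff_diff_eq2 diff_add_eq[symmetric])
qed

text \<open>The terms of \<open>KK\<close> have different sources: those with \<open>dR\<close> and
  with \<open>R\<close> after \<open>Om\<close> come from replacing the ghost by its covariant
  version, the one with \<open>dW\<close> from the Leibniz rule on omega, and the one with
  \<open>C3\<close> from the bracket in the variation of \<open>E\<close>.\<close>

lemma s0_psit_nab: "s0 S (tn \<mu>) = - (\<Sum>\<nu>\<in>UNIV. tn \<nu> * dR \<mu> \<nu> E) + (\<Sum>\<nu>\<in>UNIV. tn \<nu> * R \<nu> (Om \<mu> E))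
    - (1/6) *\<^sub>R CH \<mu> E E E + (1/2) *\<^sub>R KK \<mu> E E E"
proof -
  have psit: "psit S \<nu> = tn \<nu> - (1/2) *\<^sub>R W \<nu> E E" for \<nu>
    by (simp add: tn_eq)
  have c1: "W \<nu> E E * dR \<mu> \<nu> E = dR \<mu> \<nu> E * W \<nu> E E" for \<nu>
    using bigr_commute[OF W_EE dR_E] by simp
  have c2: "W \<nu> E E * R \<nu> (Om \<mu> E) = R \<nu> (Om \<mu> E) * W \<nu> E E" for \<nu>
    using bigr_commute[OF W_EE R_Om_E] by simp
  have c3: "R \<nu> (Om \<mu> E) * psit S \<nu> = psit S \<nu> * R \<nu> (Om \<mu> E)" for \<nu>
    using bigr_commute[OF psit_bigr R_Om_E] by simp
  have C: "C3 E E (Om \<mu> E) = C3 (Om \<mu> E) E E"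
    using C3_rotate[OF scomm_Om_right scomm_Om_right, OF scomm_fields(2) scomm_fields(2), of \<mu>] by simp
  have "s0 S (tn \<mu>) = s0 S (psit S \<mu>) + (1/2) *\<^sub>R ((\<Sum>\<nu>\<in>UNIV. R \<nu> E * dW \<nu> \<mu> E E)
      + W \<mu> (\<lambda>a. s0 S (E a)) E - W \<mu> E (\<lambda>a. s0 S (E a)))"
    unfolding tn_eq linear_add[OF s0_linear] linear_scale[OF s0_linear] s0_W[of E, OF eps_bigr] s0_Xf by simp
  also have "W \<mu> (\<lambda>a. s0 S (E a)) E = (\<Sum>\<nu>\<in>UNIV. psit S \<nu> * R \<nu> (Om \<mu> E)) + (1/2) *\<^sub>R C3 (Om \<mu> E) E E"
    unfolding s0_eps W_linear W_up_left W_CU_left C by simp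
  also have "W \<mu> E (\<lambda>a. s0 S (E a)) = - (\<Sum>\<nu>\<in>UNIV. psit S \<nu> * R \<nu> (Om \<mu> E)) - (1/2) *\<^sub>R C3 (Om \<mu> E) E E"
    unfolding s0_eps W_linear W_up_right W_CU_right c3 by simp
  finally have "s0 S (tn \<mu>) = - (\<Sum>\<nu>\<in>UNIV. psit S \<nu> * dR \<mu> \<nu> E) - (1/6) *\<^sub>R CH \<mu> E E E
      + (1/2) *\<^sub>R (\<Sum>\<nu>\<in>UNIV. R \<nu> E * dW \<nu> \<mu> E E) + (\<Sum>\<nu>\<in>UNIV. psit S \<nu> * R \<nu> (Om \<mu> E)) + (1/2) *\<^sub>R C3 (Om \<mu> E) E E"
    unfolding s0_psit by (rule trans) (rule eq_if_double_eq, simp add: scaleR_2 algebra_simps half_add_half)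
  also have "(\<Sum>\<nu>\<in>UNIV. psit S \<nu> * dR \<mu> \<nu> E) = (\<Sum>\<nu>\<in>UNIV. tn \<nu> * dR \<mu> \<nu> E) - (1/2) *\<^sub>R (\<Sum>\<nu>\<in>UNIV. dR \<mu> \<nu> E * W \<nu> E E)"
    unfolding psit by (simp add: left_diff_distrib sum_subtractf c1 scaleR_sum_right)
  also have "(\<Sum>\<nu>\<in>UNIV. psit S \<nu> * R \<nu> (Om \<mu> E)) =
      (\<Sum>\<nu>\<in>UNIV. tn \<nu> * R \<nu> (Om \<mu> E)) - (1/2) *\<^sub>R (\<Sum>\<nu>\<in>UNIV. R \<nu> (Om \<mu> E) * W \<nu> E E)"
    unfolding psit by (simp add: left_diff_distrib sum_subtractf c2 scaleR_sum_right)
  finally show ?thesis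
    unfolding KK_def by (rule trans) (rule eq_if_double_eq, simp add: scaleR_2 algebra_simps)
qed

text \<open>Since s_0 X is rho epsilon and never rho A, \<open>KK \<mu> A E E\<close> arises without
  its \<open>dW\<close> term. Completing it leaves the explicit \<open>dW\<close> term on the right,
  which \<open>dd_psit_nab\<close> provides, just as it provides
  \<open>W \<mu> dE E\<close>.\<close>

lemma s0_psi_nab: "s0 S (pn \<mu>) = dd S (psit S \<mu>)
    + (\<Sum>\<nu>\<in>UNIV. tn \<nu> * dR \<mu> \<nu> A) - (\<Sum>\<nu>\<in>UNIV. tn \<nu> * R \<nu> (Om \<mu> A))
    + (\<Sum>\<nu>\<in>UNIV. pn \<nu> * dR \<mu> \<nu> E) - (\<Sum>\<nu>\<in>UNIV. pn \<nu> * R \<nu> (Om \<mu> E))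
    + TS \<mu> A E E + (1/2) *\<^sub>R (\<Sum>\<nu>\<in>UNIV. R \<nu> A * dW \<nu> \<mu> E E) + W \<mu> dE E
    + (1/4) *\<^sub>R (\<Sum>\<nu>\<in>UNIV. H2 \<mu> \<nu> E E * F \<nu>)"
proof -
  have psit: "psit S \<nu> = tn \<nu> - (1/2) *\<^sub>R W \<nu> E E" and psi: "psi S \<nu> = pn \<nu> - W \<nu> A E" for \<nu>
    by (simp_all add: tn_eq pn_eq)
  have c1: "W \<nu> E E * dR \<mu> \<nu> A = dR \<mu> \<nu> A * W \<nu> E E" for \<nu>
    using bigr_commute[OF W_EE dR_A] by simp
  have c2: "W \<nu> E E * R \<nu> (Om \<mu> A) = R \<nu> (Om \<mu> A) * W \<nu> E E" for \<nu>
    using bigr_commute[OF W_EE R_Om_A] by simp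
  have c3: "R \<nu> (Om \<mu> A) * psit S \<nu> = psit S \<nu> * R \<nu> (Om \<mu> A)" for \<nu>
    using bigr_commute[OF psit_bigr R_Om_A] by simp
  have c4: "W \<nu> A E * dR \<mu> \<nu> E = - (dR \<mu> \<nu> E * W \<nu> A E)" for \<nu>
    using bigr_commute[OF W_AE dR_E] by simp
  have c5: "W \<nu> A E * R \<nu> (Om \<mu> E) = - (R \<nu> (Om \<mu> E) * W \<nu> A E)" for \<nu>
    using bigr_commute[OF W_AE R_Om_E] by simp
  have C: "C3 A E (Om \<mu> E) = - C3 (Om \<mu> E) A E"
    using C3_rotate[OF scomm_Om_right scomm_Om_right, OF scomm_fields(3) scomm_fields(2), of \<mu>] by simp
  have "s0 S (pn \<mu>) = s0 S (psi S \<mu>) + ((\<Sum>\<nu>\<in>UNIV. R \<nu> E * dW \<nu> \<mu> A E)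
      + W \<mu> (\<lambda>a. s0 S (A a)) E + W \<mu> A (\<lambda>a. s0 S (E a)))"
    unfolding pn_eq linear_add[OF s0_linear] s0_W[of A, OF Af_bigr] s0_Xf by simp
  also have "W \<mu> (\<lambda>a. s0 S (A a)) E = W \<mu> dE E - (\<Sum>\<nu>\<in>UNIV. psi S \<nu> * R \<nu> (Om \<mu> E)) + C3 (Om \<mu> E) A E"
    unfolding s0_Af W_linear W_up_left W_CU_left C by simp
  also have "W \<mu> A (\<lambda>a. s0 S (E a)) = - (\<Sum>\<nu>\<in>UNIV. psit S \<nu> * R \<nu> (Om \<mu> A)) - (1/2) *\<^sub>R C3 (Om \<mu> A) E E"
    unfolding s0_eps W_linear W_up_right W_CU_right c3 by simp
  also note s0_psi
  also have "(\<Sum>\<nu>\<in>UNIV. psit S \<nu> * dR \<mu> \<nu> A) = (\<Sum>\<nu>\<in>UNIV. tn \<nu> * dR \<mu> \<nu> A) - (1/2) *\<^sub>R (\<Sum>\<nu>\<in>UNIV. dR \<mu> \<nu> A * W \<nu> E E)"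
    unfolding psit by (simp add: left_diff_distrib sum_subtractf c1 scaleR_sum_right)
  also have "(\<Sum>\<nu>\<in>UNIV. psit S \<nu> * R \<nu> (Om \<mu> A)) =
      (\<Sum>\<nu>\<in>UNIV. tn \<nu> * R \<nu> (Om \<mu> A)) - (1/2) *\<^sub>R (\<Sum>\<nu>\<in>UNIV. R \<nu> (Om \<mu> A) * W \<nu> E E)"
    unfolding psit by (simp add: left_diff_distrib sum_subtractf c2 scaleR_sum_right)
  also have "(\<Sum>\<nu>\<in>UNIV. psi S \<nu> * dR \<mu> \<nu> E) = (\<Sum>\<nu>\<in>UNIV. pn \<nu> * dR \<mu> \<nu> E) + (\<Sum>\<nu>\<in>UNIV. dR \<mu> \<nu> E * W \<nu> A E)"
    unfolding psi by (simp add: left_diff_distrib sum_subtractf c4 sum.distrib)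
  also have "(\<Sum>\<nu>\<in>UNIV. psi S \<nu> * R \<nu> (Om \<mu> E)) =
      (\<Sum>\<nu>\<in>UNIV. pn \<nu> * R \<nu> (Om \<mu> E)) + (\<Sum>\<nu>\<in>UNIV. R \<nu> (Om \<mu> E) * W \<nu> A E)"
    unfolding psi by (simp add: left_diff_distrib sum_subtractf c5 sum.distrib)
  finally show ?thesis
    unfolding TS_eq_KK(2)[OF scomm_fields(1-4)] KK_def
    by (rule trans) (rule eq_if_double_eq, simp add: scaleR_2 algebra_simps)
qed

lemma dd_psit_nab: "dd S (tn \<mu>) = dd S (psit S \<mu>) + (1/2) *\<^sub>R (\<Sum>\<nu>\<in>UNIV. F \<nu> * dW \<nu> \<mu> E E)
    + (1/2) *\<^sub>R (\<Sum>\<nu>\<in>UNIV. R \<nu> A * dW \<nu> \<mu> E E) + W \<mu> dE E"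
proof -
  have w: "W \<mu> E dE = W \<mu> dE E"
    using W_swap[OF scomm_fields(6), of \<mu>] by simp
  show ?thesis
    unfolding tn_eq linear_add[OF dd_linear] linear_scale[OF dd_linear] dd_W[of E, OF eps_bigr] dd_Xf
    by (rule eq_if_double_eq) (simp add: scaleR_2 algebra_simps sum.distrib w)
qed

lemma dd_psi_nab: "dd S (pn \<mu>) = dd S (psi S \<mu>) + (\<Sum>\<nu>\<in>UNIV. F \<nu> * dW \<nu> \<mu> A E)
    + (\<Sum>\<nu>\<in>UNIV. R \<nu> A * dW \<nu> \<mu> A E) + W \<mu> dA E - W \<mu> dE A"
proof -
  have "W \<mu> A dE = W \<mu> dE A"
    using W_swap[OF scomm_fields(8), of \<mu>] by simp
  then show ?thesis
    unfolding pn_eq linear_add[OF dd_linear] dd_W[of A, OF Af_bigr] dd_Xf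
    by (simp add: algebra_simps sum.distrib)
qed

text \<open>The term with \<open>eqG\<close> supplies what the variation of B^nabla lacks: omega dA
  epsilon, which occurs in d psi^nabla, the omega part of nabla rho in front of B^nabla, and the
  \<open>C3\<close> term of \<open>KK \<mu> E A A\<close>. As before, a \<open>dW\<close> term with
  \<open>R \<nu> A\<close> is left for the exterior derivative.\<close>

lemma s0_B_nab: "s0 S (Bn \<mu>) - W \<mu> (eqG K M S) E = - dd S (psi S \<mu>)
    - (\<Sum>\<nu>\<in>UNIV. Bn \<nu> * dR \<mu> \<nu> E) + (\<Sum>\<nu>\<in>UNIV. Bn \<nu> * R \<nu> (Om \<mu> E))
    + (\<Sum>\<nu>\<in>UNIV. pn \<nu> * dR \<mu> \<nu> A) - (\<Sum>\<nu>\<in>UNIV. pn \<nu> * R \<nu> (Om \<mu> A))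
    - TS \<mu> A A E - (\<Sum>\<nu>\<in>UNIV. R \<nu> A * dW \<nu> \<mu> A E) + W \<mu> dE A - W \<mu> dA E
    - (1/2) *\<^sub>R (\<Sum>\<nu>\<in>UNIV. H2 \<mu> \<nu> E A * F \<nu>)
    - (1/6) *\<^sub>R (\<Sum>a\<in>UNIV. \<Sum>\<nu>\<in>UNIV. \<Sum>\<tau>\<in>UNIV. p (hfl1 K \<mu> \<nu> \<tau> a) * E a * F \<nu> * F \<tau>)"
proof -
  have B: "Bf M S \<nu> = Bn \<nu> - (1/2) *\<^sub>R W \<nu> A A" and psi: "psi S \<nu> = pn \<nu> - W \<nu> A E" for \<nu>
    by (simp_all add: Bn_eq pn_eq)
  have c1: "W \<nu> A A * dR \<mu> \<nu> E = dR \<mu> \<nu> E * W \<nu> A A" for \<nu>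
    using bigr_commute[OF W_AA dR_E] by simp
  have c2: "W \<nu> A A * R \<nu> (Om \<mu> E) = R \<nu> (Om \<mu> E) * W \<nu> A A" for \<nu>
    using bigr_commute[OF W_AA R_Om_E] by simp
  have c4: "W \<nu> A E * dR \<mu> \<nu> A = - (dR \<mu> \<nu> A * W \<nu> A E)" for \<nu>
    using bigr_commute[OF W_AE dR_A] by simp
  have c5: "W \<nu> A E * R \<nu> (Om \<mu> A) = - (R \<nu> (Om \<mu> A) * W \<nu> A E)" for \<nu>
    using bigr_commute[OF W_AE R_Om_A] by simp
  have C: "C3 A E (Om \<mu> A) = - C3 (Om \<mu> A) A E" "C3 A A (Om \<mu> E) = C3 (Om \<mu> E) A A"
    using C3_rotate[OF scomm_Om_right scomm_Om_right, OF scomm_fields(1) scomm_fields(4), of \<mu>]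
      C3_rotate[OF scomm_Om_right scomm_Om_right, OF scomm_fields(3) scomm_fields(3), of \<mu>] by simp_all
  have w: "W \<mu> A (\<lambda>a. s0 S (A a)) = W \<mu> (\<lambda>a. s0 S (A a)) A"
    using W_swap[OF scomm_fields(9), of \<mu>] by simp
  have "s0 S (Bn \<mu>) = s0 S (Bf M S \<mu>) + (1/2) *\<^sub>R (\<Sum>\<nu>\<in>UNIV. R \<nu> E * dW \<nu> \<mu> A A) + W \<mu> (\<lambda>a. s0 S (A a)) A"
    unfolding Bn_eq linear_add[OF s0_linear] linear_scale[OF s0_linear] s0_W[of A, OF Af_bigr] s0_Xf w
    by (rule eq_if_double_eq) (simp add: scaleR_2 algebra_simps)
  also have "W \<mu> (\<lambda>a. s0 S (A a)) A = W \<mu> dE A - (\<Sum>\<nu>\<in>UNIV. psi S \<nu> * R \<nu> (Om \<mu> A)) + C3 (Om \<mu> A) A E"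
    unfolding s0_Af W_linear W_up_left W_CU_left C by simp
  also note s0_Bf
  finally have s0B: "s0 S (Bn \<mu>) = - dd S (psi S \<mu>) - (\<Sum>\<nu>\<in>UNIV. Bf M S \<nu> * dR \<mu> \<nu> E) + (\<Sum>\<nu>\<in>UNIV. psi S \<nu> * dR \<mu> \<nu> A)
    - (1/2) *\<^sub>R CH \<mu> A A E - (1/2) *\<^sub>R (\<Sum>\<nu>\<in>UNIV. H2 \<mu> \<nu> E A * F \<nu>)
    - (1/6) *\<^sub>R (\<Sum>a\<in>UNIV. \<Sum>\<nu>\<in>UNIV. \<Sum>\<tau>\<in>UNIV. p (hfl1 K \<mu> \<nu> \<tau> a) * E a * F \<nu> * F \<tau>)
    + (1/2) *\<^sub>R (\<Sum>\<nu>\<in>UNIV. R \<nu> E * dW \<nu> \<mu> A A)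
    + (W \<mu> dE A - (\<Sum>\<nu>\<in>UNIV. psi S \<nu> * R \<nu> (Om \<mu> A)) + C3 (Om \<mu> A) A E)" .
  have WG: "W \<mu> (eqG K M S) E = W \<mu> dA E - (\<Sum>\<nu>\<in>UNIV. Bf M S \<nu> * R \<nu> (Om \<mu> E)) - (1/2) *\<^sub>R C3 (Om \<mu> E) A A"
  proof -
    have "eqG K M S = (\<lambda>a. dd S (A a) + up (Bf M S) a + (1/2) *\<^sub>R CU A A a)"
      by (intro ext eqG_eq)
    then show ?thesis
      by (simp only: W_linear W_up_left W_CU_left C) simp
  qed
  have e1: "(\<Sum>\<nu>\<in>UNIV. Bf M S \<nu> * dR \<mu> \<nu> E) = (\<Sum>\<nu>\<in>UNIV. Bn \<nu> * dR \<mu> \<nu> E) - (1/2) *\<^sub>R (\<Sum>\<nu>\<in>UNIV. dR \<mu> \<nu> E * W \<nu> A A)"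
    unfolding B by (simp add: left_diff_distrib sum_subtractf c1 scaleR_sum_right)
  have e2: "(\<Sum>\<nu>\<in>UNIV. Bf M S \<nu> * R \<nu> (Om \<mu> E)) =
      (\<Sum>\<nu>\<in>UNIV. Bn \<nu> * R \<nu> (Om \<mu> E)) - (1/2) *\<^sub>R (\<Sum>\<nu>\<in>UNIV. R \<nu> (Om \<mu> E) * W \<nu> A A)"
    unfolding B by (simp add: left_diff_distrib sum_subtractf c2 scaleR_sum_right)
  have e3: "(\<Sum>\<nu>\<in>UNIV. psi S \<nu> * dR \<mu> \<nu> A) = (\<Sum>\<nu>\<in>UNIV. pn \<nu> * dR \<mu> \<nu> A) + (\<Sum>\<nu>\<in>UNIV. dR \<mu> \<nu> A * W \<nu> A E)"
    unfolding psi by (simp add: left_diff_distrib sum_subtractf c4 sum.distrib)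
  have e4: "(\<Sum>\<nu>\<in>UNIV. psi S \<nu> * R \<nu> (Om \<mu> A)) =
      (\<Sum>\<nu>\<in>UNIV. pn \<nu> * R \<nu> (Om \<mu> A)) + (\<Sum>\<nu>\<in>UNIV. R \<nu> (Om \<mu> A) * W \<nu> A E)"
    unfolding psi by (simp add: left_diff_distrib sum_subtractf c5 sum.distrib)
  show ?thesis
    unfolding s0B WG e1 e2 e3 e4 TS_eq_KK(3)[OF scomm_fields(1-4)] KK_def
    by (rule eq_if_double_eq) (simp add: scaleR_2 algebra_simps)
qed


section \<open>Comparison of the BRST side with the contractions, component by component\<close>

lemma torsionless_eq: "torsionless N = N"
  by (rule torsionless_id) (intro ext torsion_free)

lemma F_bigr: "F \<mu> \<in> bigr S (0, 1)"
  unfolding eqF_def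
  by (intro subspace_diff bigr_subspace dX_bigr R_A[unfolded R_def con1_def])

lemma gam_left_commute: "w * (p (gam N \<nu> \<mu> \<sigma>) * z) = p (gam N \<nu> \<mu> \<sigma>) * (w * z)"
  by (rule central_left_commute[OF p_central[OF smooth_gam]])

lemma tn_bigr: "tn \<mu> \<in> bigr S (2, 0)"
  unfolding tn_eq by (intro subspace_add subspace_scale bigr_subspace psit_bigr W_EE)

lemma Bn_bigr: "Bn \<mu> \<in> bigr S (0, 2)"
  unfolding Bn_eq by (intro subspace_add subspace_scale bigr_subspace Bf_bigr W_AA)

lemma sum_omg: "(\<Sum>\<mu>\<in>UNIV. \<Sum>b\<in>UNIV. p (omg N \<mu> b a) * V \<mu> * u b) = (\<Sum>\<mu>\<in>UNIV. V \<mu> * Om \<mu> u a)"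
  unfolding Om_def con1_def sum_distrib_left
  by (simp add: central_left_commute[OF p_central[OF smooth_omg]] mult.assoc)

definition curvF where "curvF \<mu> \<nu> u v = con2 (\<lambda>a b. p (curv_low K N a b \<mu> \<nu>)) u v"

lemma con2_omega_sq: "con2 (\<lambda>a b. p (omega_sq K N \<mu> \<nu> a b)) u v = dW \<nu> \<mu> u v - (1/2) *\<^sub>R curvF \<mu> \<nu> u v"
proof -
  have "p (omega_sq K N \<mu> \<nu> a b) = p (pdiff \<nu> (om_low K N \<mu> a b)) - (1/2) *\<^sub>R p (curv_low K N a b \<mu> \<nu>)" for a b
  proof -
    have "p (omega_sq K N \<mu> \<nu> a b) = p (\<lambda>x. pdiff \<nu> (om_low K N \<mu> a b) x - 1/2 * curv_low K N a b \<mu> \<nu> x)"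
      by (rule p_cong[OF smooth_omega_sq omega_sq_eq])
    also have "\<dots> = p (pdiff \<nu> (om_low K N \<mu> a b)) - (1/2) *\<^sub>R p (curv_low K N a b \<mu> \<nu>)"
      by (subst p_diff p_scale, (intro smooth_all)+)+ (rule refl)
    finally show ?thesis .
  qed
  then show ?thesis
    by (simp only: con2_linear_coeff dW_def curvF_def)
qed

lemma sum_omega_sq:
  "(\<Sum>\<nu>\<in>UNIV. \<Sum>a\<in>UNIV. \<Sum>b\<in>UNIV. p (omega_sq K N \<mu> \<nu> a b) * V \<nu> * u a * v b) =
    (\<Sum>\<nu>\<in>UNIV. V \<nu> * (dW \<nu> \<mu> u v - (1/2) *\<^sub>R curvF \<mu> \<nu> u v))"
  unfolding con2_omega_sq[symmetric] con2_def sum_distrib_left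
  by (simp add: central_left_commute[OF p_central[OF smooth_omega_sq]] mult.assoc)

lemma sum_striv_coeff:
  "(\<Sum>a\<in>UNIV. \<Sum>b\<in>UNIV. \<Sum>\<nu>\<in>UNIV.
      p (\<lambda>x. hfl2 K \<mu> \<nu> a b x - curv_low K N a b \<mu> \<nu> x) * u a * v b * F \<nu>) =
    (\<Sum>\<nu>\<in>UNIV. (H2 \<mu> \<nu> u v - curvF \<mu> \<nu> u v) * F \<nu>)"
  unfolding sum_con2_times H2_def curvF_def con2_linear_coeff[symmetric]
  by (simp add: p_diff smooth_hfl2 smooth_curv_low)

lemma curvF_bigr: "(\<And>a. u a \<in> bigr S (g, k)) \<Longrightarrow> (\<And>a. v a \<in> bigr S (g', k')) \<Longrightarrow>
    curvF \<mu> \<nu> u v \<in> bigr S (g + g', k + k')"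
  unfolding curvF_def by (intro con2_bigr smooth_curv_low)

text \<open>Both \<open>omega_sq\<close> and the derivative of omega are antisymmetric in
  \<open>a\<close> and \<open>b\<close>, so \<open>omega_sq_eq\<close> yields the same for the
  curvature.\<close>

lemma curv_low_antisym:
  assumes "x \<in> U"
  shows "curv_low K N a b \<mu> \<nu> x = - curv_low K N b a \<mu> \<nu> x"
proof -
  have *: "(\<Sum>d\<in>UNIV. omg N \<mu> a d x * om_low K N \<nu> b d x) = (\<Sum>d\<in>UNIV. omg N \<nu> b d x * om_low K N \<mu> a d x)" for \<mu> \<nu> a b
    unfolding om_low_def sum_distrib_left
    by (subst sum.swap) (simp add: mult_ac eta_symmetric)
  show ?thesis
    using omega_sq_eq[OF assms, of \<mu> \<nu> a b] omega_sq_eq[OF assms, of \<mu> \<nu> b a]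
      pdiff_om_low_antisym[OF assms, of \<mu> \<nu> a b] pdiff_om_low_antisym[OF assms, of \<nu> \<mu> a b]
      *[of \<mu> a \<nu> b] *[of \<mu> b \<nu> a]
    by (simp add: omega_sq_def sum_subtractf field_simps)
qed

lemma curvF_swap:
  assumes "scomm s u v"
  shows "curvF \<mu> \<nu> u v = - s *\<^sub>R curvF \<mu> \<nu> v u"
proof -
  have "p (curv_low K N a b \<mu> \<nu>) = - p (curv_low K N b a \<mu> \<nu>)" for a b
    by (intro p_antisym smooth_curv_low curv_low_antisym)
  then have "curvF \<mu> \<nu> u v = con2 (\<lambda>a b. - p (curv_low K N b a \<mu> \<nu>)) u v"
    unfolding curvF_def by (intro arg_cong[of _ _ "\<lambda>f. con2 f u v"] ext)
  then show ?thesis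
    unfolding con2_linear_coeff con2_swap[OF assms, of "\<lambda>a b. p (curv_low K N a b \<mu> \<nu>)"] curvF_def by simp
qed

lemma CU_swap:
  assumes "scomm s u v"
  shows "CU u v a = - s *\<^sub>R CU v u a"
proof -
  have "cst_up K a b c x = - cst_up K a c b x" if "x \<in> U" for b c x
    unfolding cst_up_def sum_negf[symmetric]
    by (intro sum.cong refl) (simp add: cst_antisym(1)[OF that, of b c])
  then have "p (cst_up K a b c) = - p (cst_up K a c b)" for b c
    by (intro p_antisym smooth_cst_up)
  then have "CU u v a = con2 (\<lambda>b c. - p (cst_up K a c b)) u v"
    unfolding CU_def by (intro arg_cong[of _ _ "\<lambda>f. con2 f u v"] ext)
  then show ?thesis
    unfolding con2_linear_coeff con2_swap[OF assms, of "\<lambda>b c. p (cst_up K a b c)"] CU_def by simp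
qed

text \<open>For the variation of \<open>A\<close>, the first connection term is the tensorial
  correction of \<open>s0\<close>, the second removes the rho A part of the connection term in the
  covariant derivative of epsilon, and the third accounts for the difference between psi^nabla and
  psi. For epsilon, the first two coincide and the third relates psit^nabla to psit.\<close>

lemma torsion_con:
  assumes "scomm s u v"
  shows "2 *\<^sub>R con2 (\<lambda>b c. p (gualtieri_torsion_up K N b c a)) u v =
    (\<Sum>\<mu>\<in>UNIV. R \<mu> u * Om \<mu> v a) - s *\<^sub>R (\<Sum>\<mu>\<in>UNIV. R \<mu> v * Om \<mu> u a)
    + (\<Sum>\<mu>\<in>UNIV. p (rho_up \<mu> a) * W \<mu> u v) - CU u v a"
proof -
  have T: "2 *\<^sub>R p (gualtieri_torsion_up K N b c a) = p (omE K N a b c) - p (omE K N a c b)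
      + (\<Sum>\<mu>\<in>UNIV. p (om_low K N \<mu> b c) * p (rho_up \<mu> a)) - p (cst_up K a b c)" for b c
  proof -
    have "2 *\<^sub>R p (gualtieri_torsion_up K N b c a) = p (\<lambda>x. 2 * gualtieri_torsion_up K N b c a x)"
      by (simp add: p_scale smooth_torsion_up)
    also have "\<dots> = p (\<lambda>x. omE K N a b c x - omE K N a c b x
        + (\<Sum>\<mu>\<in>UNIV. om_low K N \<mu> b c x * rho_up \<mu> a x) - cst_up K a b c x)"
      by (rule p_cong, intro smooth_all)
        (simp add: torsion_up_eq rho_up_def mult.commute[of "om_low K N _ b c _"])
    also have "\<dots> = p (omE K N a b c) - p (omE K N a c b)
      + (\<Sum>\<mu>\<in>UNIV. p (om_low K N \<mu> b c) * p (rho_up \<mu> a)) - p (cst_up K a b c)"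
      by (simp add: p_diff p_add p_sum p_mult smooth_all smooth_rho_up)
    finally show ?thesis .
  qed
  have om: "con2 (\<lambda>b c. p (omE K N a b c)) u v = (\<Sum>\<mu>\<in>UNIV. R \<mu> u * Om \<mu> v a)" for u v
    unfolding R_def Om_def
    by (subst con2_con1_con1) (simp_all add: p_central smooth_omg omE_def[abs_def] p_sum p_mult smooth_all)
  have "2 *\<^sub>R con2 (\<lambda>b c. p (gualtieri_torsion_up K N b c a)) u v =
      con2 (\<lambda>b c. p (omE K N a b c)) u v - con2 (\<lambda>b c. p (omE K N a c b)) u v
      + con2 (\<lambda>b c. \<Sum>\<mu>\<in>UNIV. p (om_low K N \<mu> b c) * p (rho_up \<mu> a)) u v - CU u v a"
    unfolding con2_linear_coeff[symmetric] T CU_def ..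
  also have "con2 (\<lambda>b c. p (omE K N a c b)) u v = s *\<^sub>R (\<Sum>\<mu>\<in>UNIV. R \<mu> v * Om \<mu> u a)"
    unfolding con2_swap[OF assms, of "\<lambda>b c. p (omE K N a b c)"] om ..
  also have "con2 (\<lambda>b c. \<Sum>\<mu>\<in>UNIV. p (om_low K N \<mu> b c) * p (rho_up \<mu> a)) u v =
      (\<Sum>\<mu>\<in>UNIV. p (rho_up \<mu> a) * W \<mu> u v)"
    unfolding W_def by (rule con2_sum_coeff) (simp add: p_central smooth_om_low)
  finally show ?thesis by (simp add: om)
qed

lemma field_Frame: "snab_A K N M S a = dd S (E a) + (\<Sum>\<mu>\<in>UNIV. dd S (Xf M S \<mu>) * Om \<mu> E a)
    + contr1 (pull S) D e (Q (Frame a))"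
proof -
  have w: "W \<mu> E A = - W \<mu> A E" for \<mu>
    using W_swap[OF scomm_fields(4), of \<mu>] by simp
  have c: "CU E A a = - CU A E a"
    using CU_swap[OF scomm_fields(4), of a] by simp
  show ?thesis
    unfolding snab_A_def sbar_up_def sum_omg s0_Af s0_Xf dd_Xf contr_Frame torsion_con[OF scomm_fields(4)] up_def pn_eq w c
    by (simp add: distrib_left distrib_right sum.distrib sum_negf algebra_simps)
qed

lemma ghost_Frame: "sbar_up N M S E a = - contr1 (pull S) D et (Q (Frame a))
    - (1/2) *\<^sub>R contr2 (pull S) D e e (Q (Frame a))"
proof -
  have "con2 (\<lambda>b c. p (gualtieri_torsion_up K N b c a)) E E = (\<Sum>\<mu>\<in>UNIV. R \<mu> E * Om \<mu> E a)
      + (1/2) *\<^sub>R (\<Sum>\<mu>\<in>UNIV. p (rho_up \<mu> a) * W \<mu> E E) - (1/2) *\<^sub>R CU E E a"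
    using torsion_con[OF scomm_fields(2), of a]
    by (intro eq_if_double_eq[of "con2 _ _ _"]) (simp add: scaleR_2 algebra_simps)
  then show ?thesis
    unfolding sbar_up_def sum_omg s0_eps s0_Xf contr_Frame up_def tn_eq
    by (simp add: distrib_left sum.distrib scaleR_sum_right algebra_simps)
qed

lemma field_Fibre: "snab_B K N M S \<mu> = - dd S (pn \<mu>)
    + (\<Sum>\<sigma>\<in>UNIV. \<Sum>\<nu>\<in>UNIV. p (gam N \<nu> \<sigma> \<mu>) * dd S (Xf M S \<sigma>) * pn \<nu>)
    + contr1 (pull S) D e (Q (Fibre \<mu>)) + striv_B K N M S \<mu>"
proof -
  have G1: "(\<Sum>\<nu>\<in>UNIV. \<Sum>\<sigma>\<in>UNIV. p (gam N \<nu> \<mu> \<sigma>) * s0 S (Xf M S \<sigma>) * Bn \<nu>) =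
      (\<Sum>\<nu>\<in>UNIV. Bn \<nu> * (\<Sum>\<sigma>\<in>UNIV. p (gam N \<nu> \<mu> \<sigma>) * R \<sigma> E))"
  proof -
    have "R \<sigma> E * Bn \<nu> = Bn \<nu> * R \<sigma> E" for \<sigma> \<nu>
      using bigr_commute[OF R_E Bn_bigr] by simp
    then show ?thesis by (simp add: s0_Xf sum_distrib_left gam_left_commute mult.assoc)
  qed
  have com: "F \<sigma> * pn \<nu> = - (pn \<nu> * F \<sigma>)" "R \<sigma> A * pn \<nu> = - (pn \<nu> * R \<sigma> A)" for \<sigma> \<nu>
    using bigr_commute[OF F_bigr psi_nab_bigr] bigr_commute[OF R_A psi_nab_bigr] by simp_all
  \<comment> \<open>\<open>covD\<close> contracts dX with the first lower index of Gamma,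
    \<open>snab_B\<close> contracts F with the second; the symmetry of Gamma identifies them. The F
    part of dX is the correction in \<open>snab_B\<close>, and the rho A part cancels the Gamma part
    of nabla rho in front of psi^nabla.\<close>
  have G2: "(\<Sum>\<sigma>\<in>UNIV. \<Sum>\<nu>\<in>UNIV. p (gam N \<nu> \<sigma> \<mu>) * dd S (Xf M S \<sigma>) * pn \<nu>) =
      - (\<Sum>\<nu>\<in>UNIV. \<Sum>\<sigma>\<in>UNIV. p (gam N \<nu> \<mu> \<sigma>) * pn \<nu> * F \<sigma>)
      - (\<Sum>\<nu>\<in>UNIV. pn \<nu> * (\<Sum>\<sigma>\<in>UNIV. p (gam N \<nu> \<mu> \<sigma>) * R \<sigma> A))"
    unfolding dd_Xf torsion_free[of _ _ \<mu>]
    by (subst sum.swap)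
      (simp add: sum_distrib_left gam_left_commute mult.assoc distrib_left distrib_right com
        sum.distrib sum_negf sum_subtractf)
  have WG: "(\<Sum>a\<in>UNIV. \<Sum>b\<in>UNIV. p (om_low K N \<mu> a b) * eqG K M S a * E b) = W \<mu> (eqG K M S) E"
    by (simp add: W_def con2_def)
  have tr: "striv_B K N M S \<mu> = - (1/2) *\<^sub>R (\<Sum>\<nu>\<in>UNIV. H2 \<mu> \<nu> E A * F \<nu>)
     + (1/2) *\<^sub>R (\<Sum>\<nu>\<in>UNIV. F \<nu> * curvF \<mu> \<nu> A E)
     - (1/6) *\<^sub>R (\<Sum>a\<in>UNIV. \<Sum>\<nu>\<in>UNIV. \<Sum>\<tau>\<in>UNIV. p (hfl1 K \<mu> \<nu> \<tau> a) * E a * F \<nu> * F \<tau>)"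
  proof -
    \<comment> \<open>Two signs cancel: one from exchanging \<open>E\<close> and \<open>A\<close>
      under the antisymmetric curvature, one from moving F past a 1-form.\<close>
    have c: "curvF \<mu> \<nu> E A * F \<nu> = F \<nu> * curvF \<mu> \<nu> A E" for \<nu>
      unfolding curvF_swap[OF scomm_fields(4)]
      using bigr_commute[OF F_bigr curvF_bigr[of A 0 1 E 1 0, OF Af_bigr eps_bigr], of \<nu> \<mu> \<nu>] by simp
    show ?thesis
      unfolding striv_B_def sum_striv_coeff
      by (simp add: left_diff_distrib sum_subtractf scaleR_right_diff_distrib c)
  qed
  have NR: "con1 (\<lambda>a. p (nabla_rho K N \<mu> a \<nu>)) u = NR \<mu> \<nu> u" for u \<nu>
    by (simp add: NR_def)
  have TS: "con3 (\<lambda>a b c. p (twisted_basic_curvature K N \<mu> a b c)) E A A = TS \<mu> A A E"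
    using TS_rotate[OF scomm_fields(4) scomm_fields(4), of \<mu>] by (simp add: TS_def)
  have c: "NR \<mu> \<nu> E * Bn \<nu> = Bn \<nu> * NR \<mu> \<nu> E" for \<nu>
    using bigr_commute[OF _ Bn_bigr, of "NR \<mu> \<nu> E" 1 0] con1_bigr[of "\<lambda>a. nabla_rho K N \<mu> a \<nu>" E 1 0] smooth_nabla_rho eps_bigr
    by (simp add: NR_def)
  have s: "s0 S (Bn \<mu>) = W \<mu> (eqG K M S) E - dd S (psi S \<mu>)
    - (\<Sum>\<nu>\<in>UNIV. Bn \<nu> * dR \<mu> \<nu> E) + (\<Sum>\<nu>\<in>UNIV. Bn \<nu> * R \<nu> (Om \<mu> E))
    + (\<Sum>\<nu>\<in>UNIV. pn \<nu> * dR \<mu> \<nu> A) - (\<Sum>\<nu>\<in>UNIV. pn \<nu> * R \<nu> (Om \<mu> A))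
    - TS \<mu> A A E - (\<Sum>\<nu>\<in>UNIV. R \<nu> A * dW \<nu> \<mu> A E) + W \<mu> dE A - W \<mu> dA E
    - (1/2) *\<^sub>R (\<Sum>\<nu>\<in>UNIV. H2 \<mu> \<nu> E A * F \<nu>)
    - (1/6) *\<^sub>R (\<Sum>a\<in>UNIV. \<Sum>\<nu>\<in>UNIV. \<Sum>\<tau>\<in>UNIV. p (hfl1 K \<mu> \<nu> \<tau> a) * E a * F \<nu> * F \<tau>)"
    using s0_B_nab[of \<mu>] by (simp add: algebra_simps)
  show ?thesis
    unfolding snab_B_def sbar_down_def torsionless_eq G1 G2 WG sum_omega_sq tr contr_Fibre NR TS c s dd_psi_nab
    unfolding NR_eq
    by (simp add: algebra_simps sum.distrib sum_subtractf scaleR_sum_right[symmetric])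
qed

lemma ghost_Fibre: "- snab_psi K N M S \<mu> = - dd S (tn \<mu>)
    + (\<Sum>\<sigma>\<in>UNIV. \<Sum>\<nu>\<in>UNIV. p (gam N \<nu> \<sigma> \<mu>) * dd S (Xf M S \<sigma>) * tn \<nu>)
    - contr1 (pull S) D et (Q (Fibre \<mu>)) - (1/2) *\<^sub>R contr2 (pull S) D e e (Q (Fibre \<mu>)) - striv_psi K N M S \<mu>"
proof -
  have G1: "(\<Sum>\<nu>\<in>UNIV. \<Sum>\<sigma>\<in>UNIV. p (gam N \<nu> \<mu> \<sigma>) * s0 S (Xf M S \<sigma>) * pn \<nu>) =
      - (\<Sum>\<nu>\<in>UNIV. pn \<nu> * (\<Sum>\<sigma>\<in>UNIV. p (gam N \<nu> \<mu> \<sigma>) * R \<sigma> E))"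
  proof -
    have "R \<sigma> E * pn \<nu> = - (pn \<nu> * R \<sigma> E)" for \<sigma> \<nu>
      using bigr_commute[OF R_E psi_nab_bigr] by simp
    then show ?thesis by (simp add: s0_Xf sum_distrib_left gam_left_commute mult.assoc sum_negf)
  qed
  have com: "F \<sigma> * tn \<nu> = tn \<nu> * F \<sigma>" "R \<sigma> A * tn \<nu> = tn \<nu> * R \<sigma> A" for \<sigma> \<nu>
    using bigr_commute[OF F_bigr tn_bigr] bigr_commute[OF R_A tn_bigr] by simp_all
  have G2: "(\<Sum>\<sigma>\<in>UNIV. \<Sum>\<nu>\<in>UNIV. p (gam N \<nu> \<sigma> \<mu>) * dd S (Xf M S \<sigma>) * tn \<nu>) =
      (\<Sum>\<nu>\<in>UNIV. \<Sum>\<sigma>\<in>UNIV. p (gam N \<nu> \<mu> \<sigma>) * tn \<nu> * F \<sigma>)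
      + (\<Sum>\<nu>\<in>UNIV. tn \<nu> * (\<Sum>\<sigma>\<in>UNIV. p (gam N \<nu> \<mu> \<sigma>) * R \<sigma> A))"
    unfolding dd_Xf torsion_free[of _ _ \<mu>]
    by (subst sum.swap)
      (simp add: sum_distrib_left gam_left_commute mult.assoc distrib_left distrib_right com
        sum.distrib)
  have tr: "striv_psi K N M S \<mu> = (1/4) *\<^sub>R (\<Sum>\<nu>\<in>UNIV. H2 \<mu> \<nu> E E * F \<nu>)
     - (1/4) *\<^sub>R (\<Sum>\<nu>\<in>UNIV. F \<nu> * curvF \<mu> \<nu> E E)"
  proof -
    have c: "curvF \<mu> \<nu> E E * F \<nu> = F \<nu> * curvF \<mu> \<nu> E E" for \<nu>
      using bigr_commute[OF F_bigr curvF_bigr[of E 1 0 E 1 0, OF eps_bigr eps_bigr], of \<nu> \<mu> \<nu>]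
      by (simp add: numeral_2_eq_2)
    show ?thesis
      unfolding striv_psi_def sum_striv_coeff
      by (simp add: left_diff_distrib sum_subtractf scaleR_right_diff_distrib c)
  qed
  have NR: "con1 (\<lambda>a. p (nabla_rho K N \<mu> a \<nu>)) u = NR \<mu> \<nu> u" for u \<nu>
    by (simp add: NR_def)
  have TS: "con3 (\<lambda>a b c. p (twisted_basic_curvature K N \<mu> a b c)) E E A = TS \<mu> A E E"
    using TS_rotate[OF scomm_fields(3) scomm_fields(3), of \<mu>] by (simp add: TS_def)
  show ?thesis
    unfolding snab_psi_def sbar_down_def torsionless_eq G1 G2 sum_omega_sq tr contr_Fibre NR TS s0_psi_nab dd_psit_nab
    unfolding NR_eq
    by (rule eq_if_double_eq) (simp add: scaleR_2 algebra_simps sum.distrib sum_subtractf half_add_half flip: scaleR_sum_right)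
qed

text \<open>By \<open>TS_eq_KK\<close>, 1/6 times the factor 2 in \<open>contr_Fibre\<close> gives
  1/6 of \<open>CH\<close> minus 1/2 of \<open>KK\<close>, the negatives of the coefficients in
  \<open>s0_psit_nab\<close>.\<close>

lemma ghost2_Fibre: "- sbar_down N M S (psit_nab K N M S) \<mu> =
    contr2 (pull S) D et e (Q (Fibre \<mu>)) + (1/6) *\<^sub>R contr3 (pull S) D e (Q (Fibre \<mu>))"
proof -
  have G1: "(\<Sum>\<nu>\<in>UNIV. \<Sum>\<sigma>\<in>UNIV. p (gam N \<nu> \<mu> \<sigma>) * s0 S (Xf M S \<sigma>) * tn \<nu>) =
      (\<Sum>\<nu>\<in>UNIV. tn \<nu> * (\<Sum>\<sigma>\<in>UNIV. p (gam N \<nu> \<mu> \<sigma>) * R \<sigma> E))"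
  proof -
    have "R \<sigma> E * tn \<nu> = tn \<nu> * R \<sigma> E" for \<sigma> \<nu>
      using bigr_commute[OF R_E tn_bigr] by simp
    then show ?thesis by (simp add: s0_Xf sum_distrib_left gam_left_commute mult.assoc)
  qed
  have NR: "con1 (\<lambda>a. p (nabla_rho K N \<mu> a \<nu>)) u = NR \<mu> \<nu> u" for u \<nu>
    by (simp add: NR_def)
  have TS: "con3 (\<lambda>a b c. p (twisted_basic_curvature K N \<mu> a b c)) E E E = (1/2) *\<^sub>R CH \<mu> E E E - (3/2) *\<^sub>R KK \<mu> E E E"
    unfolding TS_eq_KK(1)[OF scomm_fields(2,1,4,3), symmetric] TS_def ..
  show ?thesis
    unfolding sbar_down_def torsionless_eq G1 contr_Fibre NR TS s0_psit_nab
    unfolding NR_eq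
    by (simp add: algebra_simps sum.distrib sum_subtractf)
qed

end

section \<open>The stationary surface and the torsionless connection\<close>

text \<open>An intersection of two-sided ideals is again one.\<close>

lemma two_sided_ideal_hull: "two_sided_ideal (two_sided_ideal hull X)"
  by (rule hull_in) (auto simp: two_sided_ideal_def)

text \<open>Ideals are taken in the ring sense; a real scalar acts as multiplication by the algebra
  element \<open>of_real r\<close>.\<close>

lemma two_sided_ideal_scaleR:
  assumes "two_sided_ideal I" "x \<in> I"
  shows "r *\<^sub>R x \<in> (I :: 'w::real_algebra_1 set)"
proof -
  have "of_real r * x \<in> I"
    using assms by (simp add: two_sided_ideal_def)
  then show ?thesis by (simp add: scaleR_conv_of_real)
qed

lemma two_sided_ideal_sum:
  assumes "two_sided_ideal I" "\<And>i. i \<in> A \<Longrightarrow> f i \<in> I"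
  shows "sum f A \<in> I"
  using assms(2)
  by (induction A rule: infinite_finite_induct) (use assms(1) in \<open>auto simp: two_sided_ideal_def\<close>)

lemma vanishes_on_shell_closed:
  fixes S :: "('w::real_algebra_1, 'o::real_algebra_1, 'm::finite, 'a::finite) sigma_model"
  shows "vanishes_on_shell K M S (w * eqF K M S \<mu>)"
    and "vanishes_on_shell K M S 0"
    and "vanishes_on_shell K M S x \<Longrightarrow> vanishes_on_shell K M S y \<Longrightarrow> vanishes_on_shell K M S (x + y)"
    and "vanishes_on_shell K M S x \<Longrightarrow> vanishes_on_shell K M S (r *\<^sub>R x)"
    and "(\<And>i. i \<in> I \<Longrightarrow> vanishes_on_shell K M S (f i)) \<Longrightarrow> vanishes_on_shell K M S (sum f I)"
proof -
  define J where "J = two_sided_ideal hull (range (eqF K M S) \<union> range (eqG K M S) \<union> range (eqX K M S))"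
  have J: "two_sided_ideal J"
    unfolding J_def by (rule two_sided_ideal_hull)
  have F: "eqF K M S \<mu> \<in> J"
    unfolding J_def by (intro hull_inc) simp
  have v: "vanishes_on_shell K M S x \<longleftrightarrow> x \<in> J" for x
    by (simp add: vanishes_on_shell_def J_def)
  show "vanishes_on_shell K M S (w * eqF K M S \<mu>)" "vanishes_on_shell K M S 0"
    "vanishes_on_shell K M S x \<Longrightarrow> vanishes_on_shell K M S y \<Longrightarrow> vanishes_on_shell K M S (x + y)"
    using J F unfolding v two_sided_ideal_def by blast+
  show "vanishes_on_shell K M S x \<Longrightarrow> vanishes_on_shell K M S (r *\<^sub>R x)"
    unfolding v by (rule two_sided_ideal_scaleR[OF J])
  show "(\<And>i. i \<in> I \<Longrightarrow> vanishes_on_shell K M S (f i)) \<Longrightarrow> vanishes_on_shell K M S (sum f I)"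
    unfolding v by (rule two_sided_ideal_sum[OF J])
qed

lemma vanishes_on_shell_uminus: "vanishes_on_shell K M S x \<Longrightarrow> vanishes_on_shell K M S (- x)"
  using vanishes_on_shell_closed(4)[of K M S x "-1"] by simp

text \<open>Every summand of the trivial terms ends in a factor F, hence is a multiple of a
  generator of the ideal.\<close>

lemma vanishes_on_shell_striv:
  "vanishes_on_shell K M S (striv_field K N M S \<alpha>)"
  "vanishes_on_shell K M S (striv_ghost K N M S \<alpha>)"
proof -
  have "vanishes_on_shell K M S (striv_B K N M S \<mu>)" for \<mu>
    unfolding striv_B_def diff_conv_add_uminus scaleR_minus_left
    by (intro vanishes_on_shell_closed vanishes_on_shell_uminus)
  then show "vanishes_on_shell K M S (striv_field K N M S \<alpha>)"
    by (cases \<alpha>) (simp_all add: vanishes_on_shell_closed(2))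
  have "vanishes_on_shell K M S (striv_psi K N M S \<mu>)" for \<mu>
    unfolding striv_psi_def by (intro vanishes_on_shell_closed)
  then show "vanishes_on_shell K M S (striv_ghost K N M S \<alpha>)"
    by (cases \<alpha>) (simp_all add: vanishes_on_shell_closed(2) vanishes_on_shell_uminus)
qed

context sigma_model_setup
begin

theorem covariant_brst:
  "snab_field K N M S \<alpha> = covD N M S e \<alpha> + contr1 (pull S) D e (Q \<alpha>) + striv_field K N M S \<alpha>"
  "snab_ghost K N M S \<alpha> = covD N M S et \<alpha> - contr1 (pull S) D et (Q \<alpha>)
    - (1/2) *\<^sub>R contr2 (pull S) D e e (Q \<alpha>) + striv_ghost K N M S \<alpha>"
  "snab_ghost2 K N M S \<alpha> = contr2 (pull S) D et e (Q \<alpha>) + (1/6) *\<^sub>R contr3 (pull S) D e (Q \<alpha>)"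
proof -
  have dd0: "dd S 0 = 0"
    by (rule linear_0[OF dd_linear])
  have neg: "dd S (- x) = - dd S x" for x
    by (rule linear_neg[OF dd_linear])
  show "snab_field K N M S \<alpha> = covD N M S e \<alpha> + contr1 (pull S) D e (Q \<alpha>) + striv_field K N M S \<alpha>"
    by (cases \<alpha>) (simp_all add: contr_Base dd0 neg s0_Xf R_def field_Frame field_Fibre sum_omg sum_negf del: Qcomp.simps Dcov.simps)
  show "snab_ghost K N M S \<alpha> = covD N M S et \<alpha> - contr1 (pull S) D et (Q \<alpha>)
    - (1/2) *\<^sub>R contr2 (pull S) D e e (Q \<alpha>) + striv_ghost K N M S \<alpha>"
    by (cases \<alpha>) (simp_all add: contr_Base dd0 neg ghost_Frame ghost_Fibre sum_negf del: Qcomp.simps Dcov.simps)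
  show "snab_ghost2 K N M S \<alpha> = contr2 (pull S) D et e (Q \<alpha>) + (1/6) *\<^sub>R contr3 (pull S) D e (Q \<alpha>)"
    by (cases \<alpha>) (simp_all add: contr_Base contr_Frame ghost2_Fibre del: Qcomp.simps Dcov.simps)
qed

end

section \<open>Passage from a connection to its torsionless part\<close>

lemma omg_torsionless [simp]: "omg (torsionless N) = omg N"
  by (simp add: torsionless_def)

lemma gam_torsionless: "gam (torsionless N) \<nu> \<mu> \<sigma> x = (gam N \<nu> \<mu> \<sigma> x + gam N \<nu> \<sigma> \<mu> x) / 2"
  by (simp add: torsionless_def)

lemma gam_torsionless_sym: "gam (torsionless N) \<nu> \<mu> \<sigma> = gam (torsionless N) \<nu> \<sigma> \<mu>"
  by (simp add: fun_eq_iff gam_torsionless add.commute)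

lemma torsionless_torsionless [simp]: "torsionless (torsionless N) = torsionless N"
  by (rule torsionless_id) (rule gam_torsionless_sym)

lemma om_low_torsionless [simp]: "om_low K (torsionless N) = om_low K N"
  by (simp add: om_low_def fun_eq_iff)

lemma covariant_fields_torsionless [simp]:
  "B_nab K (torsionless N) M S = B_nab K N M S"
  "psi_nab K (torsionless N) M S = psi_nab K N M S"
  "psit_nab K (torsionless N) M S = psit_nab K N M S"
  by (simp_all add: fun_eq_iff B_nab_def psi_nab_def psit_nab_def)

lemma sbar_torsionless [simp]:
  "sbar_up (torsionless N) M S = sbar_up N M S"
  "sbar_down (torsionless N) M S = sbar_down N M S"
  by (simp_all add: fun_eq_iff sbar_up_def sbar_down_def)

lemma omega_sq_torsionless [simp]: "omega_sq K (torsionless N) = omega_sq K N"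
  by (simp add: fun_eq_iff omega_sq_def)

lemma curv_low_torsionless [simp]: "curv_low K (torsionless N) = curv_low K N"
  by (simp add: fun_eq_iff curv_low_def curv_def)

text \<open>Gamma occurs here only as \<open>gam (torsionless N)\<close>, and
  \<open>torsionless\<close> is idempotent and does not change omega.\<close>

lemma snab_torsionless:
  "snab_field K (torsionless N) M S \<alpha> = snab_field K N M S \<alpha>"
  "snab_ghost K (torsionless N) M S \<alpha> = snab_ghost K N M S \<alpha>"
  "snab_ghost2 K (torsionless N) M S \<alpha> = snab_ghost2 K N M S \<alpha>"
  by (cases \<alpha>; simp add: snab_A_def snab_B_def snab_psi_def)+

lemma striv_torsionless:
  "striv_field K (torsionless N) M S \<alpha> = striv_field K N M S \<alpha>"
  "striv_ghost K (torsionless N) M S \<alpha> = striv_ghost K N M S \<alpha>"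
  by (cases \<alpha>; simp add: striv_B_def striv_psi_def)+

lemma ghost_torsionless:
  "ghost K (torsionless N) M S = ghost K N M S"
  "ghost2 K (torsionless N) M S = ghost2 K N M S"
proof -
  have "ghost K (torsionless N) M S \<alpha> = ghost K N M S \<alpha>" "ghost2 K (torsionless N) M S \<alpha> = ghost2 K N M S \<alpha>" for \<alpha>
    by (cases \<alpha>; simp)+
  then show "ghost K (torsionless N) M S = ghost K N M S" "ghost2 K (torsionless N) M S = ghost2 K N M S"
    by blast+
qed

lemma smooth_connection_torsionless:
  assumes "open U" "smooth_connection U N"
  shows "smooth_connection U (torsionless N)"
proof -
  have "smooth_fun U (gam (torsionless N) \<nu> \<mu> \<sigma>)" for \<nu> \<mu> \<sigma>
  proof -
    have "gam (torsionless N) \<nu> \<mu> \<sigma> = (\<lambda>x. 1/2 * (gam N \<nu> \<mu> \<sigma> x + gam N \<nu> \<sigma> \<mu> x))"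
      by (simp add: fun_eq_iff gam_torsionless)
    with assms show ?thesis
      by (simp only:) (intro smooth_fun_cmult smooth_fun_add; simp add: smooth_connection_def)
  qed
  with assms show ?thesis by (simp add: smooth_connection_def)
qed

theorem proposition3p49:
  fixes U :: "(real^'m::finite) set"
    and K :: "('m, 'a::finite) courant_data"
    and N :: "('m, 'a) connection"
    and M :: "('o::real_algebra_1, 'm, 'a) graded_target"
    and S :: "('w::real_algebra_1, 'o, 'm, 'a) sigma_model"
  assumes "twisted_courant U K"
    and "smooth_connection U N"
    and "metric_connection U K N"
    and "target_functions U M"
    and "field_algebra U M S"
    and "brst_transformation K M S"
  shows "let D = Dcov K (torsionless N) M;
             Q = Qcomp K (torsionless N) M;
             dcov = covD (torsionless N) M S;
             e = ghost K N M S;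
             et = ghost2 K N M S
         in \<forall>\<alpha>.
           snab_field K N M S \<alpha> =
             dcov e \<alpha> + contr1 (pull S) D e (Q \<alpha>) + striv_field K N M S \<alpha> \<and>
           snab_ghost K N M S \<alpha> =
             dcov et \<alpha> - contr1 (pull S) D et (Q \<alpha>)
             - (1/2) *\<^sub>R contr2 (pull S) D e e (Q \<alpha>) + striv_ghost K N M S \<alpha> \<and>
           snab_ghost2 K N M S \<alpha> =
             contr2 (pull S) D et e (Q \<alpha>) + (1/6) *\<^sub>R contr3 (pull S) D e (Q \<alpha>) \<and>
           vanishes_on_shell K M S (striv_field K N M S \<alpha>) \<and>
           vanishes_on_shell K M S (striv_ghost K N M S \<alpha>)"
proof -
  have "open U"
    using assms(1) unfolding twisted_courant_def by blast
  \<comment> \<open>With this instance the derivations, Q and \<open>covD\<close> of the locale are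
    those of the theorem, while the transformation, the ghosts and the trivial terms are rewritten
    back to \<open>N\<close>.\<close>
  interpret sigma_model_setup U K "torsionless N" M S
    by unfold_locales
      (use assms smooth_connection_torsionless[OF \<open>open U\<close>] gam_torsionless_sym in
        \<open>simp_all add: metric_connection_def\<close>)
  show ?thesis
    unfolding Let_def
    using covariant_brst[unfolded snab_torsionless striv_torsionless ghost_torsionless]
    by (intro allI conjI vanishes_on_shell_striv)
qed

end
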